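(* Let $K$ be a finite, connected, abstract simplicial complex, and let $\mathcal{M}(K)$ be its Morse complex. Then, with equalities of complexes understood up to simplicial isomorphism, $$ \mathrm{Aut}(\mathcal{M}(K))\cong \begin{cases} \mathrm{Aut}(K) & \text{if } K \text{ is neither } \partial\Delta^n \text{ nor } C_n \text{ for any } n,\\ \mathrm{Aut}(C_{2n}) & \text{if } K= C_n \text{ for some } n,\\ \mathrm{Aut}(K)\times \mathbb{Z}_2 & \text{if } K= \partial\Delta^n \text{ for some } n, \end{cases} $$ where $\cong$ denotes isomorphism of groups.
   Context: Simplices are nonempty finite sets of vertices. For simplices, $\sigma^{(p)}$ means that $\sigma$ has dimension $p$, and $\tau<\sigma$ means that $\tau$ is a face of $\sigma$ of strictly smaller dimension. A simplicial map $f\colon K\to L$ is a function on simplices induced by a map of vertex sets that sends simplices to simplices; a simplicial automorphism of $K$ is a bijective simplicial map $K\to K$, and $\mathrm{Aut}(K)$ is the group of these under composition. (If a complex has no vertices, its automorphism group is trivial.) For $n\ge 3$, $C_n$ is the cycle of length $n$: the 1-dimensional complex with vertices $v_0,\dots,v_{n-1}$ and edges $\{v_0,v_1\},\{v_1,v_2\},\dots,\{v_{n-2},v_{n-1}\},\{v_{n-1},v_0\}$. For $n\ge 1$, $\partial\Delta^n$ is the boundary of the $n$-simplex: the complex whose simplices are all nonempty proper subsets of $\{v_0,\dots,v_n\}$. Morse complex. A discrete vector field $V$ on $K$ is a set of pairs $(\sigma^{(p)},\tau^{(p+1)})$ of simplices of $K$ with $\sigma<\tau$ such that each simplex of $K$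 is in at most one pair; the pairs are called regular pairs. A $V$-path is a sequence $\alpha_0^{(p)},\beta_0^{(p+1)},\alpha_1^{(p)},\dots,\beta_{k-1}^{(p+1)},\alpha_k^{(p)}$ of simplices of $K$ with $(\alpha_i,\beta_i)\in V$ and $\beta_i>\alpha_{i+1}\ne\alpha_i$ for $0\le i\le k-1$; it is non-trivial if $k\neq 0$ and closed if $\alpha_k=\alpha_0$. A gradient vector field is a discrete vector field with no non-trivial closed $V$-path. It is primitive if it has exactly one regular pair. The Morse complex $\mathcal{M}(K)$ is the simplicial complex whose vertices are the primitive gradient vector fields on $K$ (i.e. the pairs $(\sigma^{(p)},\tau^{(p+1)})$ with $\sigma<\tau$) and whose $n$-simplices are the gradient vector fields with $n+1$ regular pairs, such a gradient vector field being identified with the set of primitive gradient vector fields given by its regular pairs. *)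

theory Defs
  imports "HOL-Algebra.Algebra"
begin

definition abstract_complex :: "'a set set \<Rightarrow> bool" where
  "abstract_complex K \<longleftrightarrow>
     (\<forall>\<sigma>\<in>K. finite \<sigma> \<and> \<sigma> \<noteq> {}) \<and>
     (\<forall>\<sigma>\<in>K. \<forall>\<tau>. \<tau> \<subseteq> \<sigma> \<and> \<tau> \<noteq> {} \<longrightarrow> \<tau> \<in> K)"

definition has_dim :: "'a set \<Rightarrow> nat \<Rightarrow> bool" where
  "has_dim \<sigma> p \<longleftrightarrow> finite \<sigma> \<and> card \<sigma> = p + 1"

text \<open>The vertex set of \<open>K\<close> is \<open>\<Union>K\<close>.  The empty complex counts as connected here.\<close>

definition connected_complex :: "'a set set \<Rightarrow> bool" where
  "connected_complex K \<longleftrightarrow> (\<forall>u\<in>\<Union>K. \<forall>v\<in>\<Union>K. (u, v) \<in> {(x, y). {x, y} \<in> K}\<^sup>*)"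

definition simplicial_map :: "'a set set \<Rightarrow> 'b set set \<Rightarrow> ('a set \<Rightarrow> 'b set) \<Rightarrow> bool" where
  "simplicial_map K L f \<longleftrightarrow>
     (\<exists>g. g ` \<Union>K \<subseteq> \<Union>L \<and> (\<forall>\<sigma>\<in>K. g ` \<sigma> \<in> L \<and> f \<sigma> = g ` \<sigma>))"

text \<open>The inverse of a simplicial map that is bijective on simplices is again simplicial,
  so no condition on the inverse is needed in the next two definitions.\<close>

definition simplicially_isomorphic :: "'a set set \<Rightarrow> 'b set set \<Rightarrow> bool" where
  "simplicially_isomorphic K L \<longleftrightarrow> (\<exists>f. simplicial_map K L f \<and> bij_betw f K L)"

definition Aut :: "'a set set \<Rightarrow> ('a set \<Rightarrow> 'a set) monoid" where
  "Aut K = BijGroup K \<lparr>carrier := {f \<in> Bij K. simplicial_map K K f}\<rparr>"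

definition cycle_complex :: "nat \<Rightarrow> nat set set" where
  "cycle_complex n = {{i} | i. i < n} \<union> {{i, (i + 1) mod n} | i. i < n}"

definition boundary_simplex :: "nat \<Rightarrow> nat set set" where
  "boundary_simplex n = {\<sigma>. \<sigma> \<noteq> {} \<and> \<sigma> \<subset> {0..n}}"

definition primitive_pairs :: "'a set set \<Rightarrow> ('a set \<times> 'a set) set" where
  "primitive_pairs K =
     {(\<sigma>, \<tau>). \<sigma> \<in> K \<and> \<tau> \<in> K \<and> \<sigma> \<subset> \<tau> \<and> (\<exists>p. has_dim \<sigma> p \<and> has_dim \<tau> (p + 1))}"

definition discrete_vector_field :: "'a set set \<Rightarrow> ('a set \<times> 'a set) set \<Rightarrow> bool" where
  "discrete_vector_field K V \<longleftrightarrow>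
     V \<subseteq> primitive_pairs K \<and>
     (\<forall>\<rho>\<in>K. \<forall>x\<in>V. \<forall>y\<in>V. \<rho> \<in> {fst x, snd x} \<and> \<rho> \<in> {fst y, snd y} \<longrightarrow> x = y)"

text \<open>The \<open>V\<close>-path \<open>\<alpha> 0, \<beta> 0, \<alpha> 1, \<dots>, \<beta> (k - 1), \<alpha> k\<close>;
  the values \<open>\<alpha> i\<close> for \<open>i > k\<close> and \<open>\<beta> i\<close> for \<open>i \<ge> k\<close> are irrelevant.\<close>

definition V_path ::
  "'a set set \<Rightarrow> ('a set \<times> 'a set) set \<Rightarrow> nat \<Rightarrow> nat \<Rightarrow> (nat \<Rightarrow> 'a set) \<Rightarrow> (nat \<Rightarrow> 'a set) \<Rightarrow> bool"
where
  "V_path K V p k \<alpha> \<beta> \<longleftrightarrow>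
     (\<forall>i\<le>k. \<alpha> i \<in> K \<and> has_dim (\<alpha> i) p) \<and>
     (\<forall>i<k. \<beta> i \<in> K \<and> has_dim (\<beta> i) (p + 1) \<and>
            (\<alpha> i, \<beta> i) \<in> V \<and> \<alpha> (i + 1) \<subset> \<beta> i \<and> \<alpha> (i + 1) \<noteq> \<alpha> i)"

definition gradient_vector_field :: "'a set set \<Rightarrow> ('a set \<times> 'a set) set \<Rightarrow> bool" where
  "gradient_vector_field K V \<longleftrightarrow>
     discrete_vector_field K V \<and>
     \<not> (\<exists>p k \<alpha> \<beta>. V_path K V p k \<alpha> \<beta> \<and> k \<noteq> 0 \<and> \<alpha> k = \<alpha> 0)"

text \<open>A primitive gradient vector field is identified with its unique regular pair, so a
  gradient vector field is itself the set of vertices of its simplex.\<close>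

definition morse_complex :: "'a set set \<Rightarrow> ('a set \<times> 'a set) set set" where
  "morse_complex K = {V. gradient_vector_field K V \<and> finite V \<and> V \<noteq> {}}"

end

(* The pairs forming the vertices of the Morse complex are the edges of the Hasse diagram H of K,
   and two of them are compatible exactly when they are disjoint.  Since H is connected and
   triangle-free, Whitney's argument shows that an automorphism of the Morse complex is induced by
   a unique graph automorphism f of H.  The three pairs of the hexagon in the middle of an interval
   [w, w + abc] form a closed path, hence a minimal non-face, and f has to carry it to another one;
   this forces f to map chains of two covers to such chains, increasing or decreasing.  As the same
   holds for the inverse of f, adjacent edges of H are treated alike, so by connectedness f either
   preserves or reverses all covers.  Conversely all such f act on the Morse complex.

   Cover-preserving maps are the simplicial automorphisms of K.  If a cover-reversing map exists,
   then every vertex lies in as many edges, and in as many facets, as a facet has vertices, and this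
   leaves only cycles and boundaries of simplices.  For a cycle, H is a cycle of twice the length;
   for the boundary of a simplex, taking complements is a central cover-reversing involution. *)

theory Submission
  imports Defs
begin

section \<open>Gradient vector fields as acyclic matchings\<close>

text \<open>The Morse complex is in general not a flag complex: its edges see only disjointness of
  pairs, so they recover the Hasse diagram as an undirected graph, and the direction of the covers
  has to be read off from larger non-faces. Three is the smallest number of pairs that can be
  incompatible without sharing a simplex, and such an incompatibility forces all three onto one
  level. Every chain of two covers has a hexagon available: remove one vertex from the bottom
  simplex. What remains may be empty, since it is not itself a node of the hexagon. Whitney's
  exceptional graphs contain triangles or come from them, so they do not arise; nor does an isolated
  edge, whose two ends no action on edges could tell apart, because a simplex with at least two
  vertices has at least two faces of codimension one. A vertex of \<open>K\<close> can still have
  degree one in the diagram, which is why vertices and larger simplices receive their images by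
  different arguments.\<close>

definition ends :: "'b \<times> 'b \<Rightarrow> 'b set" where
  "ends x = {fst x, snd x}"

text \<open>Closed \<open>V\<close>-paths are the cycles of this relation on \<open>V\<close>.\<close>

definition flow :: "('a set \<times> 'a set) set \<Rightarrow> (('a set \<times> 'a set) \<times> ('a set \<times> 'a set)) set" where
  "flow V = {(x, y). x \<in> V \<and> y \<in> V \<and> x \<noteq> y \<and> fst y \<subset> snd x \<and> card (fst y) = card (fst x)}"

lemma flow_mono: "U \<subseteq> V \<Longrightarrow> flow U \<subseteq> flow V"
  by (auto simp: flow_def)

lemma acyclic_singleton: "a \<noteq> b \<Longrightarrow> acyclic {(a, b)}"
  by (intro wf_acyclic) (simp add: wf_insert)

locale finite_complex =
  fixes K :: "'a set set"
  assumes complex: "abstract_complex K" and fin: "finite K"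
begin

abbreviation P where "P \<equiv> primitive_pairs K"

lemma simplex_finite: "\<sigma> \<in> K \<Longrightarrow> finite \<sigma>"
  and simplex_nonempty: "\<sigma> \<in> K \<Longrightarrow> \<sigma> \<noteq> {}"
  and face_closed: "\<sigma> \<in> K \<Longrightarrow> \<tau> \<subseteq> \<sigma> \<Longrightarrow> \<tau> \<noteq> {} \<Longrightarrow> \<tau> \<in> K"
  using complex unfolding abstract_complex_def by blast+

lemma card_pos: "\<sigma> \<in> K \<Longrightarrow> 0 < card \<sigma>"
  using simplex_finite simplex_nonempty by (simp add: card_gt_0_iff)

lemma pair_iff: "(\<sigma>, \<tau>) \<in> P \<longleftrightarrow> \<sigma> \<in> K \<and> \<tau> \<in> K \<and> \<sigma> \<subset> \<tau> \<and> card \<tau> = Suc (card \<sigma>)"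
proof -
  have "\<exists>p. card \<sigma> = p + 1" if "\<sigma> \<in> K"
    using card_pos[OF that] by (metis Suc_eq_plus1 gr0_implies_Suc)
  then show ?thesis
    using simplex_finite by (auto simp: primitive_pairs_def has_dim_def)
qed

lemma pairD:
  assumes "x \<in> P"
  shows "fst x \<in> K" "snd x \<in> K" "fst x \<subset> snd x" "card (snd x) = Suc (card (fst x))"
  using assms pair_iff[of "fst x" "snd x"] by auto

lemma insert_pair: "insert a \<sigma> \<in> K \<Longrightarrow> \<sigma> \<noteq> {} \<Longrightarrow> a \<notin> \<sigma> \<Longrightarrow> (\<sigma>, insert a \<sigma>) \<in> P"
  using face_closed[of "insert a \<sigma>" \<sigma>] simplex_finite[of "insert a \<sigma>"] by (auto simp: pair_iff)

lemma remove_pair: "\<tau> \<in> K \<Longrightarrow> a \<in> \<tau> \<Longrightarrow> \<tau> \<noteq> {a} \<Longrightarrow> (\<tau> - {a}, \<tau>) \<in> P"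
  using insert_pair[of a "\<tau> - {a}"] by (auto simp: insert_absorb)

lemma finite_pairs: "finite P"
proof (rule finite_subset)
  show "P \<subseteq> K \<times> K" by (auto simp: primitive_pairs_def)
qed (simp add: fin)

lemma ends_inj: "x \<in> P \<Longrightarrow> y \<in> P \<Longrightarrow> ends x = ends y \<Longrightarrow> x = y"
  by (cases x; cases y) (auto simp: ends_def pair_iff doubleton_eq_iff)

text \<open>Equal size and distinctness make the union of \<sigma> and \<sigma>' strictly larger
  than \<sigma>, so it fills any common cover. Both the absence of closed paths of length two and
  the contradiction at the top of a hexagon rest on this.\<close>

lemma two_covers_unique:
  assumes "(\<sigma>, \<tau>) \<in> P" "(\<sigma>', \<tau>) \<in> P" "(\<sigma>, \<tau>') \<in> P" "(\<sigma>', \<tau>') \<in> P" "\<sigma> \<noteq> \<sigma>'"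
  shows "\<tau> = \<tau>'"
proof -
  have *: "\<sigma> \<union> \<sigma>' = \<rho>" if "(\<sigma>, \<rho>) \<in> P" "(\<sigma>', \<rho>) \<in> P" for \<rho>
  proof (rule card_seteq)
    show "finite \<rho>" using that simplex_finite pair_iff by blast
    show "\<sigma> \<union> \<sigma>' \<subseteq> \<rho>" using that by (auto simp: pair_iff)
    have "finite (\<sigma> \<union> \<sigma>')" using that simplex_finite pair_iff by blast
    moreover have "card \<sigma> = card \<sigma>'" using that by (auto simp: pair_iff)
    with \<open>\<sigma> \<noteq> \<sigma>'\<close> have "\<sigma> \<subset> \<sigma> \<union> \<sigma>'"
      using calculation by (metis Un_upper1 card_seteq finite_Un le_refl psubsetI sup.order_iff sup_commute)
    ultimately have "card \<sigma> < card (\<sigma> \<union> \<sigma>')" by (rule psubset_card_mono)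
    then show "card \<rho> \<le> card (\<sigma> \<union> \<sigma>')" using that by (auto simp: pair_iff)
  qed
  show ?thesis using assms *[of \<tau>] *[of \<tau>'] by simp
qed

text \<open>A closed path with k steps is a k-step return in \<open>flow V\<close>: in a matching,
  distinct pairs are the same as pairs with distinct lower simplices, and the cardinality condition
  in \<open>flow\<close> keeps the dimension fixed. From here on only acyclicity of a relation on
  pairs is used.\<close>

lemma gradient_iff:
  "gradient_vector_field K V \<longleftrightarrow>
     V \<subseteq> P \<and> (\<forall>x\<in>V. \<forall>y\<in>V. x \<noteq> y \<longrightarrow> ends x \<inter> ends y = {}) \<and> acyclic (flow V)"
proof -
  let ?C = "\<exists>p k \<alpha> \<beta>. V_path K V p k \<alpha> \<beta> \<and> k \<noteq> 0 \<and> \<alpha> k = \<alpha> 0"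
  have matching: "discrete_vector_field K V \<longleftrightarrow>
      V \<subseteq> P \<and> (\<forall>x\<in>V. \<forall>y\<in>V. x \<noteq> y \<longrightarrow> ends x \<inter> ends y = {})" (is "?L \<longleftrightarrow> ?R")
  proof
    assume ?L
    then show ?R
      unfolding discrete_vector_field_def ends_def
      using pairD(1,2) by (smt (verit) disjoint_iff insert_iff singletonD subsetD)
  next
    assume ?R
    then show ?L
      unfolding discrete_vector_field_def ends_def by blast
  qed
  have "?C \<longleftrightarrow> \<not> acyclic (flow V)"
    if V: "V \<subseteq> P" "\<forall>x\<in>V. \<forall>y\<in>V. x \<noteq> y \<longrightarrow> ends x \<inter> ends y = {}"
  proof
    assume "\<exists>p k \<alpha> \<beta>. V_path K V p k \<alpha> \<beta> \<and> k \<noteq> 0 \<and> \<alpha> k = \<alpha> 0"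
    then obtain p k \<alpha> \<beta> where path: "V_path K V p k \<alpha> \<beta>" and k: "k \<noteq> 0" "\<alpha> k = \<alpha> 0" by blast
    \<comment> \<open>The last simplex of the path has no partner listed. Since
      \<open>\<alpha> k = \<alpha> 0\<close>, it is given the partner \<open>\<beta> 0\<close>,
      which makes \<open>f k\<close> and \<open>f 0\<close> the same pair.\<close>
    define f where "f i = (\<alpha> i, \<beta> (if i < k then i else 0))" for i
    have inV: "f i \<in> V" if "i \<le> k" for i
      using path that k by (cases "i = k") (auto simp: V_path_def f_def)
    have "(f i, f (Suc i)) \<in> flow V" if "i < k" for i
      using path that inV[of i] inV[of "Suc i"]
      by (auto simp: flow_def V_path_def has_dim_def f_def)
    moreover have "f 0 = f k" using k by (simp add: f_def)
    ultimately have "(f 0, f 0) \<in> (flow V) ^^ k"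
      unfolding relpow_fun_conv by (intro exI[of _ f]) simp
    then have "(f 0, f 0) \<in> (flow V)\<^sup>+" using k by (auto simp: trancl_power)
    then show "\<not> acyclic (flow V)" unfolding acyclic_def by blast
  next
    assume "\<not> acyclic (flow V)"
    then obtain a where "(a, a) \<in> (flow V)\<^sup>+" unfolding acyclic_def by blast
    then obtain n where n: "n > 0" "(a, a) \<in> (flow V) ^^ n" by (auto simp: trancl_power)
    then obtain f where f: "f 0 = a" "f n = a" "\<And>i. i < n \<Longrightarrow> (f i, f (Suc i)) \<in> flow V"
      unfolding relpow_fun_conv by blast
    have inV: "f i \<in> V" if "i \<le> n" for i
      using that f(3)[of i] f(3)[of 0] n(1) f(1,2) by (cases "i = n") (auto simp: flow_def)
    have card: "card (fst (f i)) = card (fst a)" if "i \<le> n" for i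
      using that
    proof (induction i)
      case (Suc i)
      then show ?case using f(3)[of i] by (simp add: flow_def)
    qed (simp add: f)
    have P: "f i \<in> P" if "i \<le> n" for i using inV that V by blast
    have "fst a \<in> K" using P[of 0] pairD(1) f(1) by auto
    \<comment> \<open>Dimension is cardinality minus one; nonemptiness keeps the natural subtraction
      from being truncated.\<close>
    then have pos: "card (fst a) = (card (fst a) - 1) + 1" using card_pos by fastforce
    have "V_path K V (card (fst a) - 1) n (fst \<circ> f) (snd \<circ> f)"
      unfolding V_path_def
    proof (intro conjI allI impI)
      fix i assume i: "i \<le> n"
      show "(fst \<circ> f) i \<in> K" using pairD(1)[OF P[OF i]] by simp
      then show "has_dim ((fst \<circ> f) i) (card (fst a) - 1)"
        using card[OF i] pos simplex_finite by (simp add: has_dim_def)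
    next
      fix i assume i: "i < n"
      then have i': "i \<le> n" "Suc i \<le> n" by auto
      show K: "(snd \<circ> f) i \<in> K" using pairD(2)[OF P[OF i'(1)]] by simp
      show "has_dim ((snd \<circ> f) i) (card (fst a) - 1 + 1)"
        using card[OF i'(1)] pos simplex_finite K pairD(4)[OF P[OF i'(1)]] by (simp add: has_dim_def)
      show "((fst \<circ> f) i, (snd \<circ> f) i) \<in> V" using inV[OF i'(1)] by simp
      show "(fst \<circ> f) (i + 1) \<subset> (snd \<circ> f) i" using f(3)[OF i] by (simp add: flow_def)
      have "f (Suc i) \<noteq> f i" using f(3)[OF i] by (auto simp: flow_def)
      then have "ends (f (Suc i)) \<inter> ends (f i) = {}" using V(2) inV i' by blast
      then show "(fst \<circ> f) (i + 1) \<noteq> (fst \<circ> f) i" by (auto simp: ends_def)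
    qed
    then show "\<exists>p k \<alpha> \<beta>. V_path K V p k \<alpha> \<beta> \<and> k \<noteq> 0 \<and> \<alpha> k = \<alpha> 0"
      using n(1) f(1,2) by (metis comp_apply less_numeral_extra(3))
  qed
  then show ?thesis
    unfolding gradient_vector_field_def matching by argo
qed

lemma morse_iff:
  "V \<in> morse_complex K \<longleftrightarrow>
     V \<noteq> {} \<and> V \<subseteq> P \<and> (\<forall>x\<in>V. \<forall>y\<in>V. x \<noteq> y \<longrightarrow> ends x \<inter> ends y = {}) \<and> acyclic (flow V)"
  unfolding morse_complex_def gradient_iff
  using finite_subset[OF _ finite_pairs] by auto

lemma morse_singleton: "x \<in> P \<Longrightarrow> {x} \<in> morse_complex K"
proof -
  have "flow {x} = {}" by (auto simp: flow_def)
  then show "x \<in> P \<Longrightarrow> {x} \<in> morse_complex K" by (simp add: morse_iff acyclic_def)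
qed

lemma Union_morse: "\<Union> (morse_complex K) = P"
  proof
  show "\<Union> (morse_complex K) \<subseteq> P" by (auto simp: morse_iff)
  show "P \<subseteq> \<Union> (morse_complex K)" using morse_singleton by blast
qed

lemma finite_complex_morse: "finite_complex (morse_complex K)"
proof
  show "finite (morse_complex K)"
    by (rule finite_subset[of _ "Pow P"]) (auto simp: morse_iff finite_pairs)
  show "abstract_complex (morse_complex K)"
    unfolding abstract_complex_def
  proof (intro conjI ballI allI impI)
    fix \<sigma> \<tau> assume "\<sigma> \<in> morse_complex K" "\<tau> \<subseteq> \<sigma> \<and> \<tau> \<noteq> {}"
    then show "\<tau> \<in> morse_complex K"
      unfolding morse_iff using acyclic_subset[OF _ flow_mono] by blast
  qed (auto simp: morse_iff intro: finite_subset[OF _ finite_pairs])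
qed

text \<open>Steps in both directions would put both lower simplices under both upper ones, that is,
  two distinct simplices with two distinct common covers.\<close>

lemma no_two_step_flow:
  assumes "x \<in> P" "y \<in> P" "ends x \<inter> ends y = {}" "(x, y) \<in> flow V"
  shows "(y, x) \<notin> flow V"
proof
  assume yx: "(y, x) \<in> flow V"
  have "(fst x, snd x) \<in> P" "(fst y, snd y) \<in> P" "(fst x, snd y) \<in> P" "(fst y, snd x) \<in> P"
    using assms(1,2,4) yx pairD[of x] pairD[of y] by (auto simp: flow_def pair_iff)
  moreover have "fst x \<noteq> fst y" "snd x \<noteq> snd y" using assms(3) by (auto simp: ends_def)
  ultimately show False using two_covers_unique by blast
qed

text \<open>Closed paths of length two do not exist, so two pairs can only fail to be compatible by
  sharing a simplex. Thus the 1-skeleton of the Morse complex is the complement of the line graph of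
  the Hasse diagram.\<close>

lemma edge_morse_iff:
  assumes "x \<in> P" "y \<in> P" "x \<noteq> y"
  shows "{x, y} \<in> morse_complex K \<longleftrightarrow> ends x \<inter> ends y = {}"
proof
  assume d: "ends x \<inter> ends y = {}"
  have sub: "flow {x, y} \<subseteq> {(x, y), (y, x)}" by (auto simp: flow_def)
  have "flow {x, y} \<subseteq> {(x, y)} \<or> flow {x, y} \<subseteq> {(y, x)}"
    using no_two_step_flow[OF assms(1,2) d, of "{x, y}"] sub by blast
  moreover have "acyclic {(x, y)}" "acyclic {(y, x)}" using assms(3) acyclic_singleton by metis+
  ultimately have "acyclic (flow {x, y})" using acyclic_subset by blast
  then show "{x, y} \<in> morse_complex K" using assms d by (auto simp: morse_iff)
qed (use assms in \<open>auto simp: morse_iff\<close>)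

text \<open>Three disjoint pairs can only be incompatible through a closed path running through all of
  them, since there are no closed paths of length two.\<close>

lemma three_pairs_level:
  assumes V: "{x, y, z} \<subseteq> P" "ends x \<inter> ends y = {}" "ends y \<inter> ends z = {}" "ends x \<inter> ends z = {}"
    and "{x, y, z} \<notin> morse_complex K"
  shows "card (fst x) = card (fst y)"
proof (rule ccontr)
  assume ne: "card (fst x) \<noteq> card (fst y)"
  let ?V = "{x, y, z}"
  have d: "\<forall>a\<in>?V. \<forall>b\<in>?V. a \<noteq> b \<longrightarrow> ends a \<inter> ends b = {}"
    using V(2-4) by (auto simp: Int_commute)
  then have cyc: "\<not> acyclic (flow ?V)"
    using assms(5) V(1) by (auto simp: morse_iff)
  \<comment> \<open>A step of \<open>flow\<close> stays at one size of lower simplices. As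
    \<open>x\<close> and \<open>y\<close> differ there, \<open>z\<close> can share its level with at
    most one of them, and every step joins \<open>z\<close> to that one.\<close>
  have "flow ?V \<subseteq> {(x, z), (z, x)} \<or> flow ?V \<subseteq> {(y, z), (z, y)}"
  proof (cases "card (fst z) = card (fst x)")
    case True
    have "(a, b) \<in> {(x, z), (z, x)}" if "(a, b) \<in> flow ?V" for a b
    proof -
      have "a \<in> ?V" "b \<in> ?V" "a \<noteq> b" "card (fst b) = card (fst a)"
        using that by (simp_all add: flow_def)
      then show ?thesis using ne True by (elim insertE) simp_all
    qed
    then show ?thesis by (intro disjI1 subrelI)
  next
    case False
    have "(a, b) \<in> {(y, z), (z, y)}" if "(a, b) \<in> flow ?V" for a b
    proof -
      have "a \<in> ?V" "b \<in> ?V" "a \<noteq> b" "card (fst b) = card (fst a)"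
        using that by (simp_all add: flow_def)
      then show ?thesis using ne False by (elim insertE) simp_all
    qed
    then show ?thesis by (intro disjI2 subrelI)
  qed
  then obtain c e where ce: "flow ?V \<subseteq> {(c, e), (e, c)}" "c \<in> ?V" "e \<in> ?V"
    by (meson insertI1 insertI2)
  show False
  proof (cases "c = e")
    case True
    then have "(a, b) \<notin> flow ?V" for a b using ce(1) by (auto simp: flow_def simp del: insert_iff)
    then have "flow ?V = {}" by (meson equals0I surj_pair subrelI subset_empty empty_iff)
    then show False using cyc by (simp add: acyclic_def)
  next
    case False
    have "c \<in> P" "e \<in> P" using ce(2,3) V(1) by (meson subsetD)+
    moreover have "ends c \<inter> ends e = {}" using d ce(2,3) False by (meson bspec)
    ultimately have "(c, e) \<notin> flow ?V \<or> (e, c) \<notin> flow ?V"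
      using no_two_step_flow by metis
    then have "flow ?V \<subseteq> {(c, e)} \<or> flow ?V \<subseteq> {(e, c)}"
      using ce(1) by blast
    moreover have "acyclic {(c, e)}" "acyclic {(e, c)}" using False acyclic_singleton by metis+
    ultimately show False using cyc acyclic_subset by blast
  qed
qed

end

section \<open>Automorphism groups of complexes\<close>

text \<open>Closure of the source under products already makes the inverse bijection multiplicative,
  so isomorphisms can be turned round for the map monoids used here without first establishing them
  as groups.\<close>

lemma iso_symI:
  assumes h: "h \<in> iso G H"
    and closed: "\<And>x y. x \<in> carrier G \<Longrightarrow> y \<in> carrier G \<Longrightarrow> x \<otimes>\<^bsub>G\<^esub> y \<in> carrier G"
  shows "H \<cong> G"
proof (rule is_isoI, rule isoI)
  have hom: "h \<in> hom G H" and bij: "bij_betw h (carrier G) (carrier H)"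
    using h by (auto simp: iso_def)
  show bij': "bij_betw (inv_into (carrier G) h) (carrier H) (carrier G)"
    using bij by (rule bij_betw_inv_into)
  show "inv_into (carrier G) h \<in> hom H G"
  proof (rule homI)
    fix x y assume xy: "x \<in> carrier H" "y \<in> carrier H"
    let ?i = "inv_into (carrier G) h"
    have i: "?i x \<in> carrier G" "?i y \<in> carrier G" "h (?i x) = x" "h (?i y) = y"
      using xy bij bij' by (auto simp: bij_betw_inv_into_right dest: bij_betwE)
    then have "h (?i x \<otimes>\<^bsub>G\<^esub> ?i y) = x \<otimes>\<^bsub>H\<^esub> y"
      using hom_mult[OF hom] by simp
    then show "?i (x \<otimes>\<^bsub>H\<^esub> y) = ?i x \<otimes>\<^bsub>G\<^esub> ?i y"
      using bij_betw_inv_into_left[OF bij closed[OF i(1,2)]] by simp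
  next
    fix x assume "x \<in> carrier H"
    then show "inv_into (carrier G) h x \<in> carrier G" using bij' by (auto dest: bij_betwE)
  qed
qed

lemma Bij_bij: "f \<in> Bij S \<Longrightarrow> bij_betw f S S"
  by (simp add: Bij_def)

lemma Bij_mem: "f \<in> Bij S \<Longrightarrow> x \<in> S \<Longrightarrow> f x \<in> S"
  using Bij_imp_funcset by blast

lemma Bij_eq_iff: "f \<in> Bij S \<Longrightarrow> x \<in> S \<Longrightarrow> y \<in> S \<Longrightarrow> f x = f y \<longleftrightarrow> x = y"
  by (meson Bij_bij bij_betw_imp_inj_on inj_on_eq_iff)

lemma Bij_obtain:
  assumes "f \<in> Bij S" "y \<in> S"
  obtains x where "x \<in> S" "f x = y"
  using assms Bij_bij by (metis bij_betw_imp_surj_on imageE)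

lemma Bij_ext: "f \<in> Bij S \<Longrightarrow> g \<in> Bij S \<Longrightarrow> (\<And>x. x \<in> S \<Longrightarrow> f x = g x) \<Longrightarrow> f = g"
  by (meson Bij_imp_extensional extensionalityI)

lemma restrict_Bij: "bij_betw f S S \<Longrightarrow> restrict f S \<in> Bij S"
  by (simp add: Bij_def bij_betw_def inj_on_def)

lemma mult_BijGroup: "f \<in> Bij S \<Longrightarrow> g \<in> Bij S \<Longrightarrow> f \<otimes>\<^bsub>BijGroup S\<lparr>carrier := A\<rparr>\<^esub> g = compose S f g"
  by (simp add: BijGroup_def)

text \<open>\<open>Aut\<close> consists of maps on simplices, whereas the combinatorial arguments
  move vertices, which for the Morse complex are pairs. This is the same group written as
  permutations of the vertex set; over a finite complex, sending simplices to simplices makes the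
  inverse do so too.\<close>

definition vertex_aut :: "'b set set \<Rightarrow> ('b \<Rightarrow> 'b) monoid" where
  "vertex_aut L = BijGroup (\<Union>L) \<lparr>carrier := {g \<in> Bij (\<Union>L). \<forall>\<sigma>\<in>L. g ` \<sigma> \<in> L}\<rparr>"

lemma carrier_vertex_aut: "g \<in> carrier (vertex_aut L) \<longleftrightarrow> g \<in> Bij (\<Union>L) \<and> (\<forall>\<sigma>\<in>L. g ` \<sigma> \<in> L)"
  by (simp add: vertex_aut_def)

lemma carrier_Aut: "f \<in> carrier (Aut K) \<longleftrightarrow> f \<in> Bij K \<and> simplicial_map K K f"
  by (simp add: Aut_def)

context finite_complex
begin

lemma vertex_iff: "v \<in> \<Union>K \<longleftrightarrow> {v} \<in> K"
  using face_closed by blast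

lemma finite_vertices: "finite (\<Union>K)"
  using fin simplex_finite by blast

lemma vertex_map_inj:
  assumes f: "inj_on f K" and g: "\<And>\<sigma>. \<sigma> \<in> K \<Longrightarrow> f \<sigma> = g ` \<sigma>"
  shows "inj_on g (\<Union>K)"
proof (rule inj_onI)
  fix u v assume uv: "u \<in> \<Union>K" "v \<in> \<Union>K" "g u = g v"
  then have K: "{u} \<in> K" "{v} \<in> K" by (simp_all only: vertex_iff)
  then have "f {u} = f {v}" using g uv(3) by simp
  then have "{u} = {v}" using f K by (meson inj_onD)
  then show "u = v" by simp
qed

text \<open>The image map is injective on the finite set \<open>K\<close>, hence onto it, so a
  simplex can only be the image of a simplex.\<close>

lemma vertex_aut_image_iff:
  assumes g: "g \<in> carrier (vertex_aut K)" and \<sigma>: "\<sigma> \<subseteq> \<Union>K"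
  shows "g ` \<sigma> \<in> K \<longleftrightarrow> \<sigma> \<in> K"
proof
  have inj: "inj_on g (\<Union>K)"
    using g unfolding carrier_vertex_aut by (meson Bij_bij bij_betw_imp_inj_on)
  have "inj_on (image g) K"
    using inj by (intro inj_onI) (metis Union_upper inj_on_image_eq_iff)
  then have "image g ` K = K"
    using g fin by (intro endo_inj_surj) (auto simp: carrier_vertex_aut)
  moreover assume "g ` \<sigma> \<in> K"
  ultimately obtain \<tau> where "\<tau> \<in> K" "g ` \<tau> = g ` \<sigma>" by (metis imageE)
  then show "\<sigma> \<in> K"
    using inj \<sigma> by (metis Union_upper inj_on_image_eq_iff)
qed (use g in \<open>simp add: carrier_vertex_aut\<close>)

lemma vertex_aut_inverse:
  assumes g: "g \<in> carrier (vertex_aut K)"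
  shows "restrict (inv_into (\<Union>K) g) (\<Union>K) \<in> carrier (vertex_aut K)"
proof -
  have gB: "g \<in> Bij (\<Union>K)" using g by (simp add: carrier_vertex_aut)
  let ?i = "restrict (inv_into (\<Union>K) g) (\<Union>K)"
  have iB: "?i \<in> Bij (\<Union>K)" using gB by (rule restrict_inv_into_Bij)
  have "?i ` \<sigma> \<in> K" if "\<sigma> \<in> K" for \<sigma>
  proof -
    have "g (?i v) = v" if "v \<in> \<sigma>" for v
      using that \<open>\<sigma> \<in> K\<close> bij_betw_inv_into_right[OF Bij_bij[OF gB]] by auto
    then have "g ` ?i ` \<sigma> = \<sigma>" unfolding image_image by simp
    moreover have "?i ` \<sigma> \<subseteq> \<Union>K" using \<open>\<sigma> \<in> K\<close> Bij_mem[OF iB] by blast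
    ultimately show ?thesis using vertex_aut_image_iff[OF g] \<open>\<sigma> \<in> K\<close> by metis
  qed
  then show ?thesis using iB by (simp add: carrier_vertex_aut)
qed

lemma vertex_aut_compose:
  assumes "f \<in> carrier (vertex_aut K)" "g \<in> carrier (vertex_aut K)"
  shows "f \<otimes>\<^bsub>vertex_aut K\<^esub> g = compose (\<Union>K) f g" "compose (\<Union>K) f g \<in> carrier (vertex_aut K)"
proof -
  have B: "f \<in> Bij (\<Union>K)" "g \<in> Bij (\<Union>K)" using assms by (auto simp: carrier_vertex_aut)
  then show "f \<otimes>\<^bsub>vertex_aut K\<^esub> g = compose (\<Union>K) f g"
    unfolding vertex_aut_def by (rule mult_BijGroup)
  have "compose (\<Union>K) f g ` \<sigma> = f ` g ` \<sigma>" if "\<sigma> \<in> K" for \<sigma>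
    using that unfolding image_image by (intro image_cong) (auto simp: compose_def)
  then show "compose (\<Union>K) f g \<in> carrier (vertex_aut K)"
    using assms B by (simp add: carrier_vertex_aut compose_Bij)
qed

lemma Aut_compose:
  assumes "f \<in> carrier (Aut K)" "g \<in> carrier (Aut K)"
  shows "f \<otimes>\<^bsub>Aut K\<^esub> g = compose K f g" "compose K f g \<in> carrier (Aut K)"
proof -
  have B: "f \<in> Bij K" "g \<in> Bij K" using assms by (auto simp: carrier_Aut)
  then show "f \<otimes>\<^bsub>Aut K\<^esub> g = compose K f g"
    unfolding Aut_def by (rule mult_BijGroup)
  obtain a where a: "a ` \<Union>K \<subseteq> \<Union>K" "\<forall>\<sigma>\<in>K. a ` \<sigma> \<in> K \<and> f \<sigma> = a ` \<sigma>"
    using assms(1) unfolding carrier_Aut simplicial_map_def by (elim conjE exE)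
  obtain b where b: "b ` \<Union>K \<subseteq> \<Union>K" "\<forall>\<sigma>\<in>K. b ` \<sigma> \<in> K \<and> g \<sigma> = b ` \<sigma>"
    using assms(2) unfolding carrier_Aut simplicial_map_def by (elim conjE exE)
  have "simplicial_map K K (compose K f g)"
    unfolding simplicial_map_def
  proof (intro exI[of _ "a \<circ> b"] conjI ballI)
    show "(a \<circ> b) ` \<Union>K \<subseteq> \<Union>K" using a(1) b(1) unfolding image_comp[symmetric] by blast
    fix \<sigma> assume \<sigma>: "\<sigma> \<in> K"
    then have ba: "b ` \<sigma> \<in> K" "g \<sigma> = b ` \<sigma>" using b by auto
    then show "(a \<circ> b) ` \<sigma> \<in> K" "compose K f g \<sigma> = (a \<circ> b) ` \<sigma>"
      unfolding image_comp[symmetric] using a(2) \<sigma> by (simp_all add: compose_def)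
  qed
  then show "compose K f g \<in> carrier (Aut K)"
    using B by (simp add: carrier_Aut compose_Bij)
qed

text \<open>Injectivity is visible on singletons, and surjectivity restricts the vertex map that
  comes with a simplicial map. Restricting to \<open>K\<close> keeps the results extensional, as
  \<open>Bij K\<close> demands.\<close>

lemma vertex_aut_iso_Aut: "(\<lambda>g. restrict (image g) K) \<in> iso (vertex_aut K) (Aut K)"
proof (rule isoI)
  let ?h = "\<lambda>g. restrict (image g) K"
  have into: "?h g \<in> carrier (Aut K)" if g: "g \<in> carrier (vertex_aut K)" for g
  proof -
    have gB: "g \<in> Bij (\<Union>K)" and im: "\<And>\<sigma>. \<sigma> \<in> K \<Longrightarrow> g ` \<sigma> \<in> K"
      using g by (auto simp: carrier_vertex_aut)
    have inj: "inj_on g (\<Union>K)" using gB by (meson Bij_bij bij_betw_imp_inj_on)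
    have "inj_on (?h g) K"
      using inj by (intro inj_onI) (metis Union_upper inj_on_image_eq_iff restrict_apply')
    moreover have "?h g ` K \<subseteq> K" using im by auto
    ultimately have "bij_betw (?h g) K K"
      unfolding bij_betw_def using endo_inj_surj[OF fin] by blast
    then have "?h g \<in> Bij K" by (simp add: Bij_def)
    moreover have "simplicial_map K K (?h g)"
      unfolding simplicial_map_def
      using im Bij_mem[OF gB] by (intro exI[of _ g] conjI) (simp_all add: image_subset_iff)
    ultimately show ?thesis by (simp add: carrier_Aut)
  qed
  show "?h \<in> hom (vertex_aut K) (Aut K)"
  proof (rule homI)
    fix x y assume xy: "x \<in> carrier (vertex_aut K)" "y \<in> carrier (vertex_aut K)"
    have "?h (compose (\<Union>K) x y) = compose K (?h x) (?h y)"
    proof (rule extensionalityI[of _ K])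
      fix \<sigma> assume "\<sigma> \<in> K"
      moreover have "y ` \<sigma> \<in> K" using xy \<open>\<sigma> \<in> K\<close> by (simp add: carrier_vertex_aut)
      ultimately show "?h (compose (\<Union>K) x y) \<sigma> = compose K (?h x) (?h y) \<sigma>"
        unfolding image_image compose_def
        by (auto simp: image_image intro!: image_cong)
    qed (simp_all add: compose_def)
    then show "?h (x \<otimes>\<^bsub>vertex_aut K\<^esub> y) = ?h x \<otimes>\<^bsub>Aut K\<^esub> ?h y"
      using Aut_compose(1)[OF into[OF xy(1)] into[OF xy(2)]] vertex_aut_compose(1)[OF xy] by simp
  qed (rule into)
  show "bij_betw ?h (carrier (vertex_aut K)) (carrier (Aut K))"
    unfolding bij_betw_def
  proof (intro conjI inj_onI equalityI subsetI)
    fix x y assume xy: "x \<in> carrier (vertex_aut K)" "y \<in> carrier (vertex_aut K)" "?h x = ?h y"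
    show "x = y"
    proof (rule Bij_ext[of _ "\<Union>K"])
      fix v assume "v \<in> \<Union>K"
      then have "{v} \<in> K" by (simp only: vertex_iff)
      then have "x ` {v} = y ` {v}" using xy(3) by (metis restrict_apply')
      then show "x v = y v" by simp
    qed (use xy in \<open>auto simp: carrier_vertex_aut\<close>)
  next
    fix f assume "f \<in> ?h ` carrier (vertex_aut K)"
    then show "f \<in> carrier (Aut K)" using into by auto
  next
    fix f assume f: "f \<in> carrier (Aut K)"
    then obtain g where g: "g ` \<Union>K \<subseteq> \<Union>K" "\<And>\<sigma>. \<sigma> \<in> K \<Longrightarrow> g ` \<sigma> \<in> K" "\<And>\<sigma>. \<sigma> \<in> K \<Longrightarrow> f \<sigma> = g ` \<sigma>"
      and fB: "f \<in> Bij K"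
      unfolding carrier_Aut simplicial_map_def by meson
    have "inj_on g (\<Union>K)"
      using vertex_map_inj[OF bij_betw_imp_inj_on[OF Bij_bij[OF fB]] g(3)] .
    then have "bij_betw g (\<Union>K) (\<Union>K)"
      using g(1) finite_vertices by (simp add: bij_betw_def endo_inj_surj)
    then have rB: "restrict g (\<Union>K) \<in> Bij (\<Union>K)"
      by (rule restrict_Bij)
    have im: "restrict g (\<Union>K) ` \<sigma> = g ` \<sigma>" if "\<sigma> \<in> K" for \<sigma>
      using that by (intro image_cong) auto
    have "restrict g (\<Union>K) \<in> carrier (vertex_aut K)"
      using rB im g(2) by (simp add: carrier_vertex_aut)
    moreover have "f = ?h (restrict g (\<Union>K))"
      using Bij_imp_extensional[OF fB] g(3) im by (intro extensionalityI[of _ K]) auto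
    ultimately show "f \<in> ?h ` carrier (vertex_aut K)" by blast
  qed
qed

end

section \<open>Symmetries of the Hasse diagram\<close>

definition cover_preserving :: "'a set set \<Rightarrow> ('a set \<Rightarrow> 'a set) \<Rightarrow> bool" where
  "cover_preserving K f \<longleftrightarrow>
     (\<forall>\<sigma> \<tau>. (\<sigma>, \<tau>) \<in> primitive_pairs K \<longrightarrow> (f \<sigma>, f \<tau>) \<in> primitive_pairs K)"

definition cover_reversing :: "'a set set \<Rightarrow> ('a set \<Rightarrow> 'a set) \<Rightarrow> bool" where
  "cover_reversing K f \<longleftrightarrow>
     (\<forall>\<sigma> \<tau>. (\<sigma>, \<tau>) \<in> primitive_pairs K \<longrightarrow> (f \<tau>, f \<sigma>) \<in> primitive_pairs K)"

text \<open>The intermediate group of the whole argument: it is first identified with the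
  automorphism group of the Morse complex, and then computed separately in each of the three
  cases.\<close>

definition cover_group :: "'a set set \<Rightarrow> ('a set \<Rightarrow> 'a set) monoid" where
  "cover_group K = BijGroup K
     \<lparr>carrier := {f \<in> Bij K. cover_preserving K f \<or> cover_reversing K f}\<rparr>"

lemma carrier_cover_group:
  "f \<in> carrier (cover_group K) \<longleftrightarrow> f \<in> Bij K \<and> (cover_preserving K f \<or> cover_reversing K f)"
  by (simp add: cover_group_def)

text \<open>A pair lists its smaller simplex first, so a reversing map has to exchange the two
  images. For a member of \<open>cover_group\<close>, failing the test means being
  reversing.\<close>

definition pair_map ::
  "'a set set \<Rightarrow> ('a set \<Rightarrow> 'a set) \<Rightarrow> 'a set \<times> 'a set \<Rightarrow> 'a set \<times> 'a set" where
  "pair_map K f = (\<lambda>x\<in>primitive_pairs K.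
     if cover_preserving K f then (f (fst x), f (snd x)) else (f (snd x), f (fst x)))"

section \<open>Order properties of cover symmetries and their relation to simplicial
  automorphisms\<close>

context finite_complex
begin

text \<open>The map induced on pairs is an injection of a finite set into itself, hence onto; so
  every cover between images comes from a cover.\<close>

lemma cover_preserving_iff:
  assumes "f \<in> Bij K" "cover_preserving K f" "\<sigma> \<in> K" "\<tau> \<in> K"
  shows "(f \<sigma>, f \<tau>) \<in> P \<longleftrightarrow> (\<sigma>, \<tau>) \<in> P"
proof
  let ?F = "\<lambda>x. (f (fst x), f (snd x))"
  have "inj_on ?F P"
    by (rule inj_onI) (use Bij_eq_iff[OF assms(1)] pairD in \<open>auto intro: prod_eqI\<close>)
  moreover have "?F ` P \<subseteq> P" using assms(2) by (auto simp: cover_preserving_def)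
  ultimately have "?F ` P = P" using finite_pairs by (intro endo_inj_surj)
  moreover assume "(f \<sigma>, f \<tau>) \<in> P"
  ultimately obtain x where "x \<in> P" "?F x = (f \<sigma>, f \<tau>)" by (metis (no_types, lifting) imageE)
  then show "(\<sigma>, \<tau>) \<in> P"
    using Bij_eq_iff[OF assms(1)] pairD(1,2) assms(3,4) by (metis prod.collapse prod.inject)
qed (use assms in \<open>auto simp: cover_preserving_def\<close>)

lemma cover_reversing_iff:
  assumes "f \<in> Bij K" "cover_reversing K f" "\<sigma> \<in> K" "\<tau> \<in> K"
  shows "(f \<tau>, f \<sigma>) \<in> P \<longleftrightarrow> (\<sigma>, \<tau>) \<in> P"
proof
  let ?F = "\<lambda>x. (f (snd x), f (fst x))"
  have "inj_on ?F P"
    by (rule inj_onI) (use Bij_eq_iff[OF assms(1)] pairD in \<open>auto intro: prod_eqI\<close>)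
  moreover have "?F ` P \<subseteq> P" using assms(2) by (auto simp: cover_reversing_def)
  ultimately have "?F ` P = P" using finite_pairs by (intro endo_inj_surj)
  moreover assume "(f \<tau>, f \<sigma>) \<in> P"
  ultimately obtain x where "x \<in> P" "?F x = (f \<tau>, f \<sigma>)" by (metis (no_types, lifting) imageE)
  then show "(\<sigma>, \<tau>) \<in> P"
    using Bij_eq_iff[OF assms(1)] pairD(1,2) assms(3,4) by (metis prod.collapse prod.inject)
qed (use assms in \<open>auto simp: cover_reversing_def\<close>)

lemma psubset_trancl: "\<sigma> \<in> K \<Longrightarrow> \<tau> \<in> K \<Longrightarrow> \<sigma> \<subset> \<tau> \<Longrightarrow> (\<sigma>, \<tau>) \<in> P\<^sup>+"
proof (induction "card \<tau>" arbitrary: \<tau> rule: less_induct)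
  case less
  then obtain a where a: "a \<in> \<tau>" "a \<notin> \<sigma>" by blast
  have "\<tau> \<noteq> {a}" using less.prems a simplex_nonempty by blast
  then have p: "(\<tau> - {a}, \<tau>) \<in> P" using remove_pair less.prems(2) a by blast
  show ?case
  proof (cases "\<sigma> = \<tau> - {a}")
    case False
    then have "\<sigma> \<subset> \<tau> - {a}" using less.prems(3) a by blast
    moreover have "\<tau> - {a} \<in> K" "card (\<tau> - {a}) < card \<tau>" using p by (auto simp: pair_iff)
    ultimately have "(\<sigma>, \<tau> - {a}) \<in> P\<^sup>+" using less.hyps less.prems(1) by blast
    then show ?thesis using p by (rule trancl_into_trancl)
  qed (use p in blast)
qed

lemma trancl_psubset: "(\<sigma>, \<tau>) \<in> P\<^sup>+ \<Longrightarrow> \<sigma> \<subset> \<tau>"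
  by (induction rule: trancl_induct) (auto simp: pair_iff)

lemma preserving_mono:
  assumes "cover_preserving K f" "\<sigma> \<in> K" "\<tau> \<in> K" "\<sigma> \<subseteq> \<tau>"
  shows "f \<sigma> \<subseteq> f \<tau>"
proof (cases "\<sigma> = \<tau>")
  case False
  have "(f \<sigma>, f \<tau>) \<in> P\<^sup>+" if "(\<sigma>, \<tau>) \<in> P\<^sup>+" for \<sigma> \<tau>
    using that
  proof (induction rule: trancl_induct)
    case (step y z)
    then show ?case using assms(1) by (auto simp: cover_preserving_def intro: trancl_into_trancl)
  qed (use assms(1) in \<open>auto simp: cover_preserving_def\<close>)
  then show ?thesis using trancl_psubset psubset_trancl assms False by blast
qed simp

lemma reversing_antimono:
  assumes "cover_reversing K f" "\<sigma> \<in> K" "\<tau> \<in> K" "\<sigma> \<subseteq> \<tau>"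
  shows "f \<tau> \<subseteq> f \<sigma>"
proof (cases "\<sigma> = \<tau>")
  case False
  have "(f \<tau>, f \<sigma>) \<in> P\<^sup>+" if "(\<sigma>, \<tau>) \<in> P\<^sup>+" for \<sigma> \<tau>
    using that
  proof (induction rule: trancl_induct)
    case (step y z)
    then show ?case using assms(1) by (auto simp: cover_reversing_def intro: trancl_into_trancl2)
  qed (use assms(1) in \<open>auto simp: cover_reversing_def\<close>)
  then show ?thesis using trancl_psubset psubset_trancl assms False by blast
qed simp

definition inverse_map :: "('a set \<Rightarrow> 'a set) \<Rightarrow> 'a set \<Rightarrow> 'a set" where
  "inverse_map f = restrict (inv_into K f) K"

lemma inverse_map:
  assumes "f \<in> Bij K"
  shows "inverse_map f \<in> Bij K"
    and "\<sigma> \<in> K \<Longrightarrow> f (inverse_map f \<sigma>) = \<sigma>"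
    and "\<sigma> \<in> K \<Longrightarrow> inverse_map f (f \<sigma>) = \<sigma>"
  unfolding inverse_map_def
    apply (rule restrict_inv_into_Bij[OF assms])
  using bij_betw_inv_into_right[OF Bij_bij[OF assms]] bij_betw_inv_into_left[OF Bij_bij[OF assms]]
    Bij_mem[OF assms]
  by auto

lemma inverse_preserving:
  assumes "f \<in> Bij K" "cover_preserving K f"
  shows "cover_preserving K (inverse_map f)"
  unfolding cover_preserving_def
  using cover_preserving_iff[OF assms] inverse_map[OF assms(1)] Bij_mem
  by (metis pair_iff)

lemma inverse_reversing:
  assumes "f \<in> Bij K" "cover_reversing K f"
  shows "cover_reversing K (inverse_map f)"
  unfolding cover_reversing_def
  using cover_reversing_iff[OF assms] inverse_map[OF assms(1)] Bij_mem
  by (metis pair_iff)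

lemma preserving_subset_iff:
  assumes "f \<in> Bij K" "cover_preserving K f" "\<sigma> \<in> K" "\<tau> \<in> K"
  shows "f \<sigma> \<subseteq> f \<tau> \<longleftrightarrow> \<sigma> \<subseteq> \<tau>"
  using assms preserving_mono[OF assms(2), of \<sigma> \<tau>]
    preserving_mono[OF inverse_preserving[OF assms(1,2)], of "f \<sigma>" "f \<tau>"]
  by (auto simp: inverse_map(3) Bij_mem)

lemma reversing_subset_iff:
  assumes "f \<in> Bij K" "cover_reversing K f" "\<sigma> \<in> K" "\<tau> \<in> K"
  shows "f \<tau> \<subseteq> f \<sigma> \<longleftrightarrow> \<sigma> \<subseteq> \<tau>"
  using assms reversing_antimono[OF assms(2), of \<sigma> \<tau>]
    reversing_antimono[OF inverse_reversing[OF assms(1,2)], of "f \<tau>" "f \<sigma>"]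
  by (auto simp: inverse_map(3) Bij_mem)

lemma simplicial_imp_preserving:
  assumes "f \<in> carrier (Aut K)"
  shows "cover_preserving K f"
proof -
  have fB: "f \<in> Bij K" using assms by (simp add: carrier_Aut)
  obtain g where g: "g ` \<Union>K \<subseteq> \<Union>K" "\<forall>\<sigma>\<in>K. g ` \<sigma> \<in> K \<and> f \<sigma> = g ` \<sigma>"
    using assms unfolding carrier_Aut simplicial_map_def by (elim conjE exE)
  have inj: "inj_on g (\<Union>K)"
    using vertex_map_inj[OF bij_betw_imp_inj_on[OF Bij_bij[OF fB]]] g(2) by blast
  show ?thesis
    unfolding cover_preserving_def
  proof (intro allI impI)
    fix \<sigma> \<tau> assume p: "(\<sigma>, \<tau>) \<in> P"
    then have K: "\<sigma> \<in> K" "\<tau> \<in> K" by (auto simp: pair_iff)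
    have c: "card (f \<rho>) = card \<rho>" if "\<rho> \<in> K" for \<rho>
      using g(2) that inj card_image inj_on_subset by (metis Union_upper)
    have "f \<sigma> \<subseteq> f \<tau>" using K g(2) p by (auto simp: pair_iff)
    moreover have "f \<sigma> \<noteq> f \<tau>" using Bij_eq_iff[OF fB K] p by (auto simp: pair_iff)
    ultimately show "(f \<sigma>, f \<tau>) \<in> P"
      using K c p Bij_mem[OF fB] by (simp add: pair_iff)
  qed
qed

text \<open>A cover-preserving bijection is an order automorphism. It therefore sends minimal
  simplices, the vertices, to vertices, and since a simplex is the union of the vertices below it,
  \<open>f\<close> is the image map of the resulting vertex map.\<close>

lemma preserving_imp_simplicial:
  assumes fB: "f \<in> Bij K" and pres: "cover_preserving K f"
  shows "f \<in> carrier (Aut K)"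
proof -
  have vertex: "is_singleton (f {v})" if v: "{v} \<in> K" for v
  proof -
    have fv: "f {v} \<in> K" using Bij_mem[OF fB v] .
    then obtain w where w: "w \<in> f {v}" using simplex_nonempty by blast
    show ?thesis
    proof (cases "f {v} = {w}")
      case False
      \<comment> \<open>The preimage of such a proper face would be covered by \<open>{v}\<close>,
        hence empty.\<close>
      then have "(f {v} - {w}, f {v}) \<in> P" using fv w by (intro remove_pair)
      then obtain \<sigma> where "\<sigma> \<in> K" "(\<sigma>, {v}) \<in> P"
        using cover_preserving_iff[OF fB pres] Bij_obtain[OF fB] v by (metis pair_iff)
      then have "\<sigma> = {}" by (auto simp: pair_iff)
      then show ?thesis using \<open>\<sigma> \<in> K\<close> simplex_nonempty by blast
    qed (simp add: is_singleton_def)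
  qed
  define g where "g v = the_elem (f {v})" for v
  have g: "f {v} = {g v}" if "{v} \<in> K" for v
    using vertex[OF that] by (simp add: g_def is_singleton_the_elem)
  have im: "f \<sigma> = g ` \<sigma>" if \<sigma>: "\<sigma> \<in> K" for \<sigma>
  proof (intro equalityI subsetI)
    fix w assume w: "w \<in> f \<sigma>"
    have "f \<sigma> \<in> K" using Bij_mem[OF fB \<sigma>] .
    then have "{w} \<in> K" using w face_closed by blast
    then obtain \<rho> where \<rho>: "\<rho> \<in> K" "f \<rho> = {w}" using Bij_obtain[OF fB] by metis
    have "\<rho> \<subseteq> \<sigma>" using preserving_subset_iff[OF fB pres \<rho>(1) \<sigma>] \<rho>(2) w by simp
    obtain v where v: "v \<in> \<rho>" using simplex_nonempty \<rho>(1) by blast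
    then have vK: "{v} \<in> K" using face_closed \<rho>(1) by blast
    have "f {v} \<subseteq> f \<rho>" using preserving_mono[OF pres vK \<rho>(1)] v by blast
    then show "w \<in> g ` \<sigma>" using g[OF vK] \<rho>(2) v \<open>\<rho> \<subseteq> \<sigma>\<close> by auto
  next
    fix w assume "w \<in> g ` \<sigma>"
    then obtain v where v: "v \<in> \<sigma>" "w = g v" by blast
    then have vK: "{v} \<in> K" using face_closed \<sigma> by blast
    then show "w \<in> f \<sigma>" using preserving_mono[OF pres vK \<sigma>] v g[OF vK] by auto
  qed
  have "g v \<in> \<Union>K" if "v \<in> \<Union>K" for v
  proof -
    have "{v} \<in> K" using that by (simp only: vertex_iff)
    then have "{g v} \<in> K" using g Bij_mem[OF fB] by metis
    then show ?thesis by (simp only: vertex_iff)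
  qed
  moreover have "g ` \<sigma> \<in> K" if "\<sigma> \<in> K" for \<sigma>
    using im[OF that] Bij_mem[OF fB that] by simp
  ultimately have "simplicial_map K K f"
    unfolding simplicial_map_def using im by (intro exI[of _ g]) blast
  then show ?thesis using fB by (simp add: carrier_Aut)
qed

lemma Aut_eq_cover_group:
  assumes "\<And>f. f \<in> Bij K \<Longrightarrow> cover_reversing K f \<Longrightarrow> cover_preserving K f"
  shows "Aut K = cover_group K"
proof -
  have "{f \<in> Bij K. simplicial_map K K f} = {f \<in> Bij K. cover_preserving K f \<or> cover_reversing K f}"
    using assms simplicial_imp_preserving preserving_imp_simplicial unfolding carrier_Aut by blast
  then show ?thesis by (simp add: Aut_def cover_group_def)
qed

lemma compose_preserving_reversing:
  assumes "f \<in> Bij K" "g \<in> Bij K"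
  shows "cover_preserving K f \<Longrightarrow> cover_preserving K g \<Longrightarrow> cover_preserving K (compose K f g)"
    and "cover_preserving K f \<Longrightarrow> cover_reversing K g \<Longrightarrow> cover_reversing K (compose K f g)"
    and "cover_reversing K f \<Longrightarrow> cover_preserving K g \<Longrightarrow> cover_reversing K (compose K f g)"
    and "cover_reversing K f \<Longrightarrow> cover_reversing K g \<Longrightarrow> cover_preserving K (compose K f g)"
proof -
  have "\<sigma> \<in> K \<and> \<tau> \<in> K" if "(\<sigma>, \<tau>) \<in> P" for \<sigma> \<tau> using that by (simp add: pair_iff)
  then show "cover_preserving K f \<Longrightarrow> cover_preserving K g \<Longrightarrow> cover_preserving K (compose K f g)"
    and "cover_preserving K f \<Longrightarrow> cover_reversing K g \<Longrightarrow> cover_reversing K (compose K f g)"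
    and "cover_reversing K f \<Longrightarrow> cover_preserving K g \<Longrightarrow> cover_reversing K (compose K f g)"
    and "cover_reversing K f \<Longrightarrow> cover_reversing K g \<Longrightarrow> cover_preserving K (compose K f g)"
    unfolding cover_preserving_def cover_reversing_def compose_def by simp_all
qed

lemma cover_group_compose:
  assumes "f \<in> carrier (cover_group K)" "g \<in> carrier (cover_group K)"
  shows "f \<otimes>\<^bsub>cover_group K\<^esub> g = compose K f g" "compose K f g \<in> carrier (cover_group K)"
proof -
  have B: "f \<in> Bij K" "g \<in> Bij K" using assms by (auto simp: carrier_cover_group)
  then show "f \<otimes>\<^bsub>cover_group K\<^esub> g = compose K f g"
    unfolding cover_group_def by (rule mult_BijGroup)
  show "compose K f g \<in> carrier (cover_group K)"
    using assms B compose_preserving_reversing[OF B] unfolding carrier_cover_group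
    by (meson compose_Bij)
qed

section \<open>The action of cover symmetries on pairs\<close>

lemma ends_subset: "x \<in> P \<Longrightarrow> ends x \<subseteq> K"
  using pairD(1,2) by (simp add: ends_def)

lemma pair_map:
  assumes f: "f \<in> carrier (cover_group K)" and x: "x \<in> P"
  shows "pair_map K f x \<in> P" "ends (pair_map K f x) = f ` ends x"
  using f x by (auto simp: pair_map_def carrier_cover_group cover_preserving_def
      cover_reversing_def ends_def)

lemma pair_map_Bij:
  assumes f: "f \<in> carrier (cover_group K)"
  shows "pair_map K f \<in> Bij P"
proof -
  have fB: "f \<in> Bij K" using f by (simp add: carrier_cover_group)
  have "inj_on (pair_map K f) P"
  proof (rule inj_onI)
    fix x y assume xy: "x \<in> P" "y \<in> P" "pair_map K f x = pair_map K f y"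
    then have "f ` ends x = f ` ends y" using pair_map(2)[OF f] by metis
    then have "ends x = ends y"
      using ends_subset xy(1,2) fB by (meson Bij_bij bij_betw_imp_inj_on inj_on_image_eq_iff)
    then show "x = y" using ends_inj xy by blast
  qed
  moreover have "pair_map K f ` P \<subseteq> P" using pair_map(1)[OF f] by blast
  ultimately have "bij_betw (pair_map K f) P P"
    unfolding bij_betw_def using endo_inj_surj[OF finite_pairs] by blast
  then show ?thesis by (simp add: Bij_def pair_map_def)
qed

lemma finite_flow: "V \<subseteq> P \<Longrightarrow> finite (flow V)"
proof -
  assume "V \<subseteq> P"
  then have "finite (V \<times> V)" using finite_pairs finite_subset by blast
  moreover have "flow V \<subseteq> V \<times> V" unfolding flow_def by blast
  ultimately show ?thesis by (rule rev_finite_subset)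
qed

text \<open>Apart from distinctness, a step from \<open>x\<close> to \<open>y\<close> says that
  \<open>snd x\<close> covers \<open>fst y\<close>. If a reversing map has such a step between the
  images, then \<open>snd y\<close> covers \<open>fst x\<close>, so the original step runs from
  \<open>y\<close> to \<open>x\<close>; hence the converse relation.\<close>

lemma pair_map_flow:
  assumes f: "f \<in> carrier (cover_group K)" and V: "V \<subseteq> P" "x \<in> V" "y \<in> V"
    and flow: "(pair_map K f x, pair_map K f y) \<in> flow (pair_map K f ` V)"
  shows "(x, y) \<in> (if cover_preserving K f then flow V else (flow V)\<inverse>)"
proof -
  have fB: "f \<in> Bij K" using f by (simp add: carrier_cover_group)
  have P: "x \<in> P" "y \<in> P" using V by auto
  have K: "fst x \<in> K" "snd x \<in> K" "fst y \<in> K" "snd y \<in> K" using pairD P by auto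
  have ne: "x \<noteq> y" using flow by (auto simp: flow_def)
  have flow': "(fst (pair_map K f y), snd (pair_map K f x)) \<in> P"
    using flow pairD[OF pair_map(1)[OF f P(1)]] pairD[OF pair_map(1)[OF f P(2)]]
    by (auto simp: flow_def pair_iff)
  show ?thesis
  proof (cases "cover_preserving K f")
    case True
    then have "(fst y, snd x) \<in> P"
      using flow' cover_preserving_iff[OF fB True] K P by (simp add: pair_map_def)
    then show ?thesis using True V ne pairD[OF P(1)] by (auto simp: flow_def pair_iff)
  next
    case False
    then have r: "cover_reversing K f" using f by (auto simp: carrier_cover_group)
    then have "(fst x, snd y) \<in> P"
      using flow' cover_reversing_iff[OF fB r] K P False by (simp add: pair_map_def)
    then show ?thesis using False V ne pairD[OF P(2)] by (auto simp: flow_def pair_iff)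
  qed
qed

lemma pair_map_vertex_aut:
  assumes f: "f \<in> carrier (cover_group K)"
  shows "pair_map K f \<in> carrier (vertex_aut (morse_complex K))"
proof -
  let ?F = "pair_map K f"
  have fB: "f \<in> Bij K" using f by (simp add: carrier_cover_group)
  note FB = pair_map_Bij[OF f]
  have "?F ` V \<in> morse_complex K" if V: "V \<in> morse_complex K" for V
  proof -
    have VP: "V \<subseteq> P" and "V \<noteq> {}" and d: "\<forall>x\<in>V. \<forall>y\<in>V. x \<noteq> y \<longrightarrow> ends x \<inter> ends y = {}"
      and ac: "acyclic (flow V)"
      using V by (auto simp: morse_iff)
    have "ends (?F x) \<inter> ends (?F y) = {}" if "x \<in> V" "y \<in> V" "?F x \<noteq> ?F y" for x y
    proof -
      have "ends x \<inter> ends y = {}" using d that by metis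
      moreover have "ends x \<subseteq> K" "ends y \<subseteq> K" using that(1,2) VP ends_subset by blast+
      ultimately have "f ` ends x \<inter> f ` ends y = {}"
        using fB by (metis Bij_bij bij_betw_imp_inj_on image_is_empty inj_on_image_Int)
      then show ?thesis using pair_map(2)[OF f] that VP by (metis subsetD)
    qed
    moreover have "acyclic (flow (?F ` V))"
    proof (rule wf_acyclic, rule wf_subset)
      let ?R = "if cover_preserving K f then flow V else (flow V)\<inverse>"
      \<comment> \<open>On a finite relation acyclicity amounts to well-foundedness, for the
        converse as well, and well-foundedness passes to inverse images; so preserving and reversing
        maps are handled at once.\<close>
      have "wf ?R"
        using ac finite_flow[OF VP] by (simp add: finite_acyclic_wf finite_acyclic_wf_converse)
      then show "wf (inv_image ?R (inv_into P ?F))" by (rule wf_inv_image)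
      show "flow (?F ` V) \<subseteq> inv_image ?R (inv_into P ?F)"
      proof (rule subrelI)
        fix a b assume ab: "(a, b) \<in> flow (?F ` V)"
        then obtain x y where xy: "x \<in> V" "y \<in> V" "a = ?F x" "b = ?F y"
          unfolding flow_def by blast
        then have "inv_into P ?F a = x" "inv_into P ?F b = y"
          using VP bij_betw_inv_into_left[OF Bij_bij[OF FB]] by (metis subsetD)+
        then show "(a, b) \<in> inv_image ?R (inv_into P ?F)"
          using pair_map_flow[OF f VP xy(1,2)] ab xy(3,4) unfolding inv_image_def by simp
      qed
    qed
    moreover have "?F ` V \<subseteq> P" using pair_map(1)[OF f] VP by blast
    ultimately show ?thesis using \<open>V \<noteq> {}\<close> unfolding morse_iff by blast
  qed
  then show ?thesis using FB by (simp add: carrier_vertex_aut Union_morse)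
qed

text \<open>A pair is determined by its set of ends, on which \<open>f\<close> acts without regard
  to order. Comparing ends avoids distinguishing preserving and reversing factors.\<close>

lemma pair_map_hom: "pair_map K \<in> hom (cover_group K) (vertex_aut (morse_complex K))"
proof (rule homI)
  fix f g assume fg: "f \<in> carrier (cover_group K)" "g \<in> carrier (cover_group K)"
  interpret M: finite_complex "morse_complex K" by (rule finite_complex_morse)
  note c = cover_group_compose[OF fg]
  have "pair_map K (compose K f g) = compose P (pair_map K f) (pair_map K g)"
  proof (rule Bij_ext[of _ P])
    show "pair_map K (compose K f g) \<in> Bij P" "compose P (pair_map K f) (pair_map K g) \<in> Bij P"
      using pair_map_Bij c(2) fg by (auto intro: compose_Bij)
  next
    fix x assume x: "x \<in> P"
    then have gx: "pair_map K g x \<in> P" using pair_map(1) fg by blast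
    have "ends (pair_map K (compose K f g) x) = compose K f g ` ends x"
      using pair_map(2)[OF c(2) x] .
    also have "\<dots> = f ` g ` ends x"
      unfolding image_image using pairD[OF x] by (auto simp: compose_def ends_def)
    also have "\<dots> = ends (pair_map K f (pair_map K g x))"
      using pair_map(2)[OF fg(1) gx] pair_map(2)[OF fg(2) x] by simp
    finally have "pair_map K (compose K f g) x = pair_map K f (pair_map K g x)"
      using ends_inj pair_map(1)[OF c(2) x] pair_map(1)[OF fg(1) gx] by blast
    then show "pair_map K (compose K f g) x = compose P (pair_map K f) (pair_map K g) x"
      using x by (simp add: compose_def)
  qed
  then show "pair_map K (f \<otimes>\<^bsub>cover_group K\<^esub> g) =
      pair_map K f \<otimes>\<^bsub>vertex_aut (morse_complex K)\<^esub> pair_map K g"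
    using c(1) M.vertex_aut_compose(1)[OF pair_map_vertex_aut[OF fg(1)] pair_map_vertex_aut[OF fg(2)]]
    by (simp add: Union_morse)
qed (rule pair_map_vertex_aut)

end

section \<open>Automorphisms of the Morse complex come from the Hasse diagram\<close>

text \<open>Together with connectedness, \<open>pairs_nonempty\<close> puts every vertex on an edge.
  Among connected complexes it sets aside the empty one and the single vertex, which are treated at
  the end.\<close>

locale connected_complex_with_edge = finite_complex +
  assumes connected: "connected_complex K" and pairs_nonempty: "primitive_pairs K \<noteq> {}"
begin

lemma vertex_neighbour:
  assumes "{v} \<in> K"
  obtains w where "w \<noteq> v" "{v, w} \<in> K"
proof -
  obtain \<sigma> \<tau> where p: "(\<sigma>, \<tau>) \<in> P" using pairs_nonempty by auto
  then have "\<not> card \<tau> \<le> card {v}" using card_pos[of \<sigma>] by (auto simp: pair_iff)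
  then have "\<exists>u\<in>\<tau>. u \<noteq> v" using card_mono[of "{v}" \<tau>] by auto
  then obtain u where u: "u \<in> \<Union>K" "u \<noteq> v" using p by (auto simp: pair_iff)
  have "(v, u) \<in> {(x, y). {x, y} \<in> K}\<^sup>*"
    using connected u assms unfolding connected_complex_def by blast
  moreover have "u = v" if "\<forall>w. w \<noteq> v \<longrightarrow> {v, w} \<notin> K" "(v, u) \<in> {(x, y). {x, y} \<in> K}\<^sup>*"
    using that(2) by (induction rule: rtrancl_induct) (use that(1) in auto)
  ultimately have "\<exists>w. w \<noteq> v \<and> {v, w} \<in> K" using u(2) by metis
  then show ?thesis using that by auto
qed

text \<open>Connectedness of the Hasse diagram as an invariance principle. It is applied to the
  direction in which a map treats covers and to the joint size of a simplex and its image.\<close>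

lemma constant_if_constant_on_pairs:
  assumes c: "\<And>\<sigma> \<tau>. (\<sigma>, \<tau>) \<in> P \<Longrightarrow> c \<sigma> = c \<tau>" and K: "\<sigma> \<in> K" "\<tau> \<in> K"
  shows "c \<sigma> = c \<tau>"
proof -
  have trancl: "c \<sigma> = c \<tau>" if "(\<sigma>, \<tau>) \<in> P\<^sup>+" for \<sigma> \<tau>
    using that by (induction rule: trancl_induct) (auto simp: c)
  have vertex: "c {v} = c \<sigma>" if "\<sigma> \<in> K" "v \<in> \<sigma>" for \<sigma> v
  proof (cases "\<sigma> = {v}")
    case False
    then have "{v} \<subset> \<sigma>" using that by blast
    then show ?thesis using trancl psubset_trancl face_closed that by blast
  qed simp
  have "c {u} = c {v}" if "(u, v) \<in> {(x, y). {x, y} \<in> K}\<^sup>*" for u v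
    using that
  proof (induction rule: rtrancl_induct)
    case (step y z)
    then have "{y, z} \<in> K" by simp
    then have "c {y} = c {z}" using vertex[of "{y, z}"] by simp
    then show ?case using step.IH by simp
  qed simp
  moreover obtain u v where uv: "u \<in> \<sigma>" "v \<in> \<tau>" using K simplex_nonempty by blast
  moreover have "(u, v) \<in> {(x, y). {x, y} \<in> K}\<^sup>*"
    using connected K uv unfolding connected_complex_def by blast
  ultimately show ?thesis using vertex K by metis
qed

text \<open>Simplices with at least two vertices have degree at least two in the Hasse diagram, and
  two incident pairs pin them down. A vertex may have degree one and is reached through an edge
  instead.\<close>

lemma two_faces:
  assumes "\<tau> \<in> K" "2 \<le> card \<tau>"
  obtains a b where "a \<in> \<tau>" "b \<in> \<tau>" "a \<noteq> b" "(\<tau> - {a}, \<tau>) \<in> P" "(\<tau> - {b}, \<tau>) \<in> P"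
proof -
  obtain a b where ab: "a \<in> \<tau>" "b \<in> \<tau>" "a \<noteq> b"
    using assms(2) by (metis card_le_Suc0_iff_eq card.infinite not_less_eq_eq numeral_2_eq_2 zero_le)
  then have "\<tau> \<noteq> {a}" "\<tau> \<noteq> {b}" by auto
  then show ?thesis using that ab remove_pair assms(1) by blast
qed

text \<open>The image of a larger simplex is the only common end of the images of two incident
  pairs; a vertex is then the remaining end of a pair. This serves the injectivity of
  \<open>pair_map\<close> and, with \<open>g\<close> the identity, maps that fix the ends of every
  pair.\<close>

lemma node_map_unique:
  assumes inj: "inj_on g K" and eq: "\<And>x. x \<in> P \<Longrightarrow> f ` ends x = g ` ends x" and "\<sigma> \<in> K"
  shows "f \<sigma> = g \<sigma>"
proof -
  have big: "f \<tau> = g \<tau>" if \<tau>: "\<tau> \<in> K" "2 \<le> card \<tau>" for \<tau>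
  proof -
    obtain a b where ab: "a \<in> \<tau>" "b \<in> \<tau>" "a \<noteq> b" "(\<tau> - {a}, \<tau>) \<in> P" "(\<tau> - {b}, \<tau>) \<in> P"
      using two_faces[OF \<tau>] .
    then have "\<tau> - {a} \<in> K" "\<tau> - {b} \<in> K" "\<tau> - {a} \<noteq> \<tau> - {b}" by (auto simp: pair_iff)
    then have "g (\<tau> - {a}) \<noteq> g (\<tau> - {b})" using inj by (meson inj_onD)
    moreover have "f \<tau> \<in> {g (\<tau> - {a}), g \<tau>}" "f \<tau> \<in> {g (\<tau> - {b}), g \<tau>}"
      using eq[OF ab(4)] eq[OF ab(5)] by (auto simp: ends_def)
    ultimately show ?thesis by auto
  qed
  show ?thesis
  proof (cases "2 \<le> card \<sigma>")
    case False
    then have "card \<sigma> = 1" using card_pos[OF assms(3)] by linarith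
    then obtain v where v: "\<sigma> = {v}" by (metis card_1_singletonE)
    then obtain w where w: "w \<noteq> v" "{v, w} \<in> K" using vertex_neighbour assms(3) by metis
    then have p: "({v}, {v, w}) \<in> P" using assms(3) v by (auto simp: pair_iff)
    have "g {v} \<noteq> g {v, w}" using inj w assms(3) v by (auto dest!: inj_onD)
    moreover have "f {v, w} = g {v, w}" using big w by simp
    moreover have "{f {v}, f {v, w}} = {g {v}, g {v, w}}" using eq[OF p] by (simp add: ends_def)
    ultimately show ?thesis using v by (auto simp: doubleton_eq_iff)
  qed (use big assms(3) in blast)
qed

lemma ends_card:
  assumes "x \<in> P" "s \<in> ends x" "t \<in> ends x" "s \<noteq> t"
  shows "card s = Suc (card t) \<or> card t = Suc (card s)"
  using assms pairD(4)[OF assms(1)] by (auto simp: ends_def)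

lemma ends_eqI: "s \<in> ends x \<Longrightarrow> t \<in> ends x \<Longrightarrow> s \<noteq> t \<Longrightarrow> ends x = {s, t}"
  by (auto simp: ends_def)

text \<open>The Hasse diagram is bipartite, so it has no triangles, and three pairwise adjacent pairs
  share a simplex.\<close>

lemma no_triangle:
  assumes "x \<in> P" "y \<in> P" "z \<in> P" "x \<noteq> y" "a \<in> ends x" "a \<in> ends y"
    and "ends x \<inter> ends z \<noteq> {}" "ends y \<inter> ends z \<noteq> {}"
  shows "a \<in> ends z"
proof (rule ccontr)
  assume na: "a \<notin> ends z"
  obtain b c where b: "b \<in> ends x" "b \<in> ends z" and c: "c \<in> ends y" "c \<in> ends z"
    using assms by blast
  have ab: "a \<noteq> b" and ac: "a \<noteq> c" using na b c by auto
  have "ends x = {a, b}" using ends_eqI[OF assms(5) b(1) ab] .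
  moreover have "ends y = {a, c}" using ends_eqI[OF assms(6) c(1) ac] .
  ultimately have "b \<noteq> c" using ends_inj assms(1,2,4) by metis
  with ab ac show False
    using ends_card[OF assms(1) assms(5) b(1)] ends_card[OF assms(2) assms(6) c(1)]
      ends_card[OF assms(3) b(2) c(2)] by presburger
qed

context
  fixes F
  assumes F: "F \<in> carrier (vertex_aut (morse_complex K))"
begin

lemma F_Bij: "F \<in> Bij P"
  using F by (simp add: carrier_vertex_aut Union_morse)

lemmas F_mem = Bij_mem[OF F_Bij]

lemma F_morse_iff: "V \<subseteq> P \<Longrightarrow> F ` V \<in> morse_complex K \<longleftrightarrow> V \<in> morse_complex K"
  using finite_complex.vertex_aut_image_iff[OF finite_complex_morse F] by (simp add: Union_morse)

lemma F_adjacent_iff: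
  assumes "x \<in> P" "y \<in> P"
  shows "ends (F x) \<inter> ends (F y) = {} \<longleftrightarrow> ends x \<inter> ends y = {}"
proof (cases "x = y")
  case False
  then have "F x \<noteq> F y" using Bij_eq_iff[OF F_Bij assms] by simp
  then show ?thesis
    using edge_morse_iff[OF assms False] edge_morse_iff[OF F_mem[OF assms(1)] F_mem[OF assms(2)]]
      F_morse_iff[of "{x, y}"] assms by simp
qed (simp add: ends_def)

text \<open>Whitney's argument: the pairs containing a simplex \<open>\<tau>\<close> are pairwise incompatible, and so are
  their images, which therefore share a simplex.\<close>

lemma star_image:
  assumes "\<tau> \<in> K" "2 \<le> card \<tau>"
  shows "\<exists>t\<in>K. \<forall>x\<in>P. \<tau> \<in> ends x \<longrightarrow> t \<in> ends (F x)"
proof -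
  obtain a b where ab: "a \<in> \<tau>" "b \<in> \<tau>" "a \<noteq> b" "(\<tau> - {a}, \<tau>) \<in> P" "(\<tau> - {b}, \<tau>) \<in> P"
    using two_faces[OF assms] .
  define x y where "x = (\<tau> - {a}, \<tau>)" "y = (\<tau> - {b}, \<tau>)"
  have P: "x \<in> P" "y \<in> P" and "x \<noteq> y" and e: "\<tau> \<in> ends x" "\<tau> \<in> ends y"
    using ab by (auto simp: x_y_def ends_def)
  then have ne: "F x \<noteq> F y" using Bij_eq_iff[OF F_Bij P] by simp
  have meet: "ends (F u) \<inter> ends (F v) \<noteq> {}" if "u \<in> P" "v \<in> P" "\<tau> \<in> ends u" "\<tau> \<in> ends v" for u v
    using F_adjacent_iff that by blast
  obtain t where t: "t \<in> ends (F x)" "t \<in> ends (F y)" using meet[OF P e] by blast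
  have "t \<in> ends (F z)" if "z \<in> P" "\<tau> \<in> ends z" for z
    using no_triangle[OF F_mem[OF P(1)] F_mem[OF P(2)] F_mem[OF that(1)] ne t] meet P e that by blast
  moreover have "t \<in> K" using t ends_subset[OF F_mem[OF P(1)]] by blast
  ultimately show ?thesis by blast
qed

text \<open>Larger simplices take the value supplied by their star. A vertex takes the other end of
  the image of a pair formed with one edge; the work lies in showing that all edges at the vertex
  yield the same other end.\<close>

lemma node_map_exists:
  obtains f where "\<And>\<sigma>. \<sigma> \<in> K \<Longrightarrow> f \<sigma> \<in> K" "\<And>x. x \<in> P \<Longrightarrow> ends (F x) = f ` ends x"
proof -
  have "\<forall>\<tau>. \<exists>t. \<tau> \<in> K \<and> 2 \<le> card \<tau> \<longrightarrow> t \<in> K \<and> (\<forall>x\<in>P. \<tau> \<in> ends x \<longrightarrow> t \<in> ends (F x))"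
    using star_image by metis
  then obtain n where
    n: "\<forall>\<tau>. \<tau> \<in> K \<and> 2 \<le> card \<tau> \<longrightarrow> n \<tau> \<in> K \<and> (\<forall>x\<in>P. \<tau> \<in> ends x \<longrightarrow> n \<tau> \<in> ends (F x))"
    by (rule choice[THEN exE])
  have big: "snd x \<in> K" "2 \<le> card (snd x)" "snd x \<in> ends x" if "x \<in> P" for x
    using pairD[OF that] card_pos[of "fst x"] by (auto simp: ends_def)
  have n_snd: "n (snd x) \<in> ends (F y)" if "x \<in> P" "y \<in> P" "snd x \<in> ends y" for x y
    using n big that by blast
  \<comment> \<open>If \<open>F x\<close> contained the node of the edge \<open>snd x0\<close>, it
    would meet the image of the pair formed by that edge and its other vertex \<open>w\<close>. But
    this pair is disjoint from \<open>x\<close>.\<close>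
  have other: "n (snd x0) \<notin> ends (F x)"
    if x: "x \<in> P" "x0 \<in> P" "fst x = {v}" "fst x0 = {v}" "x \<noteq> x0" for x x0 v
  proof
    assume in_x: "n (snd x0) \<in> ends (F x)"
    have "v \<in> snd x0" "card (snd x0) = 2" "card (snd x) = 2"
      using pairD[OF x(1)] pairD[OF x(2)] x by auto
    moreover then obtain w where w: "snd x0 = {v, w}" "w \<noteq> v"
      by (metis card_2_iff doubleton_eq_iff insertE singletonD)
    ultimately have y: "({w}, snd x0) \<in> P"
      using face_closed[OF big(1)[OF x(2)], of "{w}"] big(1)[OF x(2)] by (auto simp: pair_iff)
    then have "n (snd x0) \<in> ends (F ({w}, snd x0))" using n_snd[OF x(2)] by (simp add: ends_def)
    then have "ends x \<inter> ends ({w}, snd x0) \<noteq> {}"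
      using in_x F_adjacent_iff[OF x(1) y] by blast
    moreover have "snd x \<noteq> snd x0" using x prod_eqI by metis
    moreover have "card {v} \<noteq> card (snd x0)" "card {w} \<noteq> card (snd x)"
      using \<open>card (snd x0) = 2\<close> \<open>card (snd x) = 2\<close> by simp_all
    then have "{v} \<noteq> snd x0" "snd x \<noteq> {w}" by metis+
    ultimately show False using w(2) by (simp add: ends_def x(3))
  qed
  have "\<exists>t. {v} \<in> K \<longrightarrow> t \<in> K \<and> (\<forall>x\<in>P. fst x = {v} \<longrightarrow> ends (F x) = {t, n (snd x)})" for v
  proof (cases "{v} \<in> K")
    case True
    obtain w where w: "w \<noteq> v" "{v, w} \<in> K" using vertex_neighbour[OF True] .
    define x0 where "x0 = ({v}, {v, w})"
    have x0: "x0 \<in> P" "fst x0 = {v}" using w True by (auto simp: pair_iff x0_def)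
    obtain t where t: "ends (F x0) = {t, n (snd x0)}"
      using n_snd[OF x0(1) x0(1) big(3)[OF x0(1)]] unfolding ends_def by blast
    have "ends (F x) = {t, n (snd x)}" if x: "x \<in> P" "fst x = {v}" for x
    proof (cases "x = x0")
      case False
      have "ends (F x) \<inter> ends (F x0) \<noteq> {}"
        using F_adjacent_iff[OF x(1) x0(1)] x(2) x0(2) by (auto simp: ends_def)
      then have "t \<in> ends (F x)"
        using other[OF x(1) x0(1) x(2) x0(2) False] t by auto
      moreover have "n (snd x) \<in> ends (F x)" using n_snd[OF x(1) x(1) big(3)[OF x(1)]] .
      moreover have "t \<noteq> n (snd x)"
        using other[OF x0(1) x(1) x0(2) x(2)] False t by auto
      ultimately show ?thesis by (auto simp: ends_def)
    qed (use t in simp)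
    moreover have "t \<in> K" using ends_subset[OF F_mem[OF x0(1)]] t by auto
    ultimately show ?thesis by blast
  qed simp
  then have "\<forall>v. \<exists>t. {v} \<in> K \<longrightarrow> t \<in> K \<and> (\<forall>x\<in>P. fst x = {v} \<longrightarrow> ends (F x) = {t, n (snd x)})"
    by (rule allI)
  then obtain m where
    m: "\<forall>v. {v} \<in> K \<longrightarrow> m v \<in> K \<and> (\<forall>x\<in>P. fst x = {v} \<longrightarrow> ends (F x) = {m v, n (snd x)})"
    by (rule choice[THEN exE])
  define f where "f \<sigma> = (if 2 \<le> card \<sigma> then n \<sigma> else m (the_elem \<sigma>))" for \<sigma>
  have single: "\<exists>v. \<sigma> = {v}" if "\<sigma> \<in> K" "\<not> 2 \<le> card \<sigma>" for \<sigma>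
  proof -
    have "card \<sigma> = 1" using card_pos[OF that(1)] that(2) by linarith
    then show ?thesis by (metis card_1_singletonE)
  qed
  have "f \<sigma> \<in> K" if \<sigma>: "\<sigma> \<in> K" for \<sigma>
  proof (cases "2 \<le> card \<sigma>")
    case True
    then show ?thesis using n \<sigma> by (simp add: f_def)
  next
    case False
    then obtain v where "\<sigma> = {v}" using single \<sigma> by blast
    then show ?thesis using m \<sigma> by (simp add: f_def)
  qed
  moreover have "ends (F x) = f ` ends x" if x: "x \<in> P" for x
  proof (cases "2 \<le> card (fst x)")
    case False
    then obtain v where v: "fst x = {v}" using single pairD(1)[OF x] by blast
    then have "ends (F x) = {m v, n (snd x)}" using m x pairD(1)[OF x] by simp
    then show ?thesis using v big(2)[OF x] by (simp add: ends_def f_def)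
  next
    case True
    have fK: "fst x \<in> K" and sK: "snd x \<in> K" using pairD[OF x] by auto
    obtain a b where ab: "a \<in> fst x" "b \<in> fst x" "a \<noteq> b" "(fst x - {a}, fst x) \<in> P"
      using two_faces[OF fK True] by metis
    \<comment> \<open>Disjoint pairs at \<open>fst x\<close> and at \<open>snd x\<close> have
      disjoint images, which separates the two nodes. Dropping \<open>b\<close> keeps
      \<open>z\<close> away from \<open>fst x\<close>, and its size keeps \<open>fst z\<close> away
      from \<open>fst y\<close>.\<close>
    define y z where "y = (fst x - {a}, fst x)" "z = (snd x - {b}, snd x)"
    have bz: "b \<in> snd x" "snd x \<noteq> {b}" using ab pairD(3)[OF x] by auto
    have y: "y \<in> P" and z: "z \<in> P" using ab(4) remove_pair[OF sK bz] by (simp_all add: y_z_def)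
    have c: "card (fst y) < card (fst x)" "card (fst z) = card (fst x)"
      using pairD(4)[OF y] pairD(4)[OF z] pairD(4)[OF x] by (auto simp: y_z_def)
    have "ends y \<inter> ends z = {}"
      using c pairD(3)[OF x] pairD(4)[OF x] ab(2) by (auto simp: ends_def y_z_def)
    then have d: "ends (F y) \<inter> ends (F z) = {}" using F_adjacent_iff[OF y z] by simp
    have "n (fst x) \<in> ends (F y)" "n (snd x) \<in> ends (F z)"
      using n_snd[OF y y] n_snd[OF z z] by (auto simp: y_z_def ends_def)
    then have "n (fst x) \<noteq> n (snd x)" using d by auto
    moreover have "n (fst x) \<in> ends (F x)" "n (snd x) \<in> ends (F x)"
      using n_snd[OF y x] n_snd[OF x x] by (auto simp: y_z_def ends_def)
    ultimately have "ends (F x) = {n (fst x), n (snd x)}" by (auto simp: ends_def)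
    then show ?thesis using True big(2)[OF x] by (simp add: ends_def f_def)
  qed
  ultimately show ?thesis using that by blast
qed

end

end

section \<open>Recovering the direction of covers\<close>

context connected_complex_with_edge
begin

text \<open>Comparing only ends leaves open whether \<open>F\<close> keeps or exchanges the order
  within a pair. That the answer is the same for all pairs is what remains to be shown.\<close>

definition induces :: "('a set \<Rightarrow> 'a set) \<Rightarrow> ('a set \<times> 'a set \<Rightarrow> 'a set \<times> 'a set) \<Rightarrow> bool" where
  "induces f F \<longleftrightarrow> F \<in> carrier (vertex_aut (morse_complex K)) \<and> f \<in> Bij K \<and>
     (\<forall>x\<in>P. ends (F x) = f ` ends x)"

lemma induced_pair:
  assumes "induces f F" "(\<sigma>, \<tau>) \<in> P"
  shows "F (\<sigma>, \<tau>) = (f \<sigma>, f \<tau>) \<and> (f \<sigma>, f \<tau>) \<in> P \<or> F (\<sigma>, \<tau>) = (f \<tau>, f \<sigma>) \<and> (f \<tau>, f \<sigma>) \<in> P"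
proof -
  obtain p q where pq: "F (\<sigma>, \<tau>) = (p, q)" by (cases "F (\<sigma>, \<tau>)")
  have "(p, q) \<in> P"
    using F_mem assms pq unfolding induces_def by metis
  moreover have "{p, q} = {f \<sigma>, f \<tau>}"
  proof -
    have "ends (F (\<sigma>, \<tau>)) = f ` ends (\<sigma>, \<tau>)" using assms unfolding induces_def by blast
    then show ?thesis using pq by (simp add: ends_def)
  qed
  ultimately show ?thesis using pq by (metis doubleton_eq_iff)
qed

text \<open>The closed path is \<open>A\<close>, \<open>AB\<close>, \<open>B\<close>,
  \<open>BC\<close>, \<open>C\<close>, \<open>CA\<close>, \<open>A\<close>. The set
  \<open>\<omega>\<close> may be empty, so nothing below \<open>A\<close>, \<open>B\<close>,
  \<open>C\<close> is presupposed; the covers by \<open>R\<close> record how the hexagon is attached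
  from above.\<close>

lemma hexagon:
  assumes "a \<notin> \<omega>" "b \<notin> \<omega>" "c \<notin> \<omega>" "a \<noteq> b" "b \<noteq> c" "a \<noteq> c" "insert a (insert b (insert c \<omega>)) \<in> K"
  defines "A \<equiv> insert a \<omega>" and "B \<equiv> insert b \<omega>" and "C \<equiv> insert c \<omega>"
    and "AB \<equiv> insert a (insert b \<omega>)" and "BC \<equiv> insert b (insert c \<omega>)" and "CA \<equiv> insert c (insert a \<omega>)"
    and "R \<equiv> insert a (insert b (insert c \<omega>))"
  shows "(A, AB) \<in> P" "(B, BC) \<in> P" "(C, CA) \<in> P" "(B, AB) \<in> P" "(C, BC) \<in> P" "(A, CA) \<in> P"
    "(AB, R) \<in> P" "(BC, R) \<in> P" "(CA, R) \<in> P"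
    "{(A, AB), (B, BC), (C, CA)} \<notin> morse_complex K"
proof -
  have "A \<in> K" "B \<in> K" "C \<in> K" "AB \<in> K" "BC \<in> K" "CA \<in> K" "R \<in> K" "finite \<omega>"
    using simplex_finite[OF assms(7)] by (auto simp: assms(8-) intro: face_closed[OF assms(7)])
  note K = this(1-7) and fin = this(8)
  show P: "(A, AB) \<in> P" "(B, BC) \<in> P" "(C, CA) \<in> P" "(B, AB) \<in> P" "(C, BC) \<in> P" "(A, CA) \<in> P"
    and "(AB, R) \<in> P" "(BC, R) \<in> P" "(CA, R) \<in> P"
  proof -
    have eqs: "AB = insert b A" "AB = insert a B" "BC = insert c B" "BC = insert b C"
      "CA = insert a C" "CA = insert c A" "R = insert c AB" "R = insert a BC" "R = insert b CA"
      by (auto simp: assms(8-))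
    have nin: "b \<notin> A" "a \<notin> B" "c \<notin> B" "b \<notin> C" "a \<notin> C" "c \<notin> A" "c \<notin> AB" "a \<notin> BC" "b \<notin> CA"
      using assms(1-6) by (simp_all add: assms(8-))
    show "(A, AB) \<in> P" unfolding eqs(1) by (rule insert_pair) (use K nin eqs simplex_nonempty in metis)+
    show "(B, BC) \<in> P" unfolding eqs(3) by (rule insert_pair) (use K nin eqs simplex_nonempty in metis)+
    show "(C, CA) \<in> P" unfolding eqs(5) by (rule insert_pair) (use K nin eqs simplex_nonempty in metis)+
    show "(B, AB) \<in> P" unfolding eqs(2) by (rule insert_pair) (use K nin eqs simplex_nonempty in metis)+
    show "(C, BC) \<in> P" unfolding eqs(4) by (rule insert_pair) (use K nin eqs simplex_nonempty in metis)+
    show "(A, CA) \<in> P" unfolding eqs(6) by (rule insert_pair) (use K nin eqs simplex_nonempty in metis)+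
    show "(AB, R) \<in> P" unfolding eqs(7) by (rule insert_pair) (use K nin eqs simplex_nonempty in metis)+
    show "(BC, R) \<in> P" unfolding eqs(8) by (rule insert_pair) (use K nin eqs simplex_nonempty in metis)+
    show "(CA, R) \<in> P" unfolding eqs(9) by (rule insert_pair) (use K nin eqs simplex_nonempty in metis)+
  qed
  let ?V = "{(A, AB), (B, BC), (C, CA)}"
  have ne: "A \<noteq> B" "B \<noteq> C" "A \<noteq> C" using assms(1-6) by (auto simp: assms(8-))
  have "B \<subset> AB" "C \<subset> BC" "A \<subset> CA" "card A = card B" "card B = card C"
    using P by (auto simp: pair_iff)
  then have "((A, AB), (B, BC)) \<in> flow ?V" "((B, BC), (C, CA)) \<in> flow ?V" "((C, CA), (A, AB)) \<in> flow ?V"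
    using ne unfolding flow_def by simp_all
  then have "((A, AB), (A, AB)) \<in> (flow ?V)\<^sup>+" by (meson r_into_trancl trancl_into_trancl)
  then have "\<not> acyclic (flow ?V)" unfolding acyclic_def by blast
  then show "?V \<notin> morse_complex K" unfolding morse_iff by blast
qed

text \<open>The hexagon of an interval above \<open>\<omega>\<close> is a closed path, so its image is again one and lies in
  two consecutive dimensions; since the image of the top element \<open>R\<close> is adjacent to half of it and
  two simplices have at most one common cover, that image lies strictly beyond them.\<close>

lemma induced_chain:
  assumes ind: "induces f F" and chain: "(\<sigma>, \<tau>) \<in> P" "(\<tau>, \<rho>) \<in> P"
  shows "(f \<sigma>, f \<tau>) \<in> P \<longleftrightarrow> (f \<tau>, f \<rho>) \<in> P"
proof -
  have F: "F \<in> carrier (vertex_aut (morse_complex K))" and fB: "f \<in> Bij K"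
    and e: "\<And>x. x \<in> P \<Longrightarrow> ends (F x) = f ` ends x"
    using ind by (auto simp: induces_def)
  have fin: "finite \<sigma>" "finite \<tau>" "finite \<rho>" and sub: "\<sigma> \<subseteq> \<tau>" "\<tau> \<subseteq> \<rho>"
    and card: "card \<tau> = Suc (card \<sigma>)" "card \<rho> = Suc (card \<tau>)"
    using chain simplex_finite by (auto simp: pair_iff)
  have "card (\<tau> - \<sigma>) = 1" "card (\<rho> - \<tau>) = 1"
    using fin sub card by (simp_all add: card_Diff_subset)
  then obtain b c where "\<tau> - \<sigma> = {b}" "\<rho> - \<tau> = {c}" by (meson card_1_singletonE)
  then have bc: "\<tau> = insert b \<sigma>" "b \<notin> \<sigma>" "\<rho> = insert c \<tau>" "c \<notin> \<tau>" using sub by auto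
  have "\<sigma> \<in> K" using chain(1) by (simp add: pair_iff)
  \<comment> \<open>Any vertex of the bottom simplex will do: removing it makes room for a hexagon
    through \<sigma> and \<tau> with \<rho> on top.\<close>
  then obtain a where a: "a \<in> \<sigma>" using simplex_nonempty by blast
  define \<omega> where "\<omega> = \<sigma> - {a}"
  have \<sigma>: "\<sigma> = insert a \<omega>" "a \<notin> \<omega>" using a by (auto simp: \<omega>_def)
  define A B C AB BC CA where defs: "A = insert a \<omega>" "B = insert b \<omega>" "C = insert c \<omega>"
    "AB = insert a (insert b \<omega>)" "BC = insert b (insert c \<omega>)" "CA = insert c (insert a \<omega>)"
  define R where R: "R = insert a (insert b (insert c \<omega>))"
  have eqs: "\<sigma> = A" "\<tau> = AB" "\<rho> = R" using bc \<sigma> defs R by auto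
  have side: "a \<notin> \<omega>" "b \<notin> \<omega>" "c \<notin> \<omega>" "a \<noteq> b" "b \<noteq> c" "a \<noteq> c" "insert a (insert b (insert c \<omega>)) \<in> K"
    using bc \<sigma> chain(2) eqs(3) R by (auto simp: pair_iff)
  note hex = hexagon[OF side, folded defs R]
  have "A \<in> K" "B \<in> K" "C \<in> K" "AB \<in> K" "BC \<in> K" "CA \<in> K" "R \<in> K"
    using hex by (auto simp: pair_iff)
  note K = this
  have mem: "b \<notin> A" "b \<in> B" "c \<notin> B" "c \<in> C" "c \<notin> A" "c \<notin> AB" "c \<in> BC" "c \<in> CA" "a \<notin> BC" "a \<in> CA"
    using side(1-6) by (simp_all add: defs)
  then have dist: "A \<noteq> B" "B \<noteq> C" "A \<noteq> C" "AB \<noteq> BC" "BC \<noteq> CA" "AB \<noteq> CA"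
    by metis+
  have cd: "card A = card B" "card B = card C" "card AB = Suc (card A)" "card BC = Suc (card B)"
    "card CA = Suc (card C)" "card R = Suc (card AB)"
    using hex(1-7) by (simp_all add: pair_iff)
  have "card A \<noteq> card BC" "card A \<noteq> card CA" "card B \<noteq> card CA" "card B \<noteq> card AB"
    "card C \<noteq> card BC" "card C \<noteq> card AB" "card A \<noteq> card R"
    using cd by linarith+
  then have level: "A \<noteq> BC" "A \<noteq> CA" "B \<noteq> CA" "B \<noteq> AB" "C \<noteq> BC" "C \<noteq> AB" "A \<noteq> R"
    by metis+
  let ?x = "(A, AB)" and ?y = "(B, BC)" and ?z = "(C, CA)"
  have disj: "ends (F x) \<inter> ends (F y) = {}" if "x \<in> P" "y \<in> P" "ends x \<inter> ends y = {}" for x y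
    using F_adjacent_iff[OF F] that by blast
  have d: "ends (F ?x) \<inter> ends (F ?y) = {}" "ends (F ?y) \<inter> ends (F ?z) = {}" "ends (F ?x) \<inter> ends (F ?z) = {}"
    using disj[OF hex(1,2)] disj[OF hex(2,3)] disj[OF hex(1,3)] dist level
    by (simp_all add: ends_def not_sym)
  have FP: "{F ?x, F ?y, F ?z} \<subseteq> P" using F_mem[OF F] hex(1-3) by simp
  have "F ` {?x, ?y, ?z} \<notin> morse_complex K"
    using F_morse_iff[OF F, of "{?x, ?y, ?z}"] hex by simp
  then have nm: "{F ?x, F ?y, F ?z} \<notin> morse_complex K" by simp
  have l1: "card (fst (F ?x)) = card (fst (F ?y))"
    by (rule three_pairs_level[OF FP d nm])
  have "{F ?y, F ?z, F ?x} = {F ?x, F ?y, F ?z}" by blast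
  then have l2: "card (fst (F ?y)) = card (fst (F ?z))"
    using three_pairs_level[of "F ?y" "F ?z" "F ?x"] FP d nm by (simp add: Int_commute)
  define g where "g \<nu> = card (f \<nu>)" for \<nu>
  have step: "card (fst (F (\<alpha>, \<beta>))) = min (g \<alpha>) (g \<beta>)" "g \<beta> = Suc (g \<alpha>) \<or> g \<alpha> = Suc (g \<beta>)"
    "(f \<alpha>, f \<beta>) \<in> P \<longleftrightarrow> g \<alpha> < g \<beta>" "(f \<beta>, f \<alpha>) \<in> P \<longleftrightarrow> g \<beta> < g \<alpha>" if ab: "(\<alpha>, \<beta>) \<in> P" for \<alpha> \<beta>
  proof -
    have up: "g \<nu> = Suc (g \<mu>)" if "(f \<mu>, f \<nu>) \<in> P" for \<mu> \<nu>
      using that by (simp add: pair_iff g_def)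
    consider "F (\<alpha>, \<beta>) = (f \<alpha>, f \<beta>)" "(f \<alpha>, f \<beta>) \<in> P" | "F (\<alpha>, \<beta>) = (f \<beta>, f \<alpha>)" "(f \<beta>, f \<alpha>) \<in> P"
      using induced_pair[OF ind ab] by blast
    then have "card (fst (F (\<alpha>, \<beta>))) = min (g \<alpha>) (g \<beta>) \<and> (g \<beta> = Suc (g \<alpha>) \<or> g \<alpha> = Suc (g \<beta>)) \<and>
      ((f \<alpha>, f \<beta>) \<in> P \<longleftrightarrow> g \<alpha> < g \<beta>) \<and> ((f \<beta>, f \<alpha>) \<in> P \<longleftrightarrow> g \<beta> < g \<alpha>)"
    proof cases
      case 1
      moreover have "(f \<beta>, f \<alpha>) \<notin> P" using up[of \<alpha> \<beta>] up[of \<beta> \<alpha>] 1(2) by linarith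
      ultimately show ?thesis using up[OF 1(2)] by (simp add: g_def)
    next
      case 2
      moreover have "(f \<alpha>, f \<beta>) \<notin> P" using up[of \<alpha> \<beta>] up[of \<beta> \<alpha>] 2(2) by linarith
      ultimately show ?thesis using up[OF 2(2)] by (simp add: g_def)
    qed
    then show "card (fst (F (\<alpha>, \<beta>))) = min (g \<alpha>) (g \<beta>)" "g \<beta> = Suc (g \<alpha>) \<or> g \<alpha> = Suc (g \<beta>)"
      "(f \<alpha>, f \<beta>) \<in> P \<longleftrightarrow> g \<alpha> < g \<beta>" "(f \<beta>, f \<alpha>) \<in> P \<longleftrightarrow> g \<beta> < g \<alpha>"
      by blast+
  qed
  note diff = step(2)[OF hex(1)] step(2)[OF hex(2)] step(2)[OF hex(3)] step(2)[OF hex(4)]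
    step(2)[OF hex(5)] step(2)[OF hex(6)] step(2)[OF hex(7)] step(2)[OF hex(9)]
  have m: "min (g B) (g BC) = min (g A) (g AB)" "min (g C) (g CA) = min (g A) (g AB)"
    using l1 l2 step(1)[OF hex(1)] step(1)[OF hex(2)] step(1)[OF hex(3)] by simp_all
  have ne: "f AB \<noteq> f CA" "f A \<noteq> f R"
    using Bij_eq_iff[OF fB] K dist level by simp_all
  \<comment> \<open>\<open>A\<close> and \<open>R\<close> are both adjacent to \<open>AB\<close> and
    \<open>CA\<close>. If their images lay on the same side of these two, distinct simplices would
    have two common covers.\<close>
  have unique: "\<not> ((f A, f AB) \<in> P \<and> (f R, f AB) \<in> P \<and> (f A, f CA) \<in> P \<and> (f R, f CA) \<in> P)"
    "\<not> ((f AB, f A) \<in> P \<and> (f AB, f R) \<in> P \<and> (f CA, f A) \<in> P \<and> (f CA, f R) \<in> P)"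
    using two_covers_unique ne by blast+
  show ?thesis unfolding eqs
  proof (cases "g A < g AB")
    case True
    then have AB: "g AB = Suc (g A)" using diff(1) by linarith
    \<comment> \<open>Neighbours on the hexagon differ by one level, and the three image pairs have
      the same lower level; walking along the hexagon from \<open>AB\<close> then fixes each level
      in turn.\<close>
    then have "g BC = Suc (g A)" using diff(2,4) m(1) by linarith
    then have CA: "g CA = Suc (g A)" using diff(3,5) m(2) AB by linarith
    have "g AB < g R"
    proof (rule ccontr)
      assume "\<not> g AB < g R"
      then have "g R < g AB" "g R < g CA" "g A < g CA" using diff(7) AB CA by linarith+
      then show False using unique(1) step(3,4) hex True by blast
    qed
    then show "(f A, f AB) \<in> P \<longleftrightarrow> (f AB, f R) \<in> P" using True step(3) hex by blast
  next
    case False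
    then have AB: "g A = Suc (g AB)" using diff(1) by linarith
    then have "g BC = g AB" using diff(2,4) m(1) by linarith
    then have CA: "g CA = g AB" using diff(3,5) m(2) AB by linarith
    have "\<not> g AB < g R"
    proof
      assume R: "g AB < g R"
      then have "g CA < g R" "g CA < g A" "g AB < g A" using AB CA by linarith+
      then show False using unique(2) step(3,4) hex R by blast
    qed
    then show "(f A, f AB) \<in> P \<longleftrightarrow> (f AB, f R) \<in> P" using False step(3) hex by blast
  qed
qed

lemma induces_inverse:
  assumes "induces f F"
  shows "induces (inverse_map f) (restrict (inv_into P F) P)"
proof -
  have F: "F \<in> carrier (vertex_aut (morse_complex K))" and fB: "f \<in> Bij K"
    and e: "\<And>x. x \<in> P \<Longrightarrow> ends (F x) = f ` ends x"
    using assms by (auto simp: induces_def)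
  let ?G = "restrict (inv_into P F) P"
  note FB = F_Bij[OF F]
  have G: "?G \<in> carrier (vertex_aut (morse_complex K))"
    using finite_complex.vertex_aut_inverse[OF finite_complex_morse F] by (simp only: Union_morse)
  have "ends (?G x) = inverse_map f ` ends x" if x: "x \<in> P" for x
  proof -
    have Gx: "?G x \<in> P" "F (?G x) = x"
      using Bij_mem[OF restrict_inv_into_Bij[OF FB] x] bij_betw_inv_into_right[OF Bij_bij[OF FB] x] x by auto
    have "inverse_map f ` ends x = inverse_map f ` f ` ends (?G x)" using e[OF Gx(1)] Gx(2) by simp
    also have "\<dots> = ends (?G x)"
      unfolding image_image using inverse_map(3)[OF fB] ends_subset[OF Gx(1)]
      by (simp add: subset_iff)
    finally show ?thesis by simp
  qed
  then show ?thesis using G inverse_map(1)[OF fB] unfolding induces_def by blast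
qed

lemma induced_reflects_chain:
  assumes ind: "induces f F" and K: "\<sigma> \<in> K" "\<tau> \<in> K" "\<rho> \<in> K"
    and chain: "(f \<sigma>, f \<tau>) \<in> P" "(f \<tau>, f \<rho>) \<in> P"
  shows "(\<sigma>, \<tau>) \<in> P \<longleftrightarrow> (\<tau>, \<rho>) \<in> P"
proof -
  have "inverse_map f (f \<nu>) = \<nu>" if "\<nu> \<in> K" for \<nu>
    using inverse_map(3)[OF _ that] ind unfolding induces_def by blast
  note i = this[OF K(1)] this[OF K(2)] this[OF K(3)]
  show ?thesis using induced_chain[OF induces_inverse[OF ind] chain] unfolding i .
qed

text \<open>If the shared simplex is the upper end of one pair and the lower end of the other, they
  form a chain. If it is on the same side of both, opposite treatment would turn this zigzag into a
  chain, and the inverse map would have to carry that chain to a chain again, not to a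
  zigzag.\<close>

lemma induced_sign:
  assumes ind: "induces f F" and P: "x \<in> P" "y \<in> P" and meet: "ends x \<inter> ends y \<noteq> {}"
  shows "(f (fst x), f (snd x)) \<in> P \<longleftrightarrow> (f (fst y), f (snd y)) \<in> P"
proof -
  obtain \<sigma> \<tau> \<alpha> \<beta> where xy: "x = (\<sigma>, \<tau>)" "y = (\<alpha>, \<beta>)" by (cases x; cases y)
  have K: "\<sigma> \<in> K" "\<tau> \<in> K" "\<alpha> \<in> K" "\<beta> \<in> K" using P by (auto simp: xy pair_iff)
  have s: "(f \<sigma>, f \<tau>) \<in> P \<longleftrightarrow> (f \<tau>, f \<sigma>) \<notin> P" if "(\<sigma>, \<tau>) \<in> P" for \<sigma> \<tau>
    using induced_pair[OF ind that] unfolding pair_iff by auto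
  have nc: "(\<tau>, \<sigma>) \<notin> P" "(\<beta>, \<alpha>) \<notin> P" using P by (auto simp: xy pair_iff)
  consider "\<tau> = \<alpha>" | "\<beta> = \<sigma>" | "\<sigma> = \<alpha>" | "\<tau> = \<beta>" using meet by (auto simp: xy ends_def)
  then show ?thesis
  proof cases
    case 1
    then show ?thesis using induced_chain[OF ind] P by (simp add: xy)
  next
    case 2
    then show ?thesis using induced_chain[OF ind, of \<alpha> \<beta> \<tau>] P by (simp add: xy)
  next
    case 3
    then show ?thesis
      using induced_reflects_chain[OF ind K(2,1,4)] induced_reflects_chain[OF ind K(4,1,2)] P s nc
      by (auto simp: xy)
  next
    case 4
    then show ?thesis
      using induced_reflects_chain[OF ind K(1,2,3)] induced_reflects_chain[OF ind K(3,2,1)] P s nc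
      by (auto simp: xy)
  qed
qed

lemma induced_cover_group:
  assumes ind: "induces f F"
  shows "f \<in> carrier (cover_group K)"
proof -
  define s where "s x \<longleftrightarrow> (f (fst x), f (snd x)) \<in> P" for x
  \<comment> \<open>The direction of a pair is transferred to its ends. Pairs with a common simplex
    agree, so this is consistent on nodes and constant along pairs.\<close>
  define c where "c \<nu> \<longleftrightarrow> (\<exists>x\<in>P. \<nu> \<in> ends x \<and> s x)" for \<nu>
  have c: "c \<nu> = s x" if "x \<in> P" "\<nu> \<in> ends x" for x \<nu>
    unfolding c_def s_def using induced_sign[OF ind] that by blast
  have const: "c \<mu> = c \<nu>" if "\<mu> \<in> K" "\<nu> \<in> K" for \<mu> \<nu>
  proof (rule constant_if_constant_on_pairs[OF _ that])
    fix \<sigma> \<tau> assume "(\<sigma>, \<tau>) \<in> P"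
    then show "c \<sigma> = c \<tau>" using c[of "(\<sigma>, \<tau>)"] by (simp add: ends_def)
  qed
  have all: "s x = s y" if "x \<in> P" "y \<in> P" for x y
    using const[OF pairD(1)[OF that(1)] pairD(1)[OF that(2)]] c that by (simp add: ends_def)
  have "cover_preserving K f \<or> cover_reversing K f"
  proof (cases "\<forall>x\<in>P. s x")
    case True
    then show ?thesis unfolding cover_preserving_def s_def by auto
  next
    case False
    then have "\<not> s x" if "x \<in> P" for x using all that by blast
    then have "cover_reversing K f"
      unfolding cover_reversing_def s_def using induced_pair[OF ind] by fastforce
    then show ?thesis by simp
  qed
  then show ?thesis using ind by (simp add: induces_def carrier_cover_group)
qed

text \<open>Bijectivity comes from the inverse of \<open>F\<close>: its node map composed with that
  of \<open>F\<close> fixes the ends of every pair, hence every simplex.\<close>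

lemma induced_exists:
  assumes F: "F \<in> carrier (vertex_aut (morse_complex K))"
  obtains f where "induces f F"
proof -
  let ?G = "restrict (inv_into P F) P"
  note FB = F_Bij[OF F]
  have G: "?G \<in> carrier (vertex_aut (morse_complex K))"
    using finite_complex.vertex_aut_inverse[OF finite_complex_morse F] by (simp only: Union_morse)
  obtain f where f: "\<And>\<sigma>. \<sigma> \<in> K \<Longrightarrow> f \<sigma> \<in> K" "\<And>x. x \<in> P \<Longrightarrow> ends (F x) = f ` ends x"
    using node_map_exists[OF F] by metis
  obtain g where g: "\<And>\<sigma>. \<sigma> \<in> K \<Longrightarrow> g \<sigma> \<in> K" "\<And>x. x \<in> P \<Longrightarrow> ends (?G x) = g ` ends x"
    using node_map_exists[OF G] by metis
  have gf: "g (f \<sigma>) = \<sigma>" if "\<sigma> \<in> K" for \<sigma>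
  proof -
    have "(g \<circ> f) \<sigma> = id \<sigma>"
    proof (rule node_map_unique[OF inj_on_id _ that])
      fix x assume x: "x \<in> P"
      have "?G (F x) = x"
        using bij_betw_inv_into_left[OF Bij_bij[OF FB] x] F_mem[OF F x] by simp
      then have "ends x = g ` f ` ends x" using g(2)[OF F_mem[OF F x]] f(2)[OF x] by simp
      then show "(g \<circ> f) ` ends x = id ` ends x" unfolding image_comp[symmetric] by simp
    qed
    then show ?thesis by simp
  qed
  have "inj_on f K" using gf by (rule inj_on_inverseI)
  moreover have "f ` K \<subseteq> K" using f(1) by blast
  ultimately have "bij_betw f K K" unfolding bij_betw_def using endo_inj_surj[OF fin] by blast
  then have "restrict f K \<in> Bij K"
    by (rule restrict_Bij)
  moreover have "restrict f K ` ends x = f ` ends x" if "x \<in> P" for x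
    using ends_subset[OF that] by (intro image_cong) auto
  ultimately have "induces (restrict f K) F" using F f(2) unfolding induces_def by simp
  then show ?thesis by (rule that)
qed

text \<open>For surjectivity, \<open>pair_map K f\<close> and \<open>F\<close> agree on ends, which
  already determine the pair, whichever direction \<open>f\<close> has.\<close>

theorem cover_group_iso_morse: "pair_map K \<in> iso (cover_group K) (vertex_aut (morse_complex K))"
proof (rule isoI[OF pair_map_hom])
  show "bij_betw (pair_map K) (carrier (cover_group K)) (carrier (vertex_aut (morse_complex K)))"
    unfolding bij_betw_def
  proof (intro conjI inj_onI equalityI subsetI)
    fix f g assume fg: "f \<in> carrier (cover_group K)" "g \<in> carrier (cover_group K)"
      "pair_map K f = pair_map K g"
    then have B: "f \<in> Bij K" "g \<in> Bij K" by (auto simp: carrier_cover_group)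
    show "f = g"
    proof (rule Bij_ext[OF B])
      fix \<sigma> assume "\<sigma> \<in> K"
      show "f \<sigma> = g \<sigma>"
      proof (rule node_map_unique[OF _ _ \<open>\<sigma> \<in> K\<close>])
        show "inj_on g K" using Bij_bij[OF B(2)] by (rule bij_betw_imp_inj_on)
        show "f ` ends x = g ` ends x" if "x \<in> P" for x
          using pair_map(2)[OF fg(1) that] pair_map(2)[OF fg(2) that] fg(3) by simp
      qed
    qed
  next
    fix F assume "F \<in> pair_map K ` carrier (cover_group K)"
    then show "F \<in> carrier (vertex_aut (morse_complex K))" using pair_map_vertex_aut by blast
  next
    fix F assume F: "F \<in> carrier (vertex_aut (morse_complex K))"
    obtain f where f: "induces f F" using induced_exists[OF F] .
    note fc = induced_cover_group[OF f]
    have "pair_map K f = F"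
    proof (rule Bij_ext[OF pair_map_Bij[OF fc] F_Bij[OF F]])
      fix x assume x: "x \<in> P"
      have "ends (pair_map K f x) = ends (F x)"
        using pair_map(2)[OF fc x] f x by (simp add: induces_def)
      then show "pair_map K f x = F x"
        using ends_inj pair_map(1)[OF fc x] F_mem[OF F x] by blast
    qed
    then show "F \<in> pair_map K ` carrier (cover_group K)" using fc by blast
  qed
qed

end

section \<open>Complexes with an order-reversing symmetry\<close>

lemma simplicially_isomorphic_image:
  assumes h: "inj_on h (\<Union>L)" and K: "K = image h ` L"
  shows "simplicially_isomorphic K L"
proof -
  let ?g = "inv_into (\<Union>L) h"
  have inv: "?g ` h ` \<sigma> = \<sigma>" if "\<sigma> \<in> L" for \<sigma>
    using inv_into_image_cancel[OF h Union_upper[OF that]] .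
  have "simplicial_map K L (image ?g)"
    unfolding simplicial_map_def
  proof (intro exI[of _ ?g] conjI ballI)
    show "?g ` \<Union>K \<subseteq> \<Union>L" using inv_into_into[of _ h "\<Union>L"] unfolding K by fastforce
  qed (use inv in \<open>auto simp: K\<close>)
  moreover have "bij_betw (image ?g) K L"
  proof (rule bij_betw_byWitness[where f' = "image h"])
    show "\<forall>\<sigma>\<in>K. h ` ?g ` \<sigma> = \<sigma>" "image ?g ` K \<subseteq> L" using inv by (simp_all add: K image_subset_iff)
  qed (use inv in \<open>auto simp: K\<close>)
  ultimately show ?thesis
    unfolding simplicially_isomorphic_def by blast
qed

text \<open>The isomorphism is turned round into a labelling of the vertices of \<open>K\<close> by
  those of the model, so that \<open>K\<close> can be rewritten as a relabelled copy of it.\<close>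

lemma (in finite_complex) simplicially_isomorphic_obtain:
  assumes "simplicially_isomorphic K L"
  obtains u where "inj_on u (\<Union>L)" "K = image u ` L" "u ` \<Union>L = \<Union>K"
proof -
  obtain f where f: "simplicial_map K L f" "bij_betw f K L"
    using assms unfolding simplicially_isomorphic_def by blast
  obtain g where g: "g ` \<Union>K \<subseteq> \<Union>L" "\<forall>\<sigma>\<in>K. g ` \<sigma> \<in> L \<and> f \<sigma> = g ` \<sigma>"
    using f(1) unfolding simplicial_map_def by (elim exE conjE)
  have inj: "inj_on g (\<Union>K)"
    using vertex_map_inj[OF bij_betw_imp_inj_on[OF f(2)]] g(2) by blast
  have L: "L = image g ` K" using g(2) f(2) by (simp add: bij_betw_def)
  have UL: "\<Union>L = g ` \<Union>K" unfolding L by blast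
  let ?u = "inv_into (\<Union>K) g"
  have inv: "?u ` g ` \<sigma> = \<sigma>" if "\<sigma> \<in> K" for \<sigma>
    using inv_into_image_cancel[OF inj Union_upper[OF that]] .
  show ?thesis
  proof (rule that)
    show "inj_on ?u (\<Union>L)" unfolding UL by (rule inj_on_inv_into) simp
    have "image ?u ` L = (\<lambda>\<sigma>. ?u ` g ` \<sigma>) ` K" unfolding L by (rule image_image)
    also have "\<dots> = K" using inv by simp
    finally show "K = image ?u ` L" by (rule sym)
    show "?u ` \<Union>L = \<Union>K" unfolding UL by (rule inv_into_image_cancel[OF inj]) simp
  qed
qed

lemma boundary_simplex_singleton:
  assumes "1 \<le> n" "i \<le> n"
  shows "{i} \<in> boundary_simplex n"
proof -
  have "0 \<in> {0..n}" "1 \<in> {0..n}" using assms by simp_all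
  then have "{i} \<noteq> {0..n}" by (metis singletonD zero_neq_one)
  then show ?thesis using assms(2) by (simp add: boundary_simplex_def psubset_eq)
qed

lemma image_boundary_simplex:
  assumes "inj_on u {0..n}"
  shows "image u ` boundary_simplex n = {\<sigma>. \<sigma> \<noteq> {} \<and> \<sigma> \<subset> u ` {0..n}}"
proof (intro equalityI subsetI)
  fix \<sigma> assume "\<sigma> \<in> image u ` boundary_simplex n"
  then obtain \<tau> where \<tau>: "\<tau> \<noteq> {}" "\<tau> \<subset> {0..n}" "\<sigma> = u ` \<tau>"
    by (auto simp: boundary_simplex_def)
  then have "u ` \<tau> \<subset> u ` {0..n}"
    using assms by (metis inj_on_image_eq_iff image_mono order_refl psubset_eq)
  then show "\<sigma> \<in> {\<sigma>. \<sigma> \<noteq> {} \<and> \<sigma> \<subset> u ` {0..n}}" using \<tau> by simp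
next
  fix \<sigma> assume "\<sigma> \<in> {\<sigma>. \<sigma> \<noteq> {} \<and> \<sigma> \<subset> u ` {0..n}}"
  then have \<sigma>: "\<sigma> \<noteq> {}" "\<sigma> \<subset> u ` {0..n}" by auto
  then obtain \<tau> where \<tau>: "\<tau> \<subseteq> {0..n}" "\<sigma> = u ` \<tau>"
    by (metis psubset_imp_subset subset_image_iff)
  then have "\<tau> \<noteq> {0..n}" using \<sigma>(2) by auto
  then show "\<sigma> \<in> image u ` boundary_simplex n"
    using \<tau> \<sigma>(1) by (auto simp: boundary_simplex_def)
qed

context connected_complex_with_edge
begin

definition nbrs :: "'a \<Rightarrow> 'a set" where
  "nbrs v = {w. w \<noteq> v \<and> {v, w} \<in> K}"

lemma nbrs_sym: "w \<in> nbrs v \<longleftrightarrow> v \<in> nbrs w"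
  by (auto simp: nbrs_def insert_commute)

lemma nbrs_vertex: "w \<in> nbrs v \<Longrightarrow> w \<in> \<Union>K"
  by (auto simp: nbrs_def)

lemma finite_nbrs: "finite (nbrs v)"
  using finite_subset[OF _ finite_vertices] nbrs_vertex by blast

lemma vertices_closed:
  assumes "v \<in> \<Union>K" "v \<in> S" and closed: "\<And>u w. u \<in> S \<Longrightarrow> w \<in> nbrs u \<Longrightarrow> w \<in> S"
  shows "\<Union>K \<subseteq> S"
proof
  fix w assume "w \<in> \<Union>K"
  then have "(v, w) \<in> {(x, y). {x, y} \<in> K}\<^sup>*"
    using connected assms(1) unfolding connected_complex_def by blast
  then show "w \<in> S"
  proof (induction rule: rtrancl_induct)
    case (step y z)
    then show ?case using closed[of y z] by (cases "y = z") (auto simp: nbrs_def)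
  qed (rule assms(2))
qed

context
  fixes f
  assumes fB: "f \<in> Bij K" and rev: "cover_reversing K f"
begin

text \<open>Since covers are reversed, \<open>card (f \<sigma>) + card \<sigma>\<close> is constant; \<open>f\<close> exchanges vertices
  with simplices of the maximal cardinality \<open>top_card\<close>.\<close>

definition top_card :: nat where
  "top_card = card (f (SOME \<sigma>. \<sigma> \<in> K)) + card (SOME \<sigma>. \<sigma> \<in> K) - 1"

lemma card_reversed:
  assumes "\<sigma> \<in> K"
  shows "card (f \<sigma>) + card \<sigma> = Suc top_card"
proof -
  let ?s = "SOME \<sigma>. \<sigma> \<in> K"
  have s: "?s \<in> K" using assms by (rule someI)
  \<comment> \<open>Going up a cover adds one to the size of the simplex and takes one from the size
    of its image.\<close>
  have "card (f \<sigma>) + card \<sigma> = card (f ?s) + card ?s"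
  proof (rule constant_if_constant_on_pairs[OF _ assms s])
    fix \<alpha> \<beta> assume "(\<alpha>, \<beta>) \<in> P"
    then have "(\<alpha>, \<beta>) \<in> P" "(f \<beta>, f \<alpha>) \<in> P" using rev unfolding cover_reversing_def by auto
    then show "card (f \<alpha>) + card \<alpha> = card (f \<beta>) + card \<beta>" by (simp add: pair_iff)
  qed
  then show ?thesis using card_pos[OF s] by (simp add: top_card_def)
qed

lemma card_le_top: "\<sigma> \<in> K \<Longrightarrow> card \<sigma> \<le> top_card"
  using card_reversed card_pos[OF Bij_mem[OF fB]] by fastforce

lemma card_vertex_image: "{v} \<in> K \<Longrightarrow> card (f {v}) = top_card"
  using card_reversed[of "{v}"] by simp

lemma top_card_ge_2: "2 \<le> top_card"
proof -
  obtain \<sigma> \<tau> where "(\<sigma>, \<tau>) \<in> P" using pairs_nonempty by auto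
  then show ?thesis using card_le_top[of \<tau>] card_pos[of \<sigma>] by (simp add: pair_iff)
qed

text \<open>The edges at \<open>v\<close> are the covers of \<open>{v}\<close>; \<open>f\<close>
  carries them to the codimension-one faces of \<open>f {v}\<close>, one for each of its
  \<open>top_card\<close> vertices.\<close>

lemma card_nbrs:
  assumes v: "{v} \<in> K"
  shows "card (nbrs v) = top_card"
proof -
  let ?T = "f {v}" and ?E = "{e. ({v}, e) \<in> P}"
  have T: "?T \<in> K" using Bij_mem[OF fB v] .
  have cT: "card ?T = top_card" using card_vertex_image[OF v] .
  have "bij_betw (\<lambda>w. {v, w}) (nbrs v) ?E"
  proof (rule bij_betw_imageI)
    show "inj_on (\<lambda>w. {v, w}) (nbrs v)" by (rule inj_onI) (auto simp: nbrs_def doubleton_eq_iff)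
    show "(\<lambda>w. {v, w}) ` nbrs v = ?E"
    proof (intro equalityI subsetI)
      fix e assume "e \<in> ?E"
      then have e: "e \<in> K" "v \<in> e" "card e = 2" by (auto simp: pair_iff)
      then obtain w where "e = {v, w}" "w \<noteq> v"
        by (metis card_2_iff doubleton_eq_iff insertE singletonD)
      then show "e \<in> (\<lambda>w. {v, w}) ` nbrs v" using e by (auto simp: nbrs_def)
    qed (use v in \<open>auto simp: nbrs_def pair_iff\<close>)
  qed
  moreover have "bij_betw f ?E ((\<lambda>a. ?T - {a}) ` ?T)"
  proof (rule bij_betw_imageI)
    have "?E \<subseteq> K" by (auto simp: pair_iff)
    then show "inj_on f ?E"
      using Bij_bij[OF fB] by (meson bij_betw_imp_inj_on inj_on_subset)
    show "f ` ?E = (\<lambda>a. ?T - {a}) ` ?T"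
    proof (intro equalityI subsetI)
      fix \<rho> assume "\<rho> \<in> f ` ?E"
      then have p: "(\<rho>, ?T) \<in> P" using rev unfolding cover_reversing_def by auto
      then have \<rho>: "\<rho> \<subset> ?T" "card ?T = Suc (card \<rho>)" "\<rho> \<in> K" by (simp_all add: pair_iff)
      then have "card (?T - \<rho>) = 1"
        using card_Diff_subset[OF simplex_finite[OF \<rho>(3)], of ?T] by auto
      then obtain a where a: "?T - \<rho> = {a}" by (rule card_1_singletonE)
      then have "\<rho> = ?T - {a}" "a \<in> ?T" using \<rho>(1) by blast+
      then show "\<rho> \<in> (\<lambda>a. ?T - {a}) ` ?T" by blast
    next
      fix \<rho> assume "\<rho> \<in> (\<lambda>a. ?T - {a}) ` ?T"
      then obtain a where a: "a \<in> ?T" "\<rho> = ?T - {a}" by blast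
      have "?T \<noteq> {a}" using cT top_card_ge_2 by auto
      then have p: "(\<rho>, ?T) \<in> P" using remove_pair[OF T a(1)] a(2) by simp
      then have "\<rho> \<in> K" by (simp add: pair_iff)
      then obtain e where e: "e \<in> K" "f e = \<rho>" using Bij_obtain[OF fB] by metis
      then have "({v}, e) \<in> P" using cover_reversing_iff[OF fB rev v e(1)] p by simp
      then show "\<rho> \<in> f ` ?E" using e(2) by blast
    qed
  qed
  moreover have "card ((\<lambda>a. ?T - {a}) ` ?T) = top_card"
    using cT by (subst card_image) (auto intro: inj_onI)
  ultimately show ?thesis by (metis bij_betw_same_card)
qed

lemma card_closed_nbrs: "{v} \<in> K \<Longrightarrow> card (insert v (nbrs v)) = Suc top_card"
  using card_nbrs finite_nbrs by (simp add: nbrs_def)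

text \<open>Simplices of maximal size at \<open>v\<close> correspond under \<open>f\<close> to the
  vertices of \<open>f {v}\<close>, so there are \<open>top_card\<close> of them. Each misses
  exactly one neighbour in the closed neighbourhood of \<open>v\<close>, which leaves only
  \<open>top_card\<close> candidates; hence all candidates occur.\<close>

lemma facets_at_vertex:
  assumes v: "{v} \<in> K" and a: "a \<in> nbrs v"
  shows "insert v (nbrs v) - {a} \<in> K"
proof -
  let ?N = "insert v (nbrs v)" and ?F = "{\<tau> \<in> K. v \<in> \<tau> \<and> card \<tau> = top_card}"
  let ?G = "(\<lambda>a. ?N - {a}) ` nbrs v"
  have "bij_betw f ?F ((\<lambda>a. {a}) ` f {v})"
  proof (rule bij_betw_imageI)
    show "inj_on f ?F"
      by (rule inj_on_subset[OF bij_betw_imp_inj_on[OF Bij_bij[OF fB]]]) auto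
    show "f ` ?F = (\<lambda>a. {a}) ` f {v}"
    proof (intro equalityI subsetI)
      fix \<rho> assume "\<rho> \<in> f ` ?F"
      then obtain \<tau> where \<tau>: "\<tau> \<in> K" "v \<in> \<tau>" "card \<tau> = top_card" "\<rho> = f \<tau>" by blast
      then have "card (f \<tau>) = 1" using card_reversed[OF \<tau>(1)] by simp
      then obtain b where b: "f \<tau> = {b}" by (rule card_1_singletonE)
      have "f \<tau> \<subseteq> f {v}" using reversing_antimono[OF rev v \<tau>(1)] \<tau>(2) by simp
      then show "\<rho> \<in> (\<lambda>a. {a}) ` f {v}" using b \<tau>(4) by auto
    next
      fix \<rho> assume "\<rho> \<in> (\<lambda>a. {a}) ` f {v}"
      then obtain b where b: "b \<in> f {v}" "\<rho> = {b}" by blast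
      then have "\<rho> \<in> K" using face_closed[OF Bij_mem[OF fB v], of \<rho>] by simp
      then obtain \<tau> where \<tau>: "\<tau> \<in> K" "f \<tau> = \<rho>" using Bij_obtain[OF fB] by metis
      have "{v} \<subseteq> \<tau>" using reversing_subset_iff[OF fB rev v \<tau>(1)] b \<tau>(2) by simp
      moreover have "card \<tau> = top_card" using card_reversed[OF \<tau>(1)] \<tau>(2) b(2) by simp
      ultimately show "\<rho> \<in> f ` ?F" using \<tau> by blast
    qed
  qed
  then have "card ?F = card ((\<lambda>a. {a}) ` f {v})" by (rule bij_betw_same_card)
  also have "\<dots> = top_card" using card_vertex_image[OF v] by (simp add: card_image)
  finally have cF: "card ?F = top_card" .
  have "?F \<subseteq> ?G"
  proof
    fix \<tau> assume "\<tau> \<in> ?F"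
    then have \<tau>: "\<tau> \<in> K" "v \<in> \<tau>" "card \<tau> = top_card" by auto
    have sub: "\<tau> \<subseteq> ?N"
    proof
      fix w assume w: "w \<in> \<tau>"
      then have "{v, w} \<in> K" using face_closed[OF \<tau>(1), of "{v, w}"] \<tau>(2) by simp
      then show "w \<in> ?N" by (auto simp: nbrs_def)
    qed
    then have "card (?N - \<tau>) = 1"
      using card_closed_nbrs[OF v] \<tau>(3) simplex_finite[OF \<tau>(1)] by (simp add: card_Diff_subset)
    then obtain b where b: "?N - \<tau> = {b}" by (rule card_1_singletonE)
    then have "\<tau> = ?N - {b}" "b \<in> nbrs v" using sub \<tau>(2) by auto
    then show "\<tau> \<in> ?G" by blast
  qed
  moreover have "finite ?G" using finite_nbrs by simp
  moreover have "card ?G \<le> card ?F"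
    using card_image_le[OF finite_nbrs, of "\<lambda>a. ?N - {a}" v] card_nbrs[OF v] cF by simp
  ultimately have "?F = ?G" by (intro card_seteq)
  then show ?thesis using a by blast
qed

text \<open>Every vertex has exactly \<open>top_card\<close> neighbours, and its facets are obtained from its closed
  neighbourhood by dropping one neighbour.  For \<open>top_card \<ge> 3\<close> this makes closed neighbourhoods
  cliques, so by connectedness there is only one.\<close>

lemma reversing_high_dim:
  assumes D: "3 \<le> top_card"
  shows "simplicially_isomorphic K (boundary_simplex top_card)"
proof -
  obtain \<sigma>0 \<tau>0 where "(\<sigma>0, \<tau>0) \<in> P" using pairs_nonempty by auto
  then have "\<sigma>0 \<in> K" by (simp add: pair_iff)
  then obtain v where v: "{v} \<in> K" using simplex_nonempty[of \<sigma>0] face_closed[of \<sigma>0] by blast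
  define N where "N u = insert u (nbrs u)" for u
  have cN: "card (N u) = Suc top_card" if "{u} \<in> K" for u
    using card_closed_nbrs[OF that] by (simp add: N_def)
  have clique: "b \<in> N a" if u: "{u} \<in> K" and ab: "a \<in> N u" "b \<in> N u" for u a b
  proof -
    \<comment> \<open>With at least three neighbours, some \<open>c\<close> differs from
      \<open>a\<close> and \<open>b\<close>, and the facet that drops \<open>c\<close> contains
      both.\<close>
    have "card (nbrs u - {a, b}) \<noteq> 0"
      using card_nbrs[OF u] D diff_card_le_card_Diff[of "{a, b}" "nbrs u"] card_insert_le_m1[of 2 "{b}" a]
      by (auto simp: card_insert_if split: if_splits)
    then have "nbrs u - {a, b} \<noteq> {}" by (metis card.empty)
    then obtain c where c: "c \<in> nbrs u" "c \<noteq> a" "c \<noteq> b" by blast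
    have "{a, b} \<subseteq> insert u (nbrs u) - {c}" using ab c by (simp add: N_def)
    then have "{a, b} \<in> K" using face_closed[OF facets_at_vertex[OF u c(1)]] by simp
    then show ?thesis by (auto simp: N_def nbrs_def)
  qed
  have same: "N a = N u" if u: "{u} \<in> K" and a: "a \<in> nbrs u" for u a
  proof -
    have a': "{a} \<in> K" using nbrs_vertex[OF a] by (simp only: vertex_iff)
    have "N u \<subseteq> N a" using clique[OF u] a by (auto simp: N_def[of u])
    moreover have "finite (N a)" using finite_nbrs by (simp add: N_def)
    ultimately show ?thesis using cN[OF u] cN[OF a'] by (metis card_subset_eq)
  qed
  have "\<Union>K \<subseteq> {u \<in> \<Union>K. N u = N v}"
  proof (rule vertices_closed[of v])
    fix u w assume "u \<in> {u \<in> \<Union>K. N u = N v}" and w: "w \<in> nbrs u"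
    then have "{u} \<in> K" "N u = N v" by (simp_all only: mem_Collect_eq vertex_iff)
    then show "w \<in> {u \<in> \<Union>K. N u = N v}" using same[OF _ w] nbrs_vertex[OF w] by simp
  qed (use v in auto)
  then have all: "N u = N v" if "{u} \<in> K" for u using that by blast
  have W: "\<Union>K = N v"
  proof
    show "\<Union>K \<subseteq> N v"
    proof
      fix u assume "u \<in> \<Union>K"
      then have "{u} \<in> K" by (simp only: vertex_iff)
      then show "u \<in> N v" using all by (force simp: N_def)
    qed
    show "N v \<subseteq> \<Union>K" using nbrs_vertex v by (auto simp: N_def)
  qed
  have fW: "finite (N v)" using W finite_vertices by simp
  have K: "K = {\<sigma>. \<sigma> \<noteq> {} \<and> \<sigma> \<subset> N v}"
  proof (intro equalityI subsetI)
    fix \<sigma> assume \<sigma>: "\<sigma> \<in> K"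
    then have "\<sigma> \<subseteq> N v" "\<sigma> \<noteq> N v" using W card_le_top[OF \<sigma>] cN[OF v] by auto
    then show "\<sigma> \<in> {\<sigma>. \<sigma> \<noteq> {} \<and> \<sigma> \<subset> N v}" using simplex_nonempty[OF \<sigma>] by blast
  next
    fix \<sigma> assume "\<sigma> \<in> {\<sigma>. \<sigma> \<noteq> {} \<and> \<sigma> \<subset> N v}"
    \<comment> \<open>All closed neighbourhoods agree, so the centre may be moved to a vertex
      \<open>u\<close> of \<sigma>. The missing element \<open>a\<close> is then a neighbour of
      \<open>u\<close>, and the facet dropping it contains \<sigma>.\<close>
    then obtain u a where ua: "u \<in> \<sigma>" "a \<in> N v" "a \<notin> \<sigma>" "\<sigma> \<subseteq> N v" by blast
    then have "u \<in> \<Union>K" using W by blast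
    then have u: "{u} \<in> K" by (simp only: vertex_iff)
    have "a \<in> nbrs u" using all[OF u] ua by (auto simp: N_def)
    then have "N v - {a} \<in> K" using facets_at_vertex[OF u] all[OF u] by (simp add: N_def)
    then show "\<sigma> \<in> K" using face_closed[of "N v - {a}" \<sigma>] ua by blast
  qed
  obtain h where h: "bij_betw h {0..top_card} (N v)"
    using fW cN[OF v] ex_bij_betw_nat_finite[OF fW] by (metis atLeastLessThanSuc_atLeastAtMost)
  have UB: "\<Union>(boundary_simplex top_card) \<subseteq> {0..top_card}" by (auto simp: boundary_simplex_def)
  have "K = image h ` boundary_simplex top_card"
    using K image_boundary_simplex[of h top_card] h by (simp add: bij_betw_def)
  moreover have "inj_on h (\<Union>(boundary_simplex top_card))"
    using h UB by (meson bij_betw_imp_inj_on inj_on_subset)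
  ultimately show ?thesis by (intro simplicially_isomorphic_image)
qed

end

end

section \<open>Two-regular graphs and the classification\<close>

context connected_complex_with_edge
begin

definition path where
  "path xs \<longleftrightarrow> distinct xs \<and> set xs \<subseteq> \<Union>K \<and> (\<forall>i. Suc i < length xs \<longrightarrow> xs ! Suc i \<in> nbrs (xs ! i))"

lemma path_Cons:
  assumes "path (x # xs)" "w \<in> nbrs x" "w \<notin> set (x # xs)"
  shows "path (w # x # xs)"
  unfolding path_def
proof (intro conjI allI impI)
  show "distinct (w # x # xs)" "set (w # x # xs) \<subseteq> \<Union>K"
    using assms nbrs_vertex by (simp_all add: path_def)
  fix i assume "Suc i < length (w # x # xs)"
  then show "(w # x # xs) ! Suc i \<in> nbrs ((w # x # xs) ! i)"
    using assms nbrs_sym by (cases i) (auto simp: path_def)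
qed

text \<open>A longest path in a 2-regular graph closes up to a cycle: a neighbour of its starting point
  outside the path would extend it, and one strictly inside would have degree three.\<close>

lemma two_regular_imp_cycle:
  assumes deg: "\<And>v. {v} \<in> K \<Longrightarrow> card (nbrs v) = 2" and dim: "\<And>\<sigma>. \<sigma> \<in> K \<Longrightarrow> card \<sigma> \<le> 2"
  shows "\<exists>n\<ge>3. simplicially_isomorphic K (cycle_complex n)"
proof -
  obtain \<sigma>0 \<tau>0 where "(\<sigma>0, \<tau>0) \<in> P" using pairs_nonempty by auto
  then have "\<sigma>0 \<in> K" by (simp add: pair_iff)
  then obtain v0 where v0: "v0 \<in> \<Union>K" using simplex_nonempty[of \<sigma>0] by blast
  then have path0: "path [v0]" by (simp add: path_def)
  have bound: "\<forall>ys. path ys \<longrightarrow> length ys < Suc (card (\<Union>K))"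
    using finite_vertices by (metis path_def card_mono distinct_card less_Suc_eq_le)
  obtain xs where xs: "path xs" and longest: "\<And>ys. path ys \<Longrightarrow> length ys \<le> length xs"
    using ex_has_greatest_nat[of path, OF path0 bound] by metis
  define n where "n = length xs"
  have "n \<noteq> 0" using longest[OF path0] by (auto simp: n_def)
  then obtain x ys where xys: "xs = x # ys" by (cases xs) (auto simp: n_def)
  have dist: "distinct xs" and sub: "set xs \<subseteq> \<Union>K"
    and step: "\<And>i. Suc i < n \<Longrightarrow> xs ! Suc i \<in> nbrs (xs ! i)"
    using xs by (auto simp: path_def n_def)
  have vertex: "{xs ! i} \<in> K" if "i < n" for i
  proof -
    have "xs ! i \<in> \<Union>K" using sub that nth_mem[of i xs] unfolding n_def by blast
    then show ?thesis by (simp only: vertex_iff)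
  qed
  have eq_iff: "xs ! i = xs ! j \<longleftrightarrow> i = j" if "i < n" "j < n" for i j
    using nth_eq_iff_index_eq[OF dist] that by (simp add: n_def)
  have nbrs0: "\<exists>j<n. j \<noteq> 0 \<and> w = xs ! j" if w: "w \<in> nbrs (xs ! 0)" for w
  proof -
    have "w \<in> set xs"
    proof (rule ccontr)
      assume "w \<notin> set xs"
      then have "path (w # xs)" using path_Cons xs w by (simp add: xys)
      then show False using longest[of "w # xs"] by simp
    qed
    then obtain j where "j < n" "w = xs ! j" by (metis in_set_conv_nth n_def)
    moreover have "w \<noteq> xs ! 0" using w by (auto simp: nbrs_def)
    ultimately show ?thesis by (metis)
  qed
  have c0: "card (nbrs (xs ! 0)) = 2" using deg vertex \<open>n \<noteq> 0\<close> by simp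
  then obtain w1 w2 where w: "nbrs (xs ! 0) = {w1, w2}" "w1 \<noteq> w2" by (meson card_2_iff)
  obtain j1 j2 where j: "j1 < n" "j1 \<noteq> 0" "w1 = xs ! j1" "j2 < n" "j2 \<noteq> 0" "w2 = xs ! j2"
    using nbrs0[of w1] nbrs0[of w2] w by auto
  then have "j1 \<noteq> j2" using w by auto
  \<comment> \<open>The farther neighbour of the starting point. The nearer one also has positive
    index, whence \<open>2 \<le> j\<close> and the bound on the length of the cycle.\<close>
  define j where "j = max j1 j2"
  have jn: "j < n" "2 \<le> j" "xs ! j \<in> nbrs (xs ! 0)"
    using j \<open>j1 \<noteq> j2\<close> w unfolding j_def by (auto simp: max_def)
  then have n3: "3 \<le> n" by simp
  have three: "\<not> (a \<noteq> b \<and> b \<noteq> c \<and> a \<noteq> c)" if "{v} \<in> K" "a \<in> nbrs v" "b \<in> nbrs v" "c \<in> nbrs v" for v a b c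
  proof
    assume "a \<noteq> b \<and> b \<noteq> c \<and> a \<noteq> c"
    then have "card {a, b, c} = 3" by simp
    moreover have "card {a, b, c} \<le> card (nbrs v)" using that finite_nbrs by (intro card_mono) auto
    ultimately show False using deg[OF that(1)] by simp
  qed
  have last: "j = n - 1"
  proof (rule ccontr)
    assume "j \<noteq> n - 1"
    then have s: "Suc j < n" "Suc (j - 1) < n" "Suc (j - 1) = j" using jn by auto
    have "xs ! 0 \<in> nbrs (xs ! j)" "xs ! Suc j \<in> nbrs (xs ! j)" "xs ! (j - 1) \<in> nbrs (xs ! j)"
      using jn(3) step[OF s(1)] step[OF s(2)] s(3) nbrs_sym by simp_all
    moreover have "xs ! 0 \<noteq> xs ! Suc j" "xs ! Suc j \<noteq> xs ! (j - 1)" "xs ! 0 \<noteq> xs ! (j - 1)"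
      using eq_iff s jn by auto
    ultimately show False using three[OF vertex[OF jn(1)]] by blast
  qed
  have succ: "xs ! (Suc i mod n) \<in> nbrs (xs ! i)" if "i < n" for i
  proof (cases "Suc i < n")
    case False
    then have "i = j" using that last by simp
    then show ?thesis using jn(3) nbrs_sym last n3 by simp
  qed (use step in simp)
  have prev: "\<exists>k<n. Suc k mod n = i" if "i < n" for i
  proof (cases i)
    case 0
    then show ?thesis using n3 by (intro exI[of _ "n - 1"]) simp
  next
    case (Suc k)
    then show ?thesis using that by (intro exI[of _ k]) simp
  qed
  have nbr: "w = xs ! (Suc i mod n) \<or> (\<exists>k<n. Suc k mod n = i \<and> w = xs ! k)"
    if i: "i < n" and w: "w \<in> nbrs (xs ! i)" for i w
  proof -
    obtain k where k: "k < n" "Suc k mod n = i" using prev[OF i] by blast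
    have "xs ! k \<in> nbrs (xs ! i)" using succ[OF k(1)] k(2) nbrs_sym by simp
    \<comment> \<open>Successor and predecessor could coincide only if two steps led back to the
      start, which \<open>3 \<le> n\<close> excludes.\<close>
    moreover have "Suc i mod n \<noteq> k"
    proof
      assume "Suc i mod n = k"
      then have "Suc (Suc k mod n) mod n = k" using k by simp
      then show False using k(1) n3 by (simp add: mod_Suc split: if_splits)
    qed
    then have "xs ! (Suc i mod n) \<noteq> xs ! k" using eq_iff k(1) n3 by simp
    ultimately show ?thesis using three[OF vertex[OF i] w succ[OF i], of "xs ! k"] k by blast
  qed
  have V: "\<Union>K \<subseteq> set xs"
  proof (rule vertices_closed)
    show "xs ! 0 \<in> set xs" using \<open>n \<noteq> 0\<close> by (simp add: n_def)
    then show "xs ! 0 \<in> \<Union>K" using sub by blast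
    fix u w assume "u \<in> set xs" and w: "w \<in> nbrs u"
    then obtain i where "i < n" "u = xs ! i" by (metis in_set_conv_nth n_def)
    then obtain k where "k < n" "w = xs ! k" using nbr[of i w] w n3 by (metis mod_less_divisor not_gr0 not_less_zero)
    then show "w \<in> set xs" by (simp add: n_def)
  qed
  have KC: "K = image ((!) xs) ` cycle_complex n"
  proof (intro equalityI subsetI)
    fix \<sigma> assume \<sigma>: "\<sigma> \<in> K"
    then obtain u where u: "u \<in> \<sigma>" using simplex_nonempty by blast
    then obtain i where i: "i < n" "u = xs ! i" using V \<sigma> by (metis UnionI in_set_conv_nth n_def subsetD)
    show "\<sigma> \<in> image ((!) xs) ` cycle_complex n"
    proof (cases "\<sigma> = {u}")
      case True
      then show ?thesis using i by (auto simp: cycle_complex_def intro!: image_eqI[of _ _ "{i}"])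
    next
      case False
      then obtain w where w: "w \<in> \<sigma>" "w \<noteq> u" using u by blast
      then have "card {u, w} = 2" by simp
      then have "\<sigma> = {u, w}"
        using card_seteq[of \<sigma> "{u, w}"] simplex_finite[OF \<sigma>] dim[OF \<sigma>] u w by simp
      then have "w \<in> nbrs (xs ! i)" using w \<sigma> i by (simp add: nbrs_def)
      from nbr[OF i(1) this] show ?thesis
      proof
        assume "w = xs ! (Suc i mod n)"
        then have "\<sigma> = (!) xs ` {i, (i + 1) mod n}" using \<open>\<sigma> = {u, w}\<close> i by simp
        moreover have "{i, (i + 1) mod n} \<in> cycle_complex n" using i by (auto simp: cycle_complex_def)
        ultimately show ?thesis by blast
      next
        assume "\<exists>k<n. Suc k mod n = i \<and> w = xs ! k"
        then obtain k where k: "k < n" "Suc k mod n = i" "w = xs ! k" by blast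
        then have "\<sigma> = (!) xs ` {k, (k + 1) mod n}" using \<open>\<sigma> = {u, w}\<close> i by auto
        moreover have "{k, (k + 1) mod n} \<in> cycle_complex n" using k by (auto simp: cycle_complex_def)
        ultimately show ?thesis by blast
      qed
    qed
  next
    fix \<sigma> assume "\<sigma> \<in> image ((!) xs) ` cycle_complex n"
    then obtain \<tau> where \<tau>: "\<tau> \<in> cycle_complex n" "\<sigma> = (!) xs ` \<tau>" by blast
    then consider i where "i < n" "\<tau> = {i}" | i where "i < n" "\<tau> = {i, (i + 1) mod n}"
      unfolding cycle_complex_def by blast
    then show "\<sigma> \<in> K"
      using vertex succ \<tau>(2) by cases (simp_all add: nbrs_def)
  qed
  have "\<Union>(cycle_complex n) \<subseteq> {..<n}" using n3 by (auto simp: cycle_complex_def)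
  then have "inj_on ((!) xs) (\<Union>(cycle_complex n))"
    using eq_iff by (intro inj_onI) blast
  then show ?thesis using simplicially_isomorphic_image[OF _ KC] n3 by blast
qed

text \<open>The value two of \<open>top_card\<close> means a 2-regular graph, so the boundary of a
  triangle appears here as \<open>cycle_complex 3\<close>.\<close>

theorem reversing_classification:
  assumes "f \<in> Bij K" "cover_reversing K f"
  shows "(\<exists>n\<ge>1. simplicially_isomorphic K (boundary_simplex n)) \<or>
    (\<exists>n\<ge>3. simplicially_isomorphic K (cycle_complex n))"
proof (cases "3 \<le> top_card f")
  case True
  have "1 \<le> top_card f" using True by simp
  then show ?thesis using reversing_high_dim[OF assms True] by blast
next
  case False
  then have D: "top_card f = 2" using top_card_ge_2[OF assms] by simp
  show ?thesis
    using two_regular_imp_cycle card_nbrs[OF assms] card_le_top[OF assms] D by simp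
qed

end

section \<open>The group of symmetries in the three cases\<close>

context connected_complex_with_edge
begin

lemma Aut_morse_iso_cover_group: "Aut (morse_complex K) \<cong> cover_group K"
proof -
  interpret M: finite_complex "morse_complex K" by (rule finite_complex_morse)
  have "(\<lambda>g. restrict (image g) (morse_complex K)) \<circ> pair_map K
      \<in> iso (cover_group K) (Aut (morse_complex K))"
    using iso_set_trans[OF cover_group_iso_morse M.vertex_aut_iso_Aut] .
  then show ?thesis
    by (rule iso_symI) (simp add: cover_group_compose)
qed

lemma not_preserving_and_reversing:
  "cover_preserving K f \<Longrightarrow> \<not> cover_reversing K f"
proof
  assume f: "cover_preserving K f" "cover_reversing K f"
  obtain \<sigma> \<tau> where "(\<sigma>, \<tau>) \<in> P" using pairs_nonempty by auto
  then have "(f \<sigma>, f \<tau>) \<in> P" "(f \<tau>, f \<sigma>) \<in> P"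
    using f unfolding cover_preserving_def cover_reversing_def by blast+
  then show False by (simp add: pair_iff)
qed

section \<open>Boundaries of simplices and the complement map\<close>

context
  fixes W
  assumes W: "finite W" and boundary: "K = {\<sigma>. \<sigma> \<noteq> {} \<and> \<sigma> \<subset> W}"
begin

definition complement :: "'a set \<Rightarrow> 'a set" where
  "complement = restrict (\<lambda>\<sigma>. W - \<sigma>) K"

lemma complement_simplex: "\<sigma> \<in> K \<Longrightarrow> W - \<sigma> \<in> K" "\<sigma> \<in> K \<Longrightarrow> W - (W - \<sigma>) = \<sigma>"
  unfolding boundary by blast+

lemma complement_Bij: "complement \<in> Bij K"
proof -
  have "bij_betw (\<lambda>\<sigma>. W - \<sigma>) K K"
    by (rule bij_betw_byWitness[where f' = "\<lambda>\<sigma>. W - \<sigma>"]) (use complement_simplex in auto)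
  then show ?thesis unfolding complement_def by (rule restrict_Bij)
qed

lemma complement_reversing: "cover_reversing K complement"
  unfolding cover_reversing_def
proof (intro allI impI)
  fix \<sigma> \<tau> assume "(\<sigma>, \<tau>) \<in> P"
  then have p: "\<sigma> \<in> K" "\<tau> \<in> K" "\<sigma> \<subset> \<tau>" "card \<tau> = Suc (card \<sigma>)" by (simp_all add: pair_iff)
  then have sub: "\<sigma> \<subseteq> W" "\<tau> \<subseteq> W" by (auto simp: boundary)
  then have "card (W - \<sigma>) = card W - card \<sigma>" "card (W - \<tau>) = card W - card \<tau>" "card \<tau> \<le> card W"
    using W by (simp_all add: card_Diff_subset finite_subset card_mono)
  then have "card (W - \<sigma>) = Suc (card (W - \<tau>))" using p(4) by linarith
  moreover have "W - \<tau> \<subset> W - \<sigma>" using p(3) sub by blast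
  ultimately show "(complement \<tau>, complement \<sigma>) \<in> P"
    using complement_simplex p(1,2) by (simp add: pair_iff complement_def)
qed

text \<open>The complement of a simplex is described by inclusion alone, and \<open>f\<close>
  preserves and reflects inclusion. This commutation is what makes the product with the two-element
  group direct.\<close>

lemma complement_commute:
  assumes "f \<in> carrier (Aut K)"
  shows "compose K complement f = compose K f complement"
proof (rule extensionalityI[of _ K])
  fix \<sigma> assume \<sigma>: "\<sigma> \<in> K"
  have fB: "f \<in> Bij K" using assms by (simp add: carrier_Aut)
  have pres: "cover_preserving K f" using simplicial_imp_preserving[OF assms] .
  have "W - f \<sigma> = f (W - \<sigma>)"
  proof (intro equalityI subsetI)
    have K: "f \<sigma> \<in> K" "W - f \<sigma> \<in> K" "f (W - \<sigma>) \<in> K"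
      using Bij_mem[OF fB] \<sigma> complement_simplex(1) by blast+
    fix w assume w: "w \<in> W - f \<sigma>"
    then have "{w} \<in> K" using K(2) face_closed by blast
    then obtain \<rho> where \<rho>: "\<rho> \<in> K" "f \<rho> = {w}" using Bij_obtain[OF fB] by metis
    \<comment> \<open>A nonempty intersection would be a simplex whose nonempty image lies in both
      \<open>{w}\<close> and \<open>f \<sigma>\<close>. The preimage \<rho> is handled as a whole,
      without identifying it as a vertex.\<close>
    have "\<rho> \<inter> \<sigma> = {}"
    proof (rule ccontr)
      assume "\<rho> \<inter> \<sigma> \<noteq> {}"
      moreover have "\<rho> \<inter> \<sigma> \<in> K" using face_closed[OF \<rho>(1), of "\<rho> \<inter> \<sigma>"] calculation by simp
      ultimately have "f (\<rho> \<inter> \<sigma>) \<subseteq> {w}" "f (\<rho> \<inter> \<sigma>) \<subseteq> f \<sigma>" "f (\<rho> \<inter> \<sigma>) \<noteq> {}"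
        using preserving_mono[OF pres, of "\<rho> \<inter> \<sigma>"] \<rho> \<sigma> simplex_nonempty[OF Bij_mem[OF fB]] by auto
      then show False using w by auto
    qed
    then have "\<rho> \<subseteq> W - \<sigma>" using \<rho>(1) by (auto simp: boundary)
    then show "w \<in> f (W - \<sigma>)"
      using preserving_mono[OF pres \<rho>(1) complement_simplex(1)[OF \<sigma>]] \<rho>(2) by simp
  next
    have K: "f (W - \<sigma>) \<in> K" using Bij_mem[OF fB] \<sigma> complement_simplex(1) by blast
    fix w assume w: "w \<in> f (W - \<sigma>)"
    then have wK: "{w} \<in> K" using K face_closed by blast
    obtain \<rho> where \<rho>: "\<rho> \<in> K" "f \<rho> = {w}" using Bij_obtain[OF fB wK] by metis
    have "\<rho> \<subseteq> W - \<sigma>"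
      using preserving_subset_iff[OF fB pres \<rho>(1) complement_simplex(1)[OF \<sigma>]] \<rho>(2) w by simp
    then have "\<not> \<rho> \<subseteq> \<sigma>" using simplex_nonempty[OF \<rho>(1)] by blast
    then have "w \<notin> f \<sigma>" using preserving_subset_iff[OF fB pres \<rho>(1) \<sigma>] \<rho>(2) by simp
    moreover have "w \<in> W" using w K by (auto simp: boundary)
    ultimately show "w \<in> W - f \<sigma>" by simp
  qed
  then show "compose K complement f \<sigma> = compose K f complement \<sigma>"
    using \<sigma> Bij_mem[OF fB \<sigma>] by (simp add: compose_def complement_def)
qed (simp_all add: compose_def)

lemma compose_complement_twice:
  assumes "f \<in> Bij K"
  shows "compose K (compose K f complement) complement = f"
proof (rule extensionalityI[of _ K])
  fix \<sigma> assume "\<sigma> \<in> K"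
  then show "compose K (compose K f complement) complement \<sigma> = f \<sigma>"
    using complement_simplex by (simp add: compose_def complement_def)
qed (use assms in \<open>simp_all add: Bij_imp_extensional compose_def\<close>)

text \<open>Composition with \<open>complement\<close> exchanges preserving and reversing symmetries
  and is an involution, so each reversing one is a unique simplicial automorphism composed with
  \<open>complement\<close>.\<close>

lemma boundary_cover_group: "cover_group K \<cong> Aut K \<times>\<times> integer_mod_group 2"
proof (rule iso_symI)
  let ?h = "\<lambda>(f, k :: int). if k = 0 then f else compose K f complement"
  let ?G = "Aut K \<times>\<times> integer_mod_group 2"
  have Z: "carrier (integer_mod_group 2) = {0, 1}"
    by (auto simp: carrier_integer_mod_group)
  have AutD: "f \<in> Bij K" "cover_preserving K f" if "f \<in> carrier (Aut K)" for f
    using that simplicial_imp_preserving by (auto simp: carrier_Aut)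
  have into0: "f \<in> carrier (cover_group K)" if "f \<in> carrier (Aut K)" for f
    using AutD[OF that] by (simp add: carrier_cover_group)
  have cc: "complement \<in> carrier (cover_group K)"
    using complement_Bij complement_reversing by (simp add: carrier_cover_group)
  have into1: "compose K f complement \<in> carrier (cover_group K)" if "f \<in> carrier (Aut K)" for f
    using cover_group_compose(2)[OF into0[OF that] cc] .
  have rev1: "cover_reversing K (compose K f complement)" if "f \<in> carrier (Aut K)" for f
    using compose_preserving_reversing(2)[OF AutD(1)[OF that] complement_Bij AutD(2)[OF that]
        complement_reversing] .
  have swap: "compose K (compose K f complement) g = compose K (compose K f g) complement"
    if "f \<in> carrier (Aut K)" "g \<in> carrier (Aut K)" for f g
  proof -
    have g: "g \<in> K \<rightarrow> K" using AutD(1)[OF that(2)] by (rule Bij_imp_funcset)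
    have c: "complement \<in> K \<rightarrow> K" using complement_Bij by (rule Bij_imp_funcset)
    show ?thesis
      using compose_assoc[OF g, of f complement] compose_assoc[OF c, of f g]
        complement_commute[OF that(2)] by simp
  qed
  have assoc: "compose K f (compose K g complement) = compose K (compose K f g) complement" for f g
    using compose_assoc[OF Bij_imp_funcset[OF complement_Bij]] by metis
  show "?h \<in> iso ?G (cover_group K)"
  proof (rule isoI)
    show "?h \<in> hom ?G (cover_group K)"
    proof (rule homI)
      fix x assume "x \<in> carrier ?G"
      then show "?h x \<in> carrier (cover_group K)" using into0 into1 by (auto split: if_splits)
    next
      fix x y assume "x \<in> carrier ?G" "y \<in> carrier ?G"
      then obtain f k g l where xy: "x = (f, k)" "y = (g, l)" and f: "f \<in> carrier (Aut K)"
        and g: "g \<in> carrier (Aut K)" and kl: "k \<in> {0, 1}" "l \<in> {0, 1}"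
        unfolding Z[symmetric] by (cases x; cases y) auto
      have m: "x \<otimes>\<^bsub>?G\<^esub> y = (compose K f g, (k + l) mod 2)"
        using Aut_compose(1)[OF f g] by (simp add: xy)
      have cm: "?h x \<otimes>\<^bsub>cover_group K\<^esub> ?h y = compose K (?h x) (?h y)"
        using into0[OF f] into1[OF f] into0[OF g] into1[OF g]
        by (intro cover_group_compose(1)) (auto simp: xy)
      have twice: "compose K (compose K (compose K f g) complement) complement = compose K f g"
        by (rule compose_complement_twice) (rule compose_Bij[OF AutD(1)[OF f] AutD(1)[OF g]])
      show "?h (x \<otimes>\<^bsub>?G\<^esub> y) = ?h x \<otimes>\<^bsub>cover_group K\<^esub> ?h y"
        using kl unfolding m cm by (elim insertE emptyE) (simp_all add: xy swap[OF f g] assoc twice)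
    qed
    show "bij_betw ?h (carrier ?G) (carrier (cover_group K))"
      unfolding bij_betw_def
    proof (intro conjI equalityI subsetI)
      show "inj_on ?h (carrier ?G)"
      proof (rule inj_onI)
        fix x y assume "x \<in> carrier ?G" "y \<in> carrier ?G" and eq: "?h x = ?h y"
        then obtain f k g l where xy: "x = (f, k)" "y = (g, l)" and f: "f \<in> carrier (Aut K)"
          and g: "g \<in> carrier (Aut K)" and kl: "k \<in> {0, 1}" "l \<in> {0, 1}"
          unfolding Z[symmetric] by (cases x; cases y) auto
        have "f \<noteq> compose K g complement" "g \<noteq> compose K f complement"
          using not_preserving_and_reversing AutD(2) rev1 f g by metis+
        moreover have "f = g" if "compose K f complement = compose K g complement"
          using that compose_complement_twice AutD(1) f g by metis
        ultimately show "x = y" using kl eq by (auto simp: xy split: if_splits)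
      qed
    next
      fix f assume "f \<in> ?h ` carrier ?G"
      then show "f \<in> carrier (cover_group K)" using into0 into1 by (auto split: if_splits)
    next
      fix f assume f: "f \<in> carrier (cover_group K)"
      then have fB: "f \<in> Bij K" by (simp add: carrier_cover_group)
      consider "cover_preserving K f" | "cover_reversing K f" using f by (auto simp: carrier_cover_group)
      then show "f \<in> ?h ` carrier ?G"
      proof cases
        case 1
        then have "(f, 0) \<in> carrier ?G" using preserving_imp_simplicial[OF fB] Z by simp
        then show ?thesis by (rule rev_image_eqI) simp
      next
        case 2
        have "compose K f complement \<in> carrier (Aut K)"
          using preserving_imp_simplicial[OF compose_Bij[OF fB complement_Bij]]
            compose_preserving_reversing(4)[OF fB complement_Bij 2 complement_reversing] by blast
        then have "(compose K f complement, 1) \<in> carrier ?G" using Z by simp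
        then show ?thesis
          by (rule rev_image_eqI) (simp add: compose_complement_twice[OF fB])
      qed
    qed
  qed
  fix x y assume "x \<in> carrier ?G" "y \<in> carrier ?G"
  then show "x \<otimes>\<^bsub>?G\<^esub> y \<in> carrier ?G"
    using Aut_compose by (auto simp: Z carrier_integer_mod_group)
qed

end

end

section \<open>Cycles and the numbering of their Hasse diagram\<close>

lemma conjugation_iso:
  assumes \<phi>: "bij_betw \<phi> A S" and C: "C \<subseteq> Bij S" and C': "C' \<subseteq> Bij A"
    and iff: "\<And>f. f \<in> Bij S \<Longrightarrow> (\<lambda>a\<in>A. inv_into A \<phi> (f (\<phi> a))) \<in> C' \<longleftrightarrow> f \<in> C"
  shows "(\<lambda>f. \<lambda>a\<in>A. inv_into A \<phi> (f (\<phi> a))) \<in>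
    iso (BijGroup S\<lparr>carrier := C\<rparr>) (BijGroup A\<lparr>carrier := C'\<rparr>)"
proof (rule isoI)
  let ?c = "\<lambda>f. \<lambda>a\<in>A. inv_into A \<phi> (f (\<phi> a))"
  let ?i = "inv_into A \<phi>"
  have \<phi>A: "\<phi> a \<in> S" if "a \<in> A" for a using \<phi> that by (rule bij_betw_apply)
  have iS: "?i s \<in> A" if "s \<in> S" for s using bij_betw_inv_into[OF \<phi>] that by (rule bij_betw_apply)
  note \<phi>i = bij_betw_inv_into_right[OF \<phi>] and i\<phi> = bij_betw_inv_into_left[OF \<phi>]
  have B: "f \<in> Bij S" if "f \<in> C" for f using C that by blast
  have into: "?c f \<in> C'" if "f \<in> C" for f using iff[OF B[OF that]] that by simp
  show "?c \<in> hom (BijGroup S\<lparr>carrier := C\<rparr>) (BijGroup A\<lparr>carrier := C'\<rparr>)"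
  proof (rule homI)
    fix f g assume "f \<in> carrier (BijGroup S\<lparr>carrier := C\<rparr>)" "g \<in> carrier (BijGroup S\<lparr>carrier := C\<rparr>)"
    then have fg: "f \<in> C" "g \<in> C" by simp_all
    have "?c (compose S f g) = compose A (?c f) (?c g)"
    proof (rule extensionalityI[of _ A])
      fix a assume "a \<in> A"
      then have "\<phi> a \<in> S" "g (\<phi> a) \<in> S" using \<phi>A Bij_mem[OF B[OF fg(2)]] by simp_all
      then show "?c (compose S f g) a = compose A (?c f) (?c g) a"
        using \<open>a \<in> A\<close> iS \<phi>i by (simp add: compose_def)
    qed (simp_all add: compose_def)
    moreover have "f \<otimes>\<^bsub>BijGroup S\<lparr>carrier := C\<rparr>\<^esub> g = compose S f g"
      by (rule mult_BijGroup[OF B[OF fg(1)] B[OF fg(2)]])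
    moreover have "?c f \<otimes>\<^bsub>BijGroup A\<lparr>carrier := C'\<rparr>\<^esub> ?c g = compose A (?c f) (?c g)"
      by (rule mult_BijGroup[OF subsetD[OF C' into[OF fg(1)]] subsetD[OF C' into[OF fg(2)]]])
    ultimately show "?c (f \<otimes>\<^bsub>BijGroup S\<lparr>carrier := C\<rparr>\<^esub> g) = ?c f \<otimes>\<^bsub>BijGroup A\<lparr>carrier := C'\<rparr>\<^esub> ?c g"
      by (simp only:)
  qed (use into in simp)
  have "bij_betw ?c C C'"
    unfolding bij_betw_def
  proof (intro conjI equalityI subsetI inj_onI)
    fix f g assume fg: "f \<in> C" "g \<in> C" "?c f = ?c g"
    show "f = g"
    proof (rule Bij_ext[OF B[OF fg(1)] B[OF fg(2)]])
      fix s assume s: "s \<in> S"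
      have "?i (f s) = ?i (g s)"
        using fun_cong[OF fg(3), of "?i s"] iS[OF s] \<phi>i[OF s] by simp
      then show "f s = g s"
        using \<phi>i[OF Bij_mem[OF B[OF fg(1)] s]] \<phi>i[OF Bij_mem[OF B[OF fg(2)] s]] by metis
    qed
  next
    fix g assume g: "g \<in> C'"
    then have gB: "g \<in> Bij A" using C' by blast
    define f where "f = (\<lambda>s\<in>S. \<phi> (g (?i s)))"
    have "bij_betw (\<phi> \<circ> (g \<circ> ?i)) S S"
      by (rule bij_betw_trans[OF bij_betw_trans[OF bij_betw_inv_into[OF \<phi>] Bij_bij[OF gB]] \<phi>])
    then have fB: "f \<in> Bij S" unfolding f_def comp_def by (rule restrict_Bij)
    have cf: "?c f = g"
    proof (rule extensionalityI[of _ A])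
      fix a assume "a \<in> A"
      then show "?c f a = g a" using \<phi>A i\<phi> Bij_mem[OF gB] by (simp add: f_def)
    qed (use Bij_imp_extensional[OF gB] in simp_all)
    then have "f \<in> C" using iff[OF fB] g by simp
    then show "g \<in> ?c ` C" using cf by blast
  qed (use into in blast)
  then show "bij_betw ?c (carrier (BijGroup S\<lparr>carrier := C\<rparr>)) (carrier (BijGroup A\<lparr>carrier := C'\<rparr>))"
    by simp
qed

lemma cycle_complex_edge_iff:
  assumes "k \<noteq> l"
  shows "{k, l} \<in> cycle_complex N \<longleftrightarrow> k < N \<and> l < N \<and> (l = Suc k mod N \<or> k = Suc l mod N)"
proof
  assume "{k, l} \<in> cycle_complex N"
  then obtain i where i: "i < N" "{k, l} = {i} \<or> {k, l} = {i, (i + 1) mod N}"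
    unfolding cycle_complex_def by blast
  then have "{k, l} = {i, Suc i mod N}" using assms by auto
  moreover have "Suc i mod N < N" using i by simp
  ultimately show "k < N \<and> l < N \<and> (l = Suc k mod N \<or> k = Suc l mod N)"
    using i by (auto simp: doubleton_eq_iff)
next
  assume "k < N \<and> l < N \<and> (l = Suc k mod N \<or> k = Suc l mod N)"
  then have "\<exists>i<N. {k, l} = {i, (i + 1) mod N}"
    by (metis Suc_eq_plus1 insert_commute)
  then show "{k, l} \<in> cycle_complex N"
    unfolding cycle_complex_def by blast
qed

lemma cycle_complex_singleton: "k < N \<Longrightarrow> {k} \<in> cycle_complex N"
  by (auto simp: cycle_complex_def)

lemma Union_cycle_complex: "\<Union>(cycle_complex N) = {..<N}"
proof
  show "\<Union>(cycle_complex N) \<subseteq> {..<N}"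
    unfolding cycle_complex_def by (auto intro: mod_less_divisor)
  show "{..<N} \<subseteq> \<Union>(cycle_complex N)" using cycle_complex_singleton by fastforce
qed

lemma cycle_complex_cases:
  assumes "\<sigma> \<in> cycle_complex N"
  obtains k where "k < N" "\<sigma> = {k}" | k where "k < N" "\<sigma> = {k, Suc k mod N}"
  using assms unfolding cycle_complex_def by auto

lemma finite_complex_cycle: "finite_complex (cycle_complex N)"
proof
  show "finite (cycle_complex N)"
    by (rule finite_subset[of _ "Pow {..<N}"]) (use Union_cycle_complex[of N] in auto)
  show "abstract_complex (cycle_complex N)"
    unfolding abstract_complex_def
  proof (intro conjI ballI allI impI)
    fix \<sigma> assume \<sigma>: "\<sigma> \<in> cycle_complex N"
    then show "finite \<sigma>" "\<sigma> \<noteq> {}" by (auto elim: cycle_complex_cases)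
    fix \<tau> assume \<tau>: "\<tau> \<subseteq> \<sigma> \<and> \<tau> \<noteq> {}"
    show "\<tau> \<in> cycle_complex N"
    proof (cases "\<tau> = \<sigma>")
      case False
      obtain k l where "\<sigma> = {k, l}" using \<sigma> by (metis cycle_complex_cases insert_absorb2)
      then obtain a where "\<tau> = {a}" using \<tau> False by blast
      moreover have "a < N" using \<sigma> \<tau> calculation Union_cycle_complex[of N] by blast
      ultimately show ?thesis using cycle_complex_singleton by simp
    qed (use \<sigma> in simp)
  qed
qed

text \<open>Only the sizes 1 and 2 occur, so whether \<open>f\<close> keeps the size of a simplex
  passes to adjacent nodes, and connectedness makes the answer uniform. Direction is thus recovered
  from mere adjacency, which is all that a symmetry of a cycle provides.\<close>

lemma (in finite_complex) graph_cover_groupI: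
  assumes dim: "\<And>\<sigma>. \<sigma> \<in> K \<Longrightarrow> card \<sigma> \<le> 2" and fB: "f \<in> Bij K"
    and con: "connected_complex_with_edge K"
    and adj: "\<And>\<sigma> \<tau>. (\<sigma>, \<tau>) \<in> P \<Longrightarrow> (f \<sigma>, f \<tau>) \<in> P \<or> (f \<tau>, f \<sigma>) \<in> P"
  shows "f \<in> carrier (cover_group K)"
proof -
  interpret connected_complex_with_edge K by (rule con)
  define c where "c \<nu> \<longleftrightarrow> card (f \<nu>) = card \<nu>" for \<nu>
  have card12: "card \<nu> = 1 \<or> card \<nu> = 2" if "\<nu> \<in> K" for \<nu>
    using dim[OF that] card_pos[OF that] by linarith
  have "c \<sigma> = c \<tau>" if "(\<sigma>, \<tau>) \<in> P" for \<sigma> \<tau>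
  proof -
    have "\<sigma> \<in> K" "\<tau> \<in> K" "card \<tau> = Suc (card \<sigma>)" using that by (simp_all add: pair_iff)
    moreover have "card (f \<tau>) = Suc (card (f \<sigma>)) \<or> card (f \<sigma>) = Suc (card (f \<tau>))"
      using adj[OF that] by (auto simp: pair_iff)
    ultimately show ?thesis
      using card12[of \<sigma>] card12[of \<tau>] card12[OF Bij_mem[OF fB], of \<sigma>] card12[OF Bij_mem[OF fB], of \<tau>]
      unfolding c_def by linarith
  qed
  then have const: "c \<sigma> = c \<tau>" if "\<sigma> \<in> K" "\<tau> \<in> K" for \<sigma> \<tau>
    using constant_if_constant_on_pairs[of c, OF _ that] by blast
  have pres: "(f \<sigma>, f \<tau>) \<in> P" if "(\<sigma>, \<tau>) \<in> P" "c \<sigma>" "c \<tau>" for \<sigma> \<tau>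
    using adj[OF that(1)] that by (auto simp: pair_iff c_def)
  have rev: "(f \<tau>, f \<sigma>) \<in> P" if "(\<sigma>, \<tau>) \<in> P" "\<not> c \<sigma>" "\<not> c \<tau>" for \<sigma> \<tau>
  proof (rule ccontr)
    assume "(f \<tau>, f \<sigma>) \<notin> P"
    then have "(f \<sigma>, f \<tau>) \<in> P" using adj[OF that(1)] by blast
    then have "card (f \<tau>) = Suc (card (f \<sigma>))" "f \<sigma> \<in> K" "f \<tau> \<in> K" by (simp_all add: pair_iff)
    moreover have "card \<tau> = Suc (card \<sigma>)" "\<sigma> \<in> K" "\<tau> \<in> K" using that(1) by (simp_all add: pair_iff)
    ultimately show False
      using that(2) card12[of \<sigma>] card12[of \<tau>] card12[of "f \<sigma>"] card12[of "f \<tau>"]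
      unfolding c_def by linarith
  qed
  obtain \<nu> where \<nu>: "\<nu> \<in> K" using pairs_nonempty by (auto simp: primitive_pairs_def)
  have "cover_preserving K f \<or> cover_reversing K f"
  proof (cases "c \<nu>")
    case True
    then have "cover_preserving K f"
      unfolding cover_preserving_def using pres const[OF \<nu>] by (metis pair_iff)
    then show ?thesis ..
  next
    case False
    then have "cover_reversing K f"
      unfolding cover_reversing_def using rev const[OF \<nu>] by (metis pair_iff)
    then show ?thesis ..
  qed
  then show ?thesis using fB by (simp add: carrier_cover_group)
qed

context connected_complex_with_edge
begin

context
  fixes n :: nat and u :: "nat \<Rightarrow> 'a"
  assumes n: "3 \<le> n" and inj: "inj_on u {..<n}" and cycle: "K = image u ` cycle_complex n"
begin

text \<open>Numbering of the Hasse diagram of the cycle along its \<open>2 * n\<close> nodes, vertices and edges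
  alternating.\<close>

definition hasse_node :: "nat \<Rightarrow> 'a set" where
  "hasse_node k = (if even k then {u (k div 2)} else {u (k div 2), u (Suc (k div 2) mod n)})"

lemma u_eq_iff: "i < n \<Longrightarrow> j < n \<Longrightarrow> u i = u j \<longleftrightarrow> i = j"
  using inj by (simp add: inj_on_eq_iff)

lemma Suc_mod: "i < n \<Longrightarrow> Suc i mod n < n" "i < n \<Longrightarrow> Suc i mod n \<noteq> i"
  using n by (simp_all add: mod_Suc)

lemma hasse_node_mem: "k < 2 * n \<Longrightarrow> hasse_node k \<in> K"
proof -
  assume "k < 2 * n"
  then have i: "k div 2 < n" by linarith
  have "{k div 2} \<in> cycle_complex n" "{k div 2, (k div 2 + 1) mod n} \<in> cycle_complex n"
    using i by (auto simp: cycle_complex_def)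
  then have "u ` {k div 2} \<in> K" "u ` {k div 2, (k div 2 + 1) mod n} \<in> K" unfolding cycle by blast+
  then show ?thesis by (simp add: hasse_node_def)
qed

lemma card_hasse_node: "k < 2 * n \<Longrightarrow> card (hasse_node k) = (if even k then 1 else 2)"
proof -
  assume "k < 2 * n"
  then have "k div 2 < n" by linarith
  then have "u (k div 2) \<noteq> u (Suc (k div 2) mod n)" using u_eq_iff Suc_mod[of "k div 2"] by simp
  then show ?thesis by (simp add: hasse_node_def)
qed

lemma hasse_node_bij: "bij_betw hasse_node {..<2 * n} K"
proof (rule bij_betw_imageI)
  show "inj_on hasse_node {..<2 * n}"
  proof (rule inj_onI)
    fix k l assume kl: "k \<in> {..<2 * n}" "l \<in> {..<2 * n}" and eq: "hasse_node k = hasse_node l"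
    then have i: "k div 2 < n" "l div 2 < n" by auto
    have "(if even k then 1 else 2 :: nat) = (if even l then 1 else 2)"
      using card_hasse_node kl eq by (metis lessThan_iff)
    then have par: "even k \<longleftrightarrow> even l" by (simp split: if_splits)
    have "k div 2 = l div 2"
    proof (cases "even k")
      case True
      then show ?thesis using eq par u_eq_iff[OF i] by (simp add: hasse_node_def)
    next
      case False
      then have "{u (k div 2), u (Suc (k div 2) mod n)} = {u (l div 2), u (Suc (l div 2) mod n)}"
        using eq par by (simp add: hasse_node_def)
      then have "k div 2 = l div 2 \<or> k div 2 = Suc (l div 2) mod n \<and> Suc (k div 2) mod n = l div 2"
        using u_eq_iff i Suc_mod(1) by (metis doubleton_eq_iff)
      then show ?thesis using i n by (auto simp: mod_Suc split: if_splits)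
    qed
    then show "k = l" using par by (metis even_two_times_div_two odd_two_times_div_two_succ)
  qed
  show "hasse_node ` {..<2 * n} = K"
  proof (intro equalityI subsetI)
    fix \<sigma> assume "\<sigma> \<in> K"
    then obtain \<tau> where \<tau>: "\<tau> \<in> cycle_complex n" "\<sigma> = u ` \<tau>" unfolding cycle by blast
    from \<tau>(1) show "\<sigma> \<in> hasse_node ` {..<2 * n}"
    proof (cases rule: cycle_complex_cases)
      case (1 k)
      then have "\<sigma> = hasse_node (2 * k)" using \<tau>(2) by (simp add: hasse_node_def)
      then show ?thesis using 1(1) by simp
    next
      case (2 k)
      then have "\<sigma> = hasse_node (2 * k + 1)" using \<tau>(2) by (simp add: hasse_node_def)
      then show ?thesis using 2(1) by simp
    qed
  qed (use hasse_node_mem in auto)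
qed

lemma hasse_pair_iff:
  assumes "i < n" "j < n"
  shows "(hasse_node (2 * i), hasse_node (2 * j + 1)) \<in> P \<longleftrightarrow> i = j \<or> i = Suc j mod n"
proof -
  let ?j = "Suc j mod n"
  have eqs: "hasse_node (2 * i) = {u i}" "hasse_node (2 * j + 1) = {u j, u ?j}"
    by (simp_all add: hasse_node_def)
  have "hasse_node (2 * i) \<in> K" "hasse_node (2 * j + 1) \<in> K"
    using assms by (auto intro: hasse_node_mem)
  then have K: "{u i} \<in> K" "{u j, u ?j} \<in> K" by (simp_all only: eqs)
  have ne: "u j \<noteq> u ?j"
    using u_eq_iff Suc_mod[OF assms(2)] assms(2) by simp
  then have "{u i} \<noteq> {u j, u ?j}" by (metis doubleton_eq_iff insert_absorb2)
  then have "{u i} \<subset> {u j, u ?j} \<longleftrightarrow> u i = u j \<or> u i = u ?j" by (simp add: psubset_eq)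
  then have "({u i}, {u j, u ?j}) \<in> P \<longleftrightarrow> u i = u j \<or> u i = u ?j"
    using K ne by (simp add: pair_iff)
  then show ?thesis using u_eq_iff[OF assms] u_eq_iff[OF assms(1) Suc_mod(1)[OF assms(2)]]
    unfolding eqs by simp
qed

lemma hasse_adjacent_iff:
  assumes "k < 2 * n" "l < 2 * n"
  shows "(hasse_node k, hasse_node l) \<in> P \<or> (hasse_node l, hasse_node k) \<in> P \<longleftrightarrow>
    l = Suc k mod (2 * n) \<or> k = Suc l mod (2 * n)"
proof -
  have main: "(hasse_node k, hasse_node l) \<in> P \<or> (hasse_node l, hasse_node k) \<in> P \<longleftrightarrow>
    l = Suc k mod (2 * n) \<or> k = Suc l mod (2 * n)"
    if kl: "k < 2 * n" "l < 2 * n" "even k" "odd l" for k l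
  proof -
    obtain i j where ij: "k = 2 * i" "l = 2 * j + 1" using kl by (meson evenE oddE)
    then have lt: "i < n" "j < n" using kl by auto
    have "(hasse_node l, hasse_node k) \<notin> P" using card_hasse_node kl by (auto simp: pair_iff)
    moreover have "l = Suc k mod (2 * n) \<longleftrightarrow> i = j" using ij lt by auto
    \<comment> \<open>One step past the edge with index \<open>2 * j + 1\<close> comes its second
      vertex; doubling commutes with reduction, which settles the wrap-around.\<close>
    moreover have "Suc l mod (2 * n) = 2 * (Suc j mod n)" using ij by (simp add: mult_mod_right)
    then have "k = Suc l mod (2 * n) \<longleftrightarrow> i = Suc j mod n" using ij by simp
    ultimately show ?thesis using hasse_pair_iff[OF lt] unfolding ij by blast
  qed
  consider "even k" "odd l" | "odd k" "even l" | "even k \<longleftrightarrow> even l" by blast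
  then show ?thesis
  proof cases
    case 3
    \<comment> \<open>The number of nodes is even, so a step changes parity also where the numbering
      wraps round.\<close>
    have "even (Suc m mod (2 * n)) \<longleftrightarrow> odd m" for m by (simp add: dvd_mod_iff)
    then have "l \<noteq> Suc k mod (2 * n)" "k \<noteq> Suc l mod (2 * n)" using 3 by metis+
    moreover have "card (hasse_node k) = card (hasse_node l)" using card_hasse_node assms 3 by simp
    ultimately show ?thesis by (auto simp: pair_iff)
  qed (use main assms in blast)+
qed

text \<open>The numbering turns adjacency in the Hasse diagram into adjacency in the cycle of twice
  the length. Conjugation by it matches the automorphisms of that cycle with the undirected
  symmetries of the diagram, which in a graph are the members of \<open>cover_group\<close>.\<close>

lemma cycle_cover_group: "cover_group K \<cong> Aut (cycle_complex (2 * n))"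
proof -
  let ?A = "{..<2 * n}"
  let ?c = "\<lambda>f. \<lambda>a\<in>?A. inv_into ?A hasse_node (f (hasse_node a))"
  interpret C: finite_complex "cycle_complex (2 * n)" by (rule finite_complex_cycle)
  have dim: "card \<sigma> \<le> 2" if \<sigma>: "\<sigma> \<in> K" for \<sigma>
  proof -
    obtain k where "k < 2 * n" "\<sigma> = hasse_node k"
      using \<sigma> hasse_node_bij by (auto simp: bij_betw_def)
    then show ?thesis using card_hasse_node by simp
  qed
  have conj: "?c f \<in> Bij ?A \<and> (\<forall>\<sigma>\<in>cycle_complex (2 * n). ?c f ` \<sigma> \<in> cycle_complex (2 * n))
      \<longleftrightarrow> f \<in> Bij K \<and> (cover_preserving K f \<or> cover_reversing K f)" if fB: "f \<in> Bij K" for f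
  proof -
    note h = hasse_node_bij
    have cB: "?c f \<in> Bij ?A"
    proof -
      have "bij_betw (inv_into ?A hasse_node \<circ> (f \<circ> hasse_node)) ?A ?A"
        by (rule bij_betw_trans[OF bij_betw_trans[OF h Bij_bij[OF fB]] bij_betw_inv_into[OF h]])
      then show ?thesis unfolding comp_def by (rule restrict_Bij)
    qed
    have node: "hasse_node (?c f k) = f (hasse_node k)" if "k \<in> ?A" for k
      using bij_betw_inv_into_right[OF h] Bij_mem[OF fB] hasse_node_mem that by simp
    have adj: "?c f ` {k, Suc k mod (2 * n)} \<in> cycle_complex (2 * n) \<longleftrightarrow>
        (f (hasse_node k), f (hasse_node (Suc k mod (2 * n)))) \<in> P \<or>
        (f (hasse_node (Suc k mod (2 * n))), f (hasse_node k)) \<in> P" if k: "k < 2 * n" for k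
    proof -
      let ?l = "Suc k mod (2 * n)"
      have l: "?l < 2 * n" "?l \<noteq> k" using n k by (simp_all add: mod_Suc)
      then have ne: "?c f k \<noteq> ?c f ?l" using Bij_eq_iff[OF cB, of k ?l] k by simp
      have mem: "?c f k < 2 * n" "?c f ?l < 2 * n"
        using Bij_mem[OF cB, of k] Bij_mem[OF cB, of ?l] k l by simp_all
      have "?c f ` {k, ?l} = {?c f k, ?c f ?l}" by simp
      then have "?c f ` {k, ?l} \<in> cycle_complex (2 * n) \<longleftrightarrow>
          (?c f ?l = Suc (?c f k) mod (2 * n) \<or> ?c f k = Suc (?c f ?l) mod (2 * n))"
        using cycle_complex_edge_iff[OF ne] mem by metis
      also have "\<dots> \<longleftrightarrow> (hasse_node (?c f k), hasse_node (?c f ?l)) \<in> P \<or>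
          (hasse_node (?c f ?l), hasse_node (?c f k)) \<in> P"
        using hasse_adjacent_iff[OF mem] by blast
      finally show ?thesis using node[of k] node[of ?l] k l(1) by simp
    qed
    show ?thesis
    proof
      assume L: "?c f \<in> Bij ?A \<and> (\<forall>\<sigma>\<in>cycle_complex (2 * n). ?c f ` \<sigma> \<in> cycle_complex (2 * n))"
      have "f \<in> carrier (cover_group K)"
      proof (rule graph_cover_groupI[OF dim fB])
        show "connected_complex_with_edge K" ..
        fix \<sigma> \<tau> assume p: "(\<sigma>, \<tau>) \<in> P"
        then have "\<sigma> \<in> K" "\<tau> \<in> K" by (simp_all add: pair_iff)
        then obtain k l where kl: "k < 2 * n" "l < 2 * n" "\<sigma> = hasse_node k" "\<tau> = hasse_node l"
          using h by (auto simp: bij_betw_def)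
        have edge: "?c f ` {k, Suc k mod (2 * n)} \<in> cycle_complex (2 * n)" if "k < 2 * n" for k
        proof -
          have "{k, Suc k mod (2 * n)} \<in> cycle_complex (2 * n)"
            using that by (auto simp: cycle_complex_def)
          then show ?thesis using L by blast
        qed
        have "l = Suc k mod (2 * n) \<or> k = Suc l mod (2 * n)"
          using hasse_adjacent_iff[OF kl(1,2)] p kl by blast
        then show "(f \<sigma>, f \<tau>) \<in> P \<or> (f \<tau>, f \<sigma>) \<in> P"
          using adj[OF kl(1)] adj[OF kl(2)] edge[OF kl(1)] edge[OF kl(2)] kl(3,4) by metis
      qed
      then show "f \<in> Bij K \<and> (cover_preserving K f \<or> cover_reversing K f)"
        by (simp add: carrier_cover_group)
    next
      assume R: "f \<in> Bij K \<and> (cover_preserving K f \<or> cover_reversing K f)"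
      have "?c f ` \<sigma> \<in> cycle_complex (2 * n)" if "\<sigma> \<in> cycle_complex (2 * n)" for \<sigma>
        using that
      proof (cases rule: cycle_complex_cases)
        case (1 k)
        then have "?c f k < 2 * n" using Bij_mem[OF cB, of k] by simp
        then show ?thesis using cycle_complex_singleton 1(2) by (metis image_empty image_insert)
      next
        case (2 k)
        have "Suc k mod (2 * n) < 2 * n" using 2(1) by simp
        then have "(hasse_node k, hasse_node (Suc k mod (2 * n))) \<in> P \<or>
            (hasse_node (Suc k mod (2 * n)), hasse_node k) \<in> P"
          using hasse_adjacent_iff[OF 2(1)] by blast
        then show ?thesis
          unfolding 2(2) adj[OF 2(1)] using R unfolding cover_preserving_def cover_reversing_def by blast
      qed
      then show "?c f \<in> Bij ?A \<and> (\<forall>\<sigma>\<in>cycle_complex (2 * n). ?c f ` \<sigma> \<in> cycle_complex (2 * n))"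
        using cB by blast
    qed
  qed
  have "?c \<in> iso (cover_group K) (vertex_aut (cycle_complex (2 * n)))"
    unfolding cover_group_def vertex_aut_def Union_cycle_complex
    by (rule conjugation_iso[OF hasse_node_bij]) (use conj in auto)
  then show ?thesis
    using iso_set_trans[OF _ C.vertex_aut_iso_Aut] is_isoI by blast
qed

end

end

section \<open>Complexes without pairs, and the three cases together\<close>

lemma trivial_groups_iso:
  assumes "carrier G = {a}" "a \<otimes>\<^bsub>G\<^esub> a = a" "carrier H = {b}" "b \<otimes>\<^bsub>H\<^esub> b = b"
  shows "G \<cong> H"
  by (rule is_isoI, rule isoI[of "\<lambda>_. b"]) (use assms in \<open>auto simp: hom_def bij_betw_def\<close>)

lemma (in finite_complex) trivial_Aut:
  assumes "\<And>\<sigma> \<tau>. \<sigma> \<in> K \<Longrightarrow> \<tau> \<in> K \<Longrightarrow> \<sigma> = \<tau>"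
  shows "carrier (Aut K) = {\<lambda>\<sigma>\<in>K. \<sigma>}" "(\<lambda>\<sigma>\<in>K. \<sigma>) \<otimes>\<^bsub>Aut K\<^esub> (\<lambda>\<sigma>\<in>K. \<sigma>) = (\<lambda>\<sigma>\<in>K. \<sigma>)"
proof -
  have id: "(\<lambda>\<sigma>\<in>K. \<sigma>) \<in> carrier (Aut K)"
  proof (rule preserving_imp_simplicial[OF id_Bij])
    show "cover_preserving K (\<lambda>\<sigma>\<in>K. \<sigma>)" by (auto simp: cover_preserving_def pair_iff)
  qed
  moreover have "f = (\<lambda>\<sigma>\<in>K. \<sigma>)" if "f \<in> carrier (Aut K)" for f
  proof (rule Bij_ext[OF _ id_Bij])
    show fB: "f \<in> Bij K" using that by (simp add: carrier_Aut)
    show "f \<sigma> = (\<lambda>\<sigma>\<in>K. \<sigma>) \<sigma>" if "\<sigma> \<in> K" for \<sigma> using assms[OF Bij_mem[OF fB that] that] that by simp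
  qed
  ultimately show "carrier (Aut K) = {\<lambda>\<sigma>\<in>K. \<sigma>}" by blast
  show "(\<lambda>\<sigma>\<in>K. \<sigma>) \<otimes>\<^bsub>Aut K\<^esub> (\<lambda>\<sigma>\<in>K. \<sigma>) = (\<lambda>\<sigma>\<in>K. \<sigma>)"
    unfolding Aut_compose(1)[OF id id] compose_def by (rule restrict_ext) simp
qed

text \<open>Without pairs every simplex is a single vertex, and connectedness leaves at most one.
  The Morse complex is then empty, and both groups consist of the identity.\<close>

lemma (in finite_complex) no_pairs:
  assumes "connected_complex K" "P = {}"
  shows "\<sigma> \<in> K \<Longrightarrow> \<tau> \<in> K \<Longrightarrow> \<sigma> = \<tau>" "Aut (morse_complex K) \<cong> Aut K"
proof -
  have single: "\<sigma> = {v}" if "\<sigma> \<in> K" "v \<in> \<sigma>" for \<sigma> v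
    using remove_pair[OF that] assms(2) by blast
  have eq: "u = v" if "(u, v) \<in> {(x, y). {x, y} \<in> K}\<^sup>*" for u v
    using that
  proof (induction rule: rtrancl_induct)
    case (step y z)
    then have "{y, z} = {y}" using single[of "{y, z}" y] by simp
    then show ?case using step.IH by auto
  qed simp
  have all: "\<sigma> = \<tau>" if K: "\<sigma> \<in> K" "\<tau> \<in> K" for \<sigma> \<tau>
  proof -
    obtain u v where uv: "u \<in> \<sigma>" "v \<in> \<tau>" using simplex_nonempty K by blast
    then have "u = v" using eq assms(1) K unfolding connected_complex_def by blast
    then show ?thesis using single[OF K(1) uv(1)] single[OF K(2) uv(2)] by simp
  qed
  then show "\<sigma> \<in> K \<Longrightarrow> \<tau> \<in> K \<Longrightarrow> \<sigma> = \<tau>" .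
  interpret M: finite_complex "morse_complex K" by (rule finite_complex_morse)
  have "morse_complex K = {}" using assms(2) by (auto simp: morse_iff)
  then have "\<sigma> = \<tau>" if "\<sigma> \<in> morse_complex K" "\<tau> \<in> morse_complex K" for \<sigma> \<tau> using that by simp
  then show "Aut (morse_complex K) \<cong> Aut K"
    using trivial_groups_iso M.trivial_Aut trivial_Aut all by metis
qed

text \<open>Keeps the degenerate complexes out of the two exceptional cases, whose models contain
  the vertices 0 and 1.\<close>

lemma simplicially_isomorphic_distinct:
  assumes "simplicially_isomorphic K L" "\<And>\<sigma> \<tau>. \<sigma> \<in> K \<Longrightarrow> \<tau> \<in> K \<Longrightarrow> \<sigma> = \<tau>" "{0 :: nat} \<in> L" "{1} \<in> L"
  shows False
proof -
  obtain f where "bij_betw f K L" using assms(1) by (auto simp: simplicially_isomorphic_def)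
  then obtain \<sigma> \<tau> where "\<sigma> \<in> K" "f \<sigma> = {0}" "\<tau> \<in> K" "f \<tau> = {1}"
    using assms(3,4) by (metis bij_betw_imp_surj_on imageE)
  then show False using assms(2)[of \<sigma> \<tau>] by auto
qed

text \<open>The cycle of length three is also the boundary of a triangle, so the second and third
  cases overlap; as separate implications, both descriptions of the group hold there.\<close>

theorem theorem1:
  fixes K :: "'a set set"
  assumes "abstract_complex K" and "finite K" and "connected_complex K"
  shows "(\<not> (\<exists>n\<ge>1. simplicially_isomorphic K (boundary_simplex n)) \<and>
          \<not> (\<exists>n\<ge>3. simplicially_isomorphic K (cycle_complex n))
            \<longrightarrow> Aut (morse_complex K) \<cong> Aut K) \<and>
         (\<forall>n\<ge>3. simplicially_isomorphic K (cycle_complex n)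
            \<longrightarrow> Aut (morse_complex K) \<cong> Aut (cycle_complex (2 * n))) \<and>
         (\<forall>n\<ge>1. simplicially_isomorphic K (boundary_simplex n)
            \<longrightarrow> Aut (morse_complex K) \<cong> Aut K \<times>\<times> integer_mod_group 2)"
proof -
  interpret finite_complex K using assms(1,2) by (rule finite_complex.intro)
  show ?thesis
  proof (cases "primitive_pairs K = {}")
    case True
    note np = no_pairs[OF assms(3) True]
    have b: "\<not> simplicially_isomorphic K (boundary_simplex n)" if "n \<ge> 1" for n
      using simplicially_isomorphic_distinct[OF _ np(1)] boundary_simplex_singleton[OF that]
        that by (metis zero_le)
    have c: "\<not> simplicially_isomorphic K (cycle_complex n)" if "n \<ge> 3" for n
      using simplicially_isomorphic_distinct[OF _ np(1)]
        cycle_complex_singleton[of 0 n] cycle_complex_singleton[of 1 n] that by fastforce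
    show ?thesis using np(2) b c by simp
  next
    case False
    interpret connected_complex_with_edge K
      using finite_complex_axioms assms(3) False
      by (simp add: connected_complex_with_edge_def connected_complex_with_edge_axioms_def)
    show ?thesis
    proof (intro conjI allI impI)
      assume no: "\<not> (\<exists>n\<ge>1. simplicially_isomorphic K (boundary_simplex n)) \<and>
        \<not> (\<exists>n\<ge>3. simplicially_isomorphic K (cycle_complex n))"
      have "Aut K = cover_group K"
      proof (rule Aut_eq_cover_group)
        fix f assume "f \<in> Bij K" "cover_reversing K f"
        from reversing_classification[OF this] no show "cover_preserving K f" by argo
      qed
      then show "Aut (morse_complex K) \<cong> Aut K" using Aut_morse_iso_cover_group by simp
    next
      fix n :: nat assume n: "n \<ge> 3" and iso: "simplicially_isomorphic K (cycle_complex n)"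
      obtain u where u: "inj_on u (\<Union>(cycle_complex n))" "K = image u ` cycle_complex n"
        by (rule simplicially_isomorphic_obtain[OF iso])
      then have inj: "inj_on u {..<n}" by (simp only: Union_cycle_complex)
      show "Aut (morse_complex K) \<cong> Aut (cycle_complex (2 * n))"
        by (rule iso_trans[OF Aut_morse_iso_cover_group cycle_cover_group[OF n inj u(2)]])
    next
      fix n :: nat assume n: "n \<ge> 1" and iso: "simplicially_isomorphic K (boundary_simplex n)"
      obtain u where u: "inj_on u (\<Union>(boundary_simplex n))" "K = image u ` boundary_simplex n"
        by (rule simplicially_isomorphic_obtain[OF iso])
      have "{0..n} \<subseteq> \<Union>(boundary_simplex n)"
        using boundary_simplex_singleton[OF n] by fastforce
      then have "inj_on u {0..n}" using u(1) by (rule inj_on_subset[rotated])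
      then have K: "K = {\<sigma>. \<sigma> \<noteq> {} \<and> \<sigma> \<subset> u ` {0..n}}"
        by (rule trans[OF u(2) image_boundary_simplex])
      show "Aut (morse_complex K) \<cong> Aut K \<times>\<times> integer_mod_group 2"
        by (rule iso_trans[OF Aut_morse_iso_cover_group boundary_cover_group[OF _ K]]) simp
    qed
  qed
qed

end
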